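(* Let $d\ge1$, $\omega=(\omega_1,\dots,\omega_d)\in(0,\infty)^d$, $V^{harm}(x)=\frac12(\omega_1^2x_1^2+\dots+\omega_d^2x_d^2)$, $\gamma\in(-1,\infty)$ and $\lambda_N=N^{1-\gamma}$. Let $H_N$ be the operator on $\ell^2(\mathbb{Z}^d)$ $$H_Nf(x)=\frac{N^2}{2}\sum_{y\in\mathbb{Z}^d:\,|x-y|=1}\big(f(x)-f(y)\big)+N^{2(1-\gamma)}V^{harm}(x/N)f(x).$$ Then for every $n\in\mathbb{N}_0$, $$\lim_{N\to\infty}\frac{E_n(H_N)}{\lambda_N}=e_n(V^{harm}).$$
   Context: $E_n(H_N)$ denotes the $n$-th eigenvalue of the self-adjoint operator $H_N$ (which has purely discrete spectrum) counted with multiplicity, starting with $n=0$ for the ground state. $e_0(V^{harm})\le e_1(V^{harm})\le\dots$ is the non-decreasing enumeration, with multiplicity (one entry per multi-index), of the numbers $\frac12\sum_{i=1}^d\omega_i(2n_i+1)$, $n_1,\dots,n_d\in\mathbb{N}_0$. *)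

theory Defs
  imports "HOL-Analysis.Analysis"
begin

definition sqnorm_int :: "int ^ 'd \<Rightarrow> int" where
  "sqnorm_int z = (\<Sum>i\<in>UNIV. (z $ i)^2)"

definition nbrs :: "int ^ 'd \<Rightarrow> (int ^ 'd) set" where
  "nbrs x = {y. sqnorm_int (x - y) = 1}"

definition Vharm :: "real ^ 'd \<Rightarrow> real ^ 'd \<Rightarrow> real" where
  "Vharm \<omega> x = (1/2) * (\<Sum>i\<in>UNIV. (\<omega> $ i)^2 * (x $ i)^2)"

definition lattice_pt :: "int ^ 'd \<Rightarrow> real ^ 'd" where
  "lattice_pt x = (\<chi> i. real_of_int (x $ i))"

definition HN :: "real ^ 'd \<Rightarrow> real \<Rightarrow> nat \<Rightarrow> (int ^ 'd \<Rightarrow> complex) \<Rightarrow> int ^ 'd \<Rightarrow> complex" where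
  "HN \<omega> \<gamma> N f x =
     complex_of_real ((real N)^2 / 2) * (\<Sum>y\<in>nbrs x. f x - f y)
     + complex_of_real (real N powr (2 * (1 - \<gamma>)) * Vharm \<omega> ((1 / real N) *\<^sub>R lattice_pt x)) * f x"

definition l2 :: "('a \<Rightarrow> complex) set" where
  "l2 = {f. (\<lambda>x. (norm (f x))^2) summable_on UNIV}"

definition is_eigenfun :: "real ^ 'd \<Rightarrow> real \<Rightarrow> nat \<Rightarrow> real \<Rightarrow> (int ^ 'd \<Rightarrow> complex) \<Rightarrow> bool" where
  "is_eigenfun \<omega> \<gamma> N \<mu> f \<longleftrightarrow>
     f \<in> l2 \<and> f \<noteq> (\<lambda>_. 0) \<and> (\<forall>x. HN \<omega> \<gamma> N f x = complex_of_real \<mu> * f x)"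

definition lin_indep :: "('a \<Rightarrow> complex) set \<Rightarrow> bool" where
  "lin_indep S \<longleftrightarrow> finite S \<and>
     (\<forall>c. (\<forall>x. (\<Sum>g\<in>S. c g * g x) = 0) \<longrightarrow> (\<forall>g\<in>S. c g = 0))"

text \<open>Counting with multiplicity: the number of eigenvalues \<le> t, counted with
  multiplicity, exceeds n iff there are n+1 linearly independent eigenfunctions with
  eigenvalues \<le> t.  E_n is the least such t, i.e. the n-th eigenvalue (from n = 0)
  in the non-decreasing enumeration with multiplicity.\<close>
definition En :: "real ^ 'd \<Rightarrow> real \<Rightarrow> nat \<Rightarrow> nat \<Rightarrow> real" where
  "En \<omega> \<gamma> N n = Inf {t. \<exists>S. lin_indep S \<and> card S > n \<and>
                    (\<forall>f\<in>S. \<exists>\<mu>\<le>t. is_eigenfun \<omega> \<gamma> N \<mu> f)}"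

definition harm_level :: "real ^ 'd \<Rightarrow> nat ^ 'd \<Rightarrow> real" where
  "harm_level \<omega> m = (1/2) * (\<Sum>i\<in>UNIV. (\<omega> $ i) * (2 * real (m $ i) + 1))"

text \<open>e_n: n-th element (from 0) of the non-decreasing enumeration with multiplicity
  (one entry per multi-index).\<close>
definition e_harm :: "real ^ 'd \<Rightarrow> nat \<Rightarrow> real" where
  "e_harm \<omega> n = Inf {t. card {m :: nat ^ 'd. harm_level \<omega> m \<le> t} > n}"

end

theory Submission
  imports Defs "HOL-Computational_Algebra.Polynomial" "HOL-Real_Asymp.Real_Asymp"
begin

text \<open>
  Divided by \<open>\<lambda>\<^sub>N\<close>, the operator is a sum over the coordinates of \<open>\<omega>\<^sub>i\<close> times the lattice oscillator
  \<open>f \<mapsto> b/2 (2 f(x) - f(x+1) - f(x-1)) + x\<^sup>2/(2b) f(x)\<close> on the integers with \<open>b = N\<^bsup>1+\<gamma>\<^esup>/\<omega>\<^sub>i \<rightarrow> \<infinity>\<close>.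
  Each oscillator has a complete system of eigenfunctions (minimisation of its quadratic form), so
  the eigenfunctions of \<open>H\<^sub>N\<close> are spanned by their products, and it suffices that the \<open>k\<close>-th
  eigenvalue of the oscillator tends to \<open>k + 1/2\<close>.  For that the oscillator is compared with
  \<open>J - J\<^sub>x\<close> in the spin-\<open>j\<close> representation of \<open>su(2)\<close>, \<open>J = j + 1/2 \<approx> b\<close>: in the basis
  of \<open>J\<^sub>z\<close> this is a lattice oscillator with a slowly varying hopping, and its
  eigenvalues are exactly \<open>1/2, 3/2, \<dots>\<close> with Kravchuk functions as eigenvectors.  Fourth moments of
  the eigenfunctions bound the difference of the two forms by \<open>O(1/J)\<close>, and the Ky Fan
  inequality, applied in both directions, gives convergence of the sums of the first eigenvalues,
  hence of every eigenvalue.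
\<close>

section \<open>Real square-summable functions\<close>

text \<open>Trial functions alone bound eigenvalues only from above. A second lattice operator with
  exactly known spectrum makes both bounds trial-function arguments: \<open>phi\<close> is tested in
  the oscillator form and \<open>psi\<close> in the spin form, with no passage between functions on
  the integers and on the line. Sums of eigenvalues are used because Ky Fan needs only the diagonal
  values of a form on the trial functions. The error in the lower bound contains \<open>ev\<close>
  itself, so the upper bound has to supply an a priori bound. The size 1/J is a matter of scaling:
  low eigenfunctions live at |x| of order sqrt J, the hopping is J/2 - x^2/(4J) up to higher order,
  and the potentials differ by terms of order x^4/J^3. The shift in J = j + 1/2 turns (j - x)(j + x
  + 1) into J^2 - (x + 1/2)^2 and puts the lowest level at J - j = 1/2. Counting eigenvalues of
  \<open>HN\<close> requires that every square-summable eigenfunction be a finite combination of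
  products, although \<open>is_eigenfun\<close> gives no decay beyond square summability.\<close>

lemma summable_on_dominated:
  fixes f g :: "'a \<Rightarrow> real"
  assumes "g summable_on A" "\<And>x. x \<in> A \<Longrightarrow> \<bar>f x\<bar> \<le> g x"
  shows "f summable_on A"
proof -
  have "(\<lambda>x. norm (f x)) summable_on A"
    by (rule summable_on_comparison_test[OF assms(1)]) (use assms(2) in auto)
  then show ?thesis by (rule abs_summable_summable)
qed

definition sqs :: "('a \<Rightarrow> real) \<Rightarrow> bool" where
  "sqs f \<longleftrightarrow> (\<lambda>x. (f x)\<^sup>2) summable_on UNIV"

text \<open>A non-summable product gets the default value 0, which is why additivity below carries
  \<open>sqs\<close> hypotheses while scaling does not.\<close>

definition ip :: "('a \<Rightarrow> real) \<Rightarrow> ('a \<Rightarrow> real) \<Rightarrow> real" where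
  "ip f g = (\<Sum>\<^sub>\<infinity>x. f x * g x)"

lemma ip_summable:
  assumes "sqs f" "sqs g"
  shows "(\<lambda>x. f x * g x) summable_on UNIV"
proof (rule summable_on_dominated)
  show "(\<lambda>x. (f x)\<^sup>2 + (g x)\<^sup>2) summable_on UNIV"
    using assms unfolding sqs_def by (intro summable_on_add)
  show "\<bar>f x * g x\<bar> \<le> (f x)\<^sup>2 + (g x)\<^sup>2" for x
  proof -
    have "2 * (\<bar>f x\<bar> * \<bar>g x\<bar>) \<le> (f x)\<^sup>2 + (g x)\<^sup>2"
      using sum_squares_bound[of "\<bar>f x\<bar>" "\<bar>g x\<bar>"] by (simp add: mult.assoc)
    moreover have "0 \<le> \<bar>f x\<bar> * \<bar>g x\<bar>" by simp
    ultimately show ?thesis unfolding abs_mult by linarith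
  qed
qed

lemma sqs_zero [simp]: "sqs (\<lambda>x. 0)"
  by (simp add: sqs_def)

lemma sqs_dominated:
  assumes "sqs g" "\<And>x. \<bar>f x\<bar> \<le> \<bar>g x\<bar>"
  shows "sqs f"
  unfolding sqs_def
proof (rule summable_on_dominated)
  show "(\<lambda>x. (g x)\<^sup>2) summable_on UNIV" using assms unfolding sqs_def by simp
  show "\<bar>(f x)\<^sup>2\<bar> \<le> (g x)\<^sup>2" for x
    using assms(2)[of x] by (simp add: abs_le_square_iff)
qed

lemma sqs_scale [intro]: "sqs f \<Longrightarrow> sqs (\<lambda>x. c * f x)"
  unfolding sqs_def power_mult_distrib by (rule summable_on_cmult_right)

lemma sqs_add [intro]:
  assumes "sqs f" "sqs g" shows "sqs (\<lambda>x. f x + g x)"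
proof -
  have "(\<lambda>x. (f x)\<^sup>2 + (g x)\<^sup>2 + 2 * (f x * g x)) summable_on UNIV"
    using assms ip_summable[OF assms] unfolding sqs_def
    by (intro summable_on_add summable_on_cmult_right) auto
  then show ?thesis
    unfolding sqs_def by (simp add: power2_sum mult.assoc)
qed

lemma sqs_diff [intro]:
  assumes "sqs f" "sqs g" shows "sqs (\<lambda>x. f x - g x)"
  using sqs_add[OF assms(1) sqs_scale[OF assms(2), of "-1"]] by simp

lemma sqs_sum [intro]:
  assumes "\<And>i. i \<in> I \<Longrightarrow> sqs (f i)"
  shows "sqs (\<lambda>x. \<Sum>i\<in>I. f i x)"
  using assms by (induction I rule: infinite_finite_induct) (auto intro: sqs_add)

lemma sqs_bounded_mult:
  assumes "sqs f" "\<And>x. \<bar>w x\<bar> \<le> C"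
  shows "sqs (\<lambda>x. w x * f x)"
proof (rule sqs_dominated[OF sqs_scale[OF assms(1), of C]])
  show "\<bar>w x * f x\<bar> \<le> \<bar>C * f x\<bar>" for x
    using assms(2)[of x] unfolding abs_mult by (intro mult_right_mono) auto
qed

lemma sqs_finite_support:
  assumes "finite {x. f x \<noteq> 0}"
  shows "sqs f"
  unfolding sqs_def
  by (rule finite_nonzero_values_imp_summable_on) (use assms in simp)

lemma sqs_reindex:
  assumes "bij p" shows "sqs (\<lambda>x. f (p x)) \<longleftrightarrow> sqs f"
  unfolding sqs_def using summable_on_reindex_bij_betw[OF assms, of "\<lambda>x. (f x)\<^sup>2"] by simp

lemma ip_reindex:
  assumes "bij p" shows "ip (\<lambda>x. f (p x)) (\<lambda>x. g (p x)) = ip f g"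
  unfolding ip_def using infsum_reindex_bij_betw[OF assms, of "\<lambda>x. f x * g x"] by simp

lemma ip_commute: "ip f g = ip g f"
  by (simp add: ip_def mult.commute)

lemma ip_add_left:
  assumes "sqs f" "sqs g" "sqs h"
  shows "ip (\<lambda>x. f x + g x) h = ip f h + ip g h"
  unfolding ip_def distrib_right using assms by (intro infsum_add ip_summable)

lemma ip_scale_left: "ip (\<lambda>x. c * f x) h = c * ip f h"
  unfolding ip_def mult.assoc by (rule infsum_cmult_right')

lemma ip_add_right:
  assumes "sqs f" "sqs g" "sqs h"
  shows "ip h (\<lambda>x. f x + g x) = ip h f + ip h g"
  using ip_add_left[OF assms] by (simp add: ip_commute)

lemma ip_scale_right: "ip h (\<lambda>x. c * f x) = c * ip h f"
  using ip_scale_left[of c f h] by (simp add: ip_commute)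

lemma ip_diff_left:
  assumes "sqs f" "sqs g" "sqs h"
  shows "ip (\<lambda>x. f x - g x) h = ip f h - ip g h"
  using ip_add_left[OF assms(1) sqs_scale[OF assms(2), of "-1"] assms(3)]
    ip_scale_left[of "-1" g h] by simp

lemma ip_diff_right:
  assumes "sqs f" "sqs g" "sqs h"
  shows "ip h (\<lambda>x. f x - g x) = ip h f - ip h g"
  using ip_diff_left[OF assms] by (simp add: ip_commute)

lemma ip_zero_left [simp]: "ip (\<lambda>x. 0) h = 0"
  by (simp add: ip_def)

lemma ip_sum_left:
  assumes "\<And>i. i \<in> I \<Longrightarrow> sqs (f i)" "sqs h"
  shows "ip (\<lambda>x. \<Sum>i\<in>I. f i x) h = (\<Sum>i\<in>I. ip (f i) h)"
  using assms
  by (induction I rule: infinite_finite_induct) (auto simp: ip_add_left sqs_sum)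

lemma ip_sum_right:
  assumes "\<And>i. i \<in> I \<Longrightarrow> sqs (f i)" "sqs h"
  shows "ip h (\<lambda>x. \<Sum>i\<in>I. f i x) = (\<Sum>i\<in>I. ip h (f i))"
  using ip_sum_left[OF assms] by (simp add: ip_commute)

lemma ip_self_nonneg: "0 \<le> ip f f"
  unfolding ip_def by (rule infsum_nonneg) simp

lemma finite_sum_le_ip_self:
  assumes "sqs f" "finite F"
  shows "(\<Sum>x\<in>F. (f x)\<^sup>2) \<le> ip f f"
  using finite_sum_le_infsum[OF assms(1)[unfolded sqs_def] assms(2)]
  by (simp add: ip_def power2_eq_square)

text \<open>Finite sums pass to pointwise limits, so this is how square summability and norm bounds
  survive such limits.\<close>

lemma ip_self_le_finite_sums:
  assumes "\<And>F. finite F \<Longrightarrow> (\<Sum>x\<in>F. (f x)\<^sup>2) \<le> C"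
  shows "sqs f" "ip f f \<le> C"
proof -
  show s: "sqs f"
    unfolding sqs_def
    by (rule nonneg_bdd_above_summable_on) (auto intro!: bdd_aboveI[of _ C] assms)
  show "ip f f \<le> C"
    using infsum_le_finite_sums[OF s[unfolded sqs_def], of C] assms
    by (simp add: ip_def power2_eq_square)
qed

lemma square_le_ip_self: "sqs f \<Longrightarrow> (f x)\<^sup>2 \<le> ip f f"
  using finite_sum_le_ip_self[of f "{x}"] by simp

lemma ip_self_add:
  assumes "sqs f" "sqs g"
  shows "ip (\<lambda>x. f x + t * g x) (\<lambda>x. f x + t * g x) = ip f f + 2 * t * ip f g + t\<^sup>2 * ip g g"
  using assms
  by (simp add: ip_add_left ip_add_right sqs_add sqs_scale ip_scale_left ip_scale_right
      ip_commute[of g f] power2_eq_square algebra_simps)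

text \<open>Near \<open>t = 0\<close> the linear term dominates, so a nonzero slope would produce a
  negative value. Applied to variations of a minimiser it gives the Euler-Lagrange equation.\<close>

lemma linear_coeff_zero:
  fixes p q :: real
  assumes "\<And>t. 0 \<le> 2 * t * p + t\<^sup>2 * q"
  shows "p = 0"
proof (rule ccontr)
  assume "p \<noteq> 0"
  define M where "M = \<bar>q\<bar> + 1"
  \<comment> \<open>Since \<open>q \<le> M\<close>, the quadratic term costs at most p^2/M here,
    against a gain of 2 p^2/M from the linear term.\<close>
  define t where "t = - p / M"
  have M: "M > 0" "q \<le> M" unfolding M_def by auto
  have "t\<^sup>2 * q \<le> t\<^sup>2 * M" using M by (intro mult_left_mono) auto
  also have "\<dots> = p\<^sup>2 / M" using M by (simp add: t_def power2_eq_square)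
  finally have "2 * t * p + t\<^sup>2 * q \<le> - (p\<^sup>2 / M)"
    by (simp add: t_def power2_eq_square)
  moreover have "p\<^sup>2 / M > 0" using M \<open>p \<noteq> 0\<close> by simp
  ultimately have "2 * t * p + t\<^sup>2 * q < 0" by linarith
  with assms[of t] show False by linarith
qed

lemma ip_Cauchy_Schwarz:
  assumes "sqs f" "sqs g"
  shows "(ip f g)\<^sup>2 \<le> ip f f * ip g g"
proof -
  have "0 \<le> ip f f + 2 * t * ip f g + t\<^sup>2 * ip g g" for t
    using ip_self_add[OF assms, of t] ip_self_nonneg[of "\<lambda>x. f x + t * g x"] by simp
  note q = this
  show ?thesis
  proof (cases "ip g g = 0")
    case True
    then have "0 \<le> ip f f + 2 * t * ip f g" for t using q[of t] by simp
    note lin = this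
    have "ip f g = 0"
    proof (rule ccontr)
      assume "ip f g \<noteq> 0"
      then have "2 * (- (ip f f + 1) / (2 * ip f g)) * ip f g = - (ip f f + 1)" by simp
      with lin[of "- (ip f f + 1) / (2 * ip f g)"]
      show False by linarith
    qed
    then show ?thesis using True by simp
  next
    case False
    then have p: "ip g g > 0" using ip_self_nonneg[of g] by simp
    have "0 \<le> ip f f - (ip f g)\<^sup>2 / ip g g"
      using q[of "- ip f g / ip g g"] p by (simp add: power2_eq_square)
    then show ?thesis using p by (simp add: divide_le_eq)
  qed
qed

text \<open>Pairing with \<open>delta a\<close> evaluates at \<open>a\<close>; completeness and weak
  equations are tested on these functions.\<close>

definition delta :: "'a \<Rightarrow> 'a \<Rightarrow> real" where
  "delta a x = (if x = a then 1 else 0)"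

lemma sqs_delta [simp]: "sqs (delta a)"
  by (rule sqs_finite_support) (simp add: delta_def)

lemma ip_delta_right [simp]: "ip f (delta a) = f a"
proof -
  have "ip f (delta a) = (\<Sum>\<^sub>\<infinity>x\<in>{a}. f x * delta a x)"
    unfolding ip_def by (rule infsum_cong_neutral) (auto simp: delta_def)
  then show ?thesis by (simp add: delta_def)
qed

lemma ip_delta_left [simp]: "ip (delta a) f = f a"
  by (simp add: ip_commute)

section \<open>Orthonormal families, Bessel and Ky Fan inequalities\<close>

definition orthonormal_on :: "'i set \<Rightarrow> ('i \<Rightarrow> 'a \<Rightarrow> real) \<Rightarrow> bool" where
  "orthonormal_on I \<psi> \<longleftrightarrow> (\<forall>i\<in>I. sqs (\<psi> i)) \<and>
     (\<forall>i\<in>I. \<forall>j\<in>I. ip (\<psi> i) (\<psi> j) = (if i = j then 1 else 0))"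

lemma orthonormal_on_subset: "orthonormal_on I \<psi> \<Longrightarrow> J \<subseteq> I \<Longrightarrow> orthonormal_on J \<psi>"
  unfolding orthonormal_on_def by blast

lemma orthonormal_onD:
  assumes "orthonormal_on I \<psi>" "i \<in> I"
  shows "sqs (\<psi> i)" "j \<in> I \<Longrightarrow> ip (\<psi> i) (\<psi> j) = (if i = j then 1 else 0)"
  using assms unfolding orthonormal_on_def by blast+

lemma orthonormal_residual:
  assumes o: "orthonormal_on I \<psi>" and I: "finite I" and f: "sqs f"
  defines "g \<equiv> \<lambda>x. f x - (\<Sum>i\<in>I. ip f (\<psi> i) * \<psi> i x)"
  shows "sqs g" "\<And>i. i \<in> I \<Longrightarrow> ip g (\<psi> i) = 0"
    "ip g g = ip f f - (\<Sum>i\<in>I. (ip f (\<psi> i))\<^sup>2)"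
proof -
  have s: "\<And>i. i \<in> I \<Longrightarrow> sqs (\<psi> i)" using o by (auto simp: orthonormal_on_def)
  show sg: "sqs g" unfolding g_def using s f by (intro sqs_diff sqs_sum sqs_scale)
  show z: "ip g (\<psi> i) = 0" if "i \<in> I" for i
  proof -
    have "ip g (\<psi> i) = ip f (\<psi> i) - (\<Sum>j\<in>I. ip f (\<psi> j) * ip (\<psi> j) (\<psi> i))"
      unfolding g_def using s f that
      by (subst ip_diff_left, auto intro!: sqs_sum, subst ip_sum_left)
         (auto simp: ip_scale_left)
    also have "(\<Sum>j\<in>I. ip f (\<psi> j) * ip (\<psi> j) (\<psi> i)) = (\<Sum>j\<in>I. if i = j then ip f (\<psi> j) else 0)"
      using orthonormal_onD(2)[OF o _ that] by (intro sum.cong) auto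
    also have "\<dots> = ip f (\<psi> i)" using that I by simp
    finally show ?thesis by simp
  qed
  have "ip g g = ip g f - (\<Sum>j\<in>I. ip f (\<psi> j) * ip g (\<psi> j))"
    by (subst (2) g_def, subst ip_diff_right)
       (use s f sg in \<open>auto intro!: sqs_sum simp: ip_scale_right ip_sum_right[OF sqs_scale]\<close>)
  also have "\<dots> = ip g f" using z by simp
  also have "ip g f = ip f f - (\<Sum>i\<in>I. (ip f (\<psi> i))\<^sup>2)"
    unfolding g_def using s f
    by (subst ip_diff_left)
       (auto simp: ip_sum_left[OF sqs_scale] ip_scale_left power2_eq_square ip_commute[of "\<psi> _" f]
         intro!: sqs_sum)
  finally show "ip g g = ip f f - (\<Sum>i\<in>I. (ip f (\<psi> i))\<^sup>2)" .
qed

lemma Bessel: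
  assumes "orthonormal_on I \<psi>" "finite I" "sqs f"
  shows "(\<Sum>i\<in>I. (ip f (\<psi> i))\<^sup>2) \<le> ip f f"
proof -
  have "0 \<le> ip f f - (\<Sum>i\<in>I. (ip f (\<psi> i))\<^sup>2)"
    unfolding orthonormal_residual(3)[OF assms, symmetric] by (rule ip_self_nonneg)
  then show ?thesis by simp
qed

text \<open>Each weight \<open>e k - e j\<close> is nonnegative, and Bessel over the trial functions
  caps its total coefficient by 1, so the total loss is at most the sum of \<open>e k - e j\<close>
  over j < k. The form enters only through the numbers \<open>q l\<close>; this lets oscillator and
  spin operator exchange roles.\<close>

lemma Ky_Fan:
  fixes e :: "nat \<Rightarrow> real" and q :: "nat \<Rightarrow> real"
  assumes o: "orthonormal_on {..<k} \<psi>" and of: "orthonormal_on {..k} f"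
    and mono: "\<And>j. j < k \<Longrightarrow> e j \<le> e k"
    and q: "\<And>l. l \<le> k \<Longrightarrow> q l \<ge> e k - (\<Sum>j<k. (e k - e j) * (ip (f l) (\<psi> j))\<^sup>2)"
  shows "(\<Sum>l\<le>k. e l) \<le> (\<Sum>l\<le>k. q l)"
proof -
  have B: "(\<Sum>l\<le>k. (ip (f l) (\<psi> j))\<^sup>2) \<le> 1" if "j < k" for j
    using Bessel[OF of, of "\<psi> j"] orthonormal_onD[OF o, of j] that by (simp add: ip_commute)
  have "(\<Sum>l\<le>k. \<Sum>j<k. (e k - e j) * (ip (f l) (\<psi> j))\<^sup>2)
      = (\<Sum>j<k. (e k - e j) * (\<Sum>l\<le>k. (ip (f l) (\<psi> j))\<^sup>2))"
    by (subst sum.swap) (simp add: sum_distrib_left)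
  also have "\<dots> \<le> (\<Sum>j<k. (e k - e j) * 1)"
    using B mono by (intro sum_mono mult_left_mono) auto
  finally have "(\<Sum>l\<le>k. \<Sum>j<k. (e k - e j) * (ip (f l) (\<psi> j))\<^sup>2) \<le> of_nat k * e k - (\<Sum>j<k. e j)"
    by (simp add: sum_subtractf)
  moreover have "(\<Sum>l\<le>k. e k - (\<Sum>j<k. (e k - e j) * (ip (f l) (\<psi> j))\<^sup>2)) \<le> (\<Sum>l\<le>k. q l)"
    using q by (intro sum_mono) auto
  moreover have "(\<Sum>l\<le>k. e l) = (\<Sum>l<k. e l) + e k"
    by (simp flip: lessThan_Suc_atMost)
  ultimately show ?thesis
    by (simp add: sum_subtractf distrib_right)
qed

section \<open>Spectral theory of the lattice oscillator on the integers\<close>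

lemma bij_int_shift [simp]: "bij (\<lambda>x::int. x + c)" "bij (\<lambda>x::int. x - c)"
  by (rule bij_betw_byWitness[where f' = "\<lambda>x. x - c"]; auto)
     (rule bij_betw_byWitness[where f' = "\<lambda>x. x + c"]; auto)

lemma sqs_shift [intro]:
  fixes f :: "int \<Rightarrow> real"
  assumes "sqs f" shows "sqs (\<lambda>x. f (x + 1))" "sqs (\<lambda>x. f (x - 1))"
  using assms sqs_reindex[OF bij_int_shift(1)[of 1], of f] sqs_reindex[OF bij_int_shift(2)[of 1], of f]
  by auto

text \<open>Discrete integration by parts on the integers: a summable \<open>G\<close> leaves no
  boundary terms.\<close>

lemma has_sum_telescope_int:
  fixes G :: "int \<Rightarrow> real"
  assumes "G summable_on UNIV"
  shows "((\<lambda>x. G x - G (x - 1)) has_sum 0) UNIV"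
proof -
  have "((\<lambda>x. G (x - 1)) has_sum infsum G UNIV) UNIV"
    using has_sum_reindex_bij_betw[OF bij_int_shift(2)[of 1], of G] assms by simp
  from has_sum_add[OF has_sum_infsum[OF assms] has_sum_uminusI[OF this]] show ?thesis by simp
qed

section \<open>The oscillator form, its domain and its operator\<close>

definition fdiff :: "(int \<Rightarrow> real) \<Rightarrow> int \<Rightarrow> real" where
  "fdiff f x = f (x + 1) - f x"

definition xmul :: "(int \<Rightarrow> real) \<Rightarrow> int \<Rightarrow> real" where
  "xmul f x = of_int x * f x"

definition qdom :: "(int \<Rightarrow> real) \<Rightarrow> bool" where
  "qdom f \<longleftrightarrow> sqs f \<and> sqs (xmul f)"

definition qf :: "real \<Rightarrow> (int \<Rightarrow> real) \<Rightarrow> (int \<Rightarrow> real) \<Rightarrow> real" where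
  "qf b f g = b / 2 * ip (fdiff f) (fdiff g) + 1 / (2 * b) * ip (xmul f) (xmul g)"

definition osc :: "real \<Rightarrow> (int \<Rightarrow> real) \<Rightarrow> int \<Rightarrow> real" where
  "osc b f x = b / 2 * (2 * f x - f (x + 1) - f (x - 1)) + (of_int x)\<^sup>2 / (2 * b) * f x"

lemma sqs_fdiff [intro]: "sqs f \<Longrightarrow> sqs (fdiff f)"
  unfolding fdiff_def by (intro sqs_diff sqs_shift)

lemma xmul_linear:
  "xmul (\<lambda>x. f x + g x) = (\<lambda>x. xmul f x + xmul g x)"
  "xmul (\<lambda>x. c * f x) = (\<lambda>x. c * xmul f x)"
  "fdiff (\<lambda>x. f x + g x) = (\<lambda>x. fdiff f x + fdiff g x)"
  "fdiff (\<lambda>x. c * f x) = (\<lambda>x. c * fdiff f x)"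
  by (auto simp: xmul_def fdiff_def algebra_simps)

lemma qdomD: "qdom f \<Longrightarrow> sqs f" "qdom f \<Longrightarrow> sqs (xmul f)" "qdom f \<Longrightarrow> sqs (fdiff f)"
  by (auto simp: qdom_def)

lemma qdom_scale: "qdom f \<Longrightarrow> qdom (\<lambda>x. c * f x)"
  unfolding qdom_def xmul_linear by blast

lemma qdom_add: "qdom f \<Longrightarrow> qdom g \<Longrightarrow> qdom (\<lambda>x. f x + g x)"
  unfolding qdom_def xmul_linear by blast

lemma qdom_diff: "qdom f \<Longrightarrow> qdom g \<Longrightarrow> qdom (\<lambda>x. f x - g x)"
  using qdom_add[of f "\<lambda>x. -1 * g x"] qdom_scale[of g "-1"] by simp

lemma qdom_finite_support:
  assumes "finite {x. f x \<noteq> 0}" shows "qdom f"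
  unfolding qdom_def using assms
  by (auto intro!: sqs_finite_support simp: xmul_def elim: rev_finite_subset)

lemma qdom_delta [simp]: "qdom (delta a)"
  by (rule qdom_finite_support) (simp add: delta_def)

lemma qdom_sum:
  assumes "\<And>i. i \<in> I \<Longrightarrow> qdom (f i)" shows "qdom (\<lambda>x. \<Sum>i\<in>I. f i x)"
  using assms
  by (induction I rule: infinite_finite_induct) (auto intro: qdom_add qdom_finite_support)

lemma qf_commute: "qf b f g = qf b g f"
  by (simp add: qf_def ip_commute)

lemma qf_add_left:
  assumes "qdom f" "qdom g" "qdom h"
  shows "qf b (\<lambda>x. f x + g x) h = qf b f h + qf b g h"
  using assms unfolding qf_def xmul_linear
  by (simp add: ip_add_left qdomD add_divide_distrib distrib_left)

lemma qf_scale_left: "qf b (\<lambda>x. c * f x) h = c * qf b f h"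
  unfolding qf_def xmul_linear by (simp add: ip_scale_left algebra_simps)

lemma qf_add_right:
  assumes "qdom f" "qdom g" "qdom h"
  shows "qf b h (\<lambda>x. f x + g x) = qf b h f + qf b h g"
  using qf_add_left[OF assms] by (simp add: qf_commute)

lemma qf_scale_right: "qf b h (\<lambda>x. c * f x) = c * qf b h f"
  using qf_scale_left[of b c f h] by (simp add: qf_commute)

lemma qf_sum_left:
  assumes "\<And>i. i \<in> I \<Longrightarrow> qdom (f i)" "qdom h"
  shows "qf b (\<lambda>x. \<Sum>i\<in>I. f i x) h = (\<Sum>i\<in>I. qf b (f i) h)"
  using assms
proof (induction I rule: infinite_finite_induct)
  case (insert i I)
  then show ?case by (simp add: qf_add_left qdom_sum)
qed (simp_all add: qf_def xmul_def[abs_def] fdiff_def[abs_def])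

lemma qf_nonneg: "b > 0 \<Longrightarrow> 0 \<le> qf b f f"
  by (simp add: qf_def ip_self_nonneg)

lemma qf_self_add:
  assumes "qdom f" "qdom g"
  shows "qf b (\<lambda>x. f x + t * g x) (\<lambda>x. f x + t * g x)
    = qf b f f + 2 * t * qf b f g + t\<^sup>2 * qf b g g"
  using assms
  by (simp add: qf_add_left qf_add_right qdom_add qdom_scale qf_scale_left qf_scale_right
      qf_commute[of b g f] power2_eq_square algebra_simps)

text \<open>Membership of \<open>g\<close> in the form domain does not make \<open>osc b g\<close>
  square summable. The product with \<open>f\<close> is nevertheless summable, because x^2 can be
  shared as one factor x for each function; \<open>G\<close> carries out the summation by
  parts.\<close>

lemma qf_eq_ip_osc:
  assumes "qdom f" "qdom g"
  shows "((\<lambda>x. f x * osc b g x) has_sum qf b f g) UNIV"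
proof -
  define G where "G x = - (b / 2) * (f (x + 1) * fdiff g x)" for x
  have "G summable_on UNIV"
    unfolding G_def using assms
    by (intro summable_on_cmult_right ip_summable sqs_shift) (auto simp: qdomD)
  note tel = has_sum_telescope_int[OF this]
  have 1: "((\<lambda>x. b / 2 * (fdiff f x * fdiff g x)) has_sum b / 2 * ip (fdiff f) (fdiff g)) UNIV"
    unfolding ip_def using assms
    by (intro has_sum_cmult_right has_sum_infsum ip_summable) (auto simp: qdomD)
  have 2: "((\<lambda>x. 1 / (2 * b) * (xmul f x * xmul g x)) has_sum 1 / (2 * b) * ip (xmul f) (xmul g)) UNIV"
    unfolding ip_def using assms
    by (intro has_sum_cmult_right has_sum_infsum ip_summable) (auto simp: qdomD)
  have "((\<lambda>x. (b / 2 * (fdiff f x * fdiff g x) + 1 / (2 * b) * (xmul f x * xmul g x))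
      + (G x - G (x - 1))) has_sum qf b f g + 0) UNIV"
    unfolding qf_def by (intro has_sum_add 1 2 tel)
  also have "(\<lambda>x. (b / 2 * (fdiff f x * fdiff g x) + 1 / (2 * b) * (xmul f x * xmul g x))
      + (G x - G (x - 1))) = (\<lambda>x. f x * osc b g x)"
    unfolding G_def fdiff_def xmul_def osc_def by (rule ext) (simp add: power2_eq_square algebra_simps)
  finally show ?thesis by simp
qed

lemma qf_eigen:
  assumes "qdom f" "qdom g" "\<And>x. osc b g x = E * g x"
  shows "qf b f g = E * ip f g"
proof -
  have "qf b f g = (\<Sum>\<^sub>\<infinity>x. f x * osc b g x)"
    using infsumI[OF qf_eq_ip_osc[OF assms(1,2), of b]] by simp
  also have "\<dots> = E * ip f g"
    unfolding assms(3) ip_def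
    by (subst infsum_cmult_right'[symmetric]) (simp add: mult.left_commute)
  finally show ?thesis .
qed

text \<open>Turns a weak equation, tested on point masses, into the pointwise eigenvalue
  equation.\<close>

lemma osc_delta: "qdom f \<Longrightarrow> qf b (delta a) f = osc b f a"
  using infsumI[OF qf_eq_ip_osc[OF qdom_delta[of a], of f b]] ip_delta_left[of a "osc b f"]
  by (simp add: ip_def)

section \<open>Minimisers of the form by the direct method\<close>

definition eigen_system :: "real \<Rightarrow> nat \<Rightarrow> (nat \<Rightarrow> int \<Rightarrow> real) \<Rightarrow> (nat \<Rightarrow> real) \<Rightarrow> bool" where
  "eigen_system b k \<psi> E \<longleftrightarrow> orthonormal_on {..<k} \<psi> \<and>
     (\<forall>j<k. qdom (\<psi> j) \<and> (\<forall>x. osc b (\<psi> j) x = E j * \<psi> j x))"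

lemma qdom_residual:
  assumes "eigen_system b k \<psi> E" "qdom f"
  shows "qdom (\<lambda>x. f x - (\<Sum>j<k. ip f (\<psi> j) * \<psi> j x))"
  using assms unfolding eigen_system_def by (intro qdom_diff qdom_sum qdom_scale) auto

text \<open>Chebyshev: outside the box x^2 exceeds M^2, so the tail is at most the second moment
  divided by M^2.\<close>

lemma ip_le_box_sum:
  fixes M :: nat
  assumes f: "sqs (xmul f)" and M: "M > 0"
  shows "ip f f \<le> (\<Sum>x\<in>{- int M..int M}. (f x)\<^sup>2) + ip (xmul f) (xmul f) / (real M)\<^sup>2"
proof (rule ip_self_le_finite_sums(2))
  fix F :: "int set" assume F: "finite F"
  define B where "B = {- int M..int M}"
  have B: "finite B" by (simp add: B_def)
  have "(\<Sum>x\<in>F. (f x)\<^sup>2) \<le> (\<Sum>x\<in>B \<union> (F - B). (f x)\<^sup>2)"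
    using F B by (intro sum_mono2) auto
  also have "\<dots> = (\<Sum>x\<in>B. (f x)\<^sup>2) + (\<Sum>x\<in>F - B. (f x)\<^sup>2)"
    using F B by (intro sum.union_disjoint) auto
  also have "(\<Sum>x\<in>F - B. (f x)\<^sup>2) \<le> (\<Sum>x\<in>F - B. (xmul f x)\<^sup>2 / (real M)\<^sup>2)"
  proof (rule sum_mono)
    fix x assume "x \<in> F - B"
    then have "\<bar>real_of_int x\<bar> \<ge> real M" unfolding B_def by auto
    then have "(real M)\<^sup>2 \<le> (real_of_int x)\<^sup>2"
      using abs_le_square_iff[of "real M" "real_of_int x"] by simp
    then have "(real M)\<^sup>2 * (f x)\<^sup>2 \<le> (real_of_int x)\<^sup>2 * (f x)\<^sup>2"
      by (rule mult_right_mono) simp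
    then show "(f x)\<^sup>2 \<le> (xmul f x)\<^sup>2 / (real M)\<^sup>2"
      using M by (simp add: xmul_def power_mult_distrib field_simps)
  qed
  also have "\<dots> = (\<Sum>x\<in>F - B. (xmul f x)\<^sup>2) / (real M)\<^sup>2"
    by (simp add: sum_divide_distrib)
  also have "\<dots> \<le> ip (xmul f) (xmul f) / (real M)\<^sup>2"
    using finite_sum_le_ip_self[OF f, of "F - B"] F by (intro divide_right_mono) auto
  finally show "(\<Sum>x\<in>F. (f x)\<^sup>2) \<le>
      (\<Sum>x\<in>{- int M..int M}. (f x)\<^sup>2) + ip (xmul f) (xmul f) / (real M)\<^sup>2"
    by (simp add: B_def)
qed

text \<open>Minimising sequences stay tight because the form controls the second moment.\<close>
lemma ip_tendsto_of_pointwise: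
  fixes f :: "nat \<Rightarrow> int \<Rightarrow> real"
  assumes f: "\<And>n. sqs (xmul (f n))" "\<And>n. ip (xmul (f n)) (xmul (f n)) \<le> R"
    and lim: "\<And>x. (\<lambda>n. f n x) \<longlonglongrightarrow> 0"
  shows "(\<lambda>n. ip (f n) (f n)) \<longlonglongrightarrow> 0"
proof (rule LIMSEQ_I)
  fix e :: real assume e: "e > 0"
  have R: "R \<ge> 0" using f(2)[of 0] ip_self_nonneg[of "xmul (f 0)"] by linarith
  obtain M :: nat where M: "M > 2 * R / e + 1" using reals_Archimedean2 by blast
  have M0: "real M > 1" using M R e by (smt (verit) divide_nonneg_pos mult_nonneg_nonneg)
  have RM: "R / (real M)\<^sup>2 < e / 2"
  proof -
    have "2 * R / e < real M" using M by linarith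
    then have "2 * R < e * real M" using e by (simp add: field_simps)
    also have "\<dots> \<le> e * (real M)\<^sup>2"
      using e M0 by (intro mult_left_mono self_le_power) auto
    finally show ?thesis using M0 by (simp add: field_simps)
  qed
  define B where "B = {- int M..int M}"
  have tail: "ip (f n) (f n) \<le> (\<Sum>x\<in>B. (f n x)\<^sup>2) + R / (real M)\<^sup>2" for n
  proof -
    have "ip (xmul (f n)) (xmul (f n)) / (real M)\<^sup>2 \<le> R / (real M)\<^sup>2"
      using f(2) by (intro divide_right_mono) auto
    then show ?thesis using ip_le_box_sum[OF f(1), of M n] M0 by (simp add: B_def)
  qed
  have "(\<lambda>n. \<Sum>x\<in>B. (f n x)\<^sup>2) \<longlonglongrightarrow> (\<Sum>x\<in>B. 0\<^sup>2)"
    by (intro tendsto_sum tendsto_power lim)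
  then have "(\<lambda>n. \<Sum>x\<in>B. (f n x)\<^sup>2) \<longlonglongrightarrow> 0" by simp
  then obtain n0 where n0: "\<And>n. n \<ge> n0 \<Longrightarrow> \<bar>\<Sum>x\<in>B. (f n x)\<^sup>2\<bar> < e / 2"
    using LIMSEQ_D[OF _ half_gt_zero[OF e]] by (metis diff_zero real_norm_def)
  show "\<exists>n0. \<forall>n\<ge>n0. norm (ip (f n) (f n) - 0) < e"
  proof (intro exI allI impI)
    fix n assume "n \<ge> n0"
    have "ip (f n) (f n) < e"
      using n0[OF \<open>n \<ge> n0\<close>] tail[of n] RM by linarith
    then show "norm (ip (f n) (f n) - 0) < e" using ip_self_nonneg[of "f n"] by simp
  qed
qed

text \<open>Tychonoff for a product of copies of [-1,1]; the index set is countable, so the product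
  is metrizable and compactness is sequential.\<close>

lemma pointwise_convergent_subsequence:
  fixes f :: "nat \<Rightarrow> int \<Rightarrow> real"
  assumes "\<And>n x. \<bar>f n x\<bar> \<le> 1"
  obtains r g where "strict_mono r" "\<And>x. (\<lambda>n. f (r n) x) \<longlonglongrightarrow> g x"
proof -
  have "compactin (product_topology (\<lambda>_. euclidean) UNIV) (PiE UNIV (\<lambda>_::int. {-1..1::real}))"
    by (subst compactin_PiE) auto
  then have "compact (PiE UNIV (\<lambda>_::int. {-1..1::real}))"
    by (simp add: euclidean_product_topology)
  then have "seq_compact (PiE UNIV (\<lambda>_::int. {-1..1::real}))"
    by (simp add: compact_eq_seq_compact_metric)
  moreover have "\<forall>n. f n \<in> PiE UNIV (\<lambda>_::int. {-1..1::real})"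
    using assms by (auto simp: abs_le_iff minus_le_iff)
  ultimately obtain g r where r: "strict_mono r" "(f \<circ> r) \<longlonglongrightarrow> g"
    unfolding seq_compact_def by blast
  have "(\<lambda>n. f (r n) x) \<longlonglongrightarrow> g x" for x
  proof -
    have "continuous_on UNIV (\<lambda>h::int \<Rightarrow> real. h x)" by simp
    then have "isCont (\<lambda>h::int \<Rightarrow> real. h x) g"
      using continuous_on_eq_continuous_at[OF open_UNIV] by blast
    from isCont_tendsto_compose[OF this r(2)] show ?thesis by (simp add: o_def)
  qed
  with r(1) that show ?thesis by blast
qed

lemma ip_self_diff_le:
  assumes "sqs u" "sqs v"
  shows "ip (\<lambda>x. u x - v x) (\<lambda>x. u x - v x) \<le> 2 * ip u u + 2 * ip v v"
  using ip_self_add[OF assms, of 1] ip_self_add[OF assms, of "-1"]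
    ip_self_nonneg[of "\<lambda>x. u x + 1 * v x"]
  by simp

text \<open>A count of mass: if the squares summed to at least 1 at each of the k + 1 sites
  \<open>0..int k\<close>, the total would exceed the k supplied by the k unit norms. At a site with
  less, the point mass has a nonzero residual, which is normalised.\<close>

lemma eigen_system_not_complete:
  assumes "eigen_system b k \<psi> E"
  obtains f where "qdom f" "ip f f = 1" "\<And>j. j < k \<Longrightarrow> ip f (\<psi> j) = 0"
proof -
  have o: "orthonormal_on {..<k} \<psi>" using assms by (simp add: eigen_system_def)
  have "\<exists>a. (\<Sum>j<k. (\<psi> j a)\<^sup>2) < 1"
  proof (rule ccontr)
    assume "\<not> ?thesis"
    then have "1 \<le> (\<Sum>j<k. (\<psi> j a)\<^sup>2)" for a by (simp add: not_less)
    then have "(\<Sum>a\<in>{0..int k}. 1) \<le> (\<Sum>a\<in>{0..int k}. \<Sum>j<k. (\<psi> j a)\<^sup>2)"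
      by (intro sum_mono)
    also have "\<dots> = (\<Sum>j<k. \<Sum>a\<in>{0..int k}. (\<psi> j a)\<^sup>2)" by (rule sum.swap)
    also have "\<dots> \<le> (\<Sum>j<k. 1)"
    proof (rule sum_mono)
      fix j assume "j \<in> {..<k}"
      then show "(\<Sum>a\<in>{0..int k}. (\<psi> j a)\<^sup>2) \<le> 1"
        using finite_sum_le_ip_self[of "\<psi> j" "{0..int k}"] orthonormal_onD[OF o, of j] by simp
    qed
    finally show False by simp
  qed
  then obtain a where a: "(\<Sum>j<k. (\<psi> j a)\<^sup>2) < 1" by blast
  define g where "g = (\<lambda>x. delta a x - (\<Sum>j<k. ip (delta a) (\<psi> j) * \<psi> j x))"
  have r: "\<And>j. j < k \<Longrightarrow> ip g (\<psi> j) = 0" "ip g g = 1 - (\<Sum>j<k. (\<psi> j a)\<^sup>2)"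
    using orthonormal_residual(2,3)[OF o finite_lessThan sqs_delta[of a]]
    by (simp_all add: g_def delta_def)
  have d: "qdom g" unfolding g_def by (rule qdom_residual[OF assms qdom_delta])
  define c where "c = 1 / sqrt (ip g g)"
  have c: "c * (c * ip g g) = 1" using r(2) a by (simp add: c_def)
  show ?thesis
  proof (rule that)
    show "qdom (\<lambda>x. c * g x)" by (rule qdom_scale[OF d])
    show "ip (\<lambda>x. c * g x) (\<lambda>x. c * g x) = 1" using c by (simp add: ip_scale_left ip_scale_right)
    show "\<And>j. j < k \<Longrightarrow> ip (\<lambda>x. c * g x) (\<psi> j) = 0" using r(1) by (simp add: ip_scale_left)
  qed
qed

lemma qf_has_sum:
  assumes "qdom f"
  shows "((\<lambda>x. b / 2 * (fdiff f x)\<^sup>2 + 1 / (2 * b) * (xmul f x)\<^sup>2) has_sum qf b f f) UNIV"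
  unfolding qf_def ip_def power2_eq_square using assms
  by (intro has_sum_add has_sum_cmult_right has_sum_infsum ip_summable) (auto simp: qdomD)

lemma qf_le_finite_sums:
  assumes "qdom f"
    and "\<And>F. finite F \<Longrightarrow>
      (\<Sum>x\<in>F. b / 2 * (fdiff f x)\<^sup>2 + 1 / (2 * b) * (xmul f x)\<^sup>2) \<le> C"
  shows "qf b f f \<le> C"
  using has_sum_le_finite_sums[OF qf_has_sum[OF assms(1)]] assms(2) by blast

text \<open>A minimising sequence has a pointwise convergent subsequence. Tightness makes the
  convergence strong, so normalisation and orthogonality survive, and the form can only drop in the
  limit because it is a supremum of finite sums, each continuous under pointwise
  convergence.\<close>

lemma minimizer_exists:
  assumes b: "b > 0" and es: "eigen_system b k \<psi> E"
  obtains g m where "qdom g" "ip g g = 1" "\<And>j. j < k \<Longrightarrow> ip g (\<psi> j) = 0" "qf b g g = m"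
    "\<And>u. qdom u \<Longrightarrow> (\<And>j. j < k \<Longrightarrow> ip u (\<psi> j) = 0) \<Longrightarrow> m * ip u u \<le> qf b u u"
proof -
  define C where "C = {f. qdom f \<and> ip f f = 1 \<and> (\<forall>j<k. ip f (\<psi> j) = 0)}"
  define m where "m = Inf ((\<lambda>f. qf b f f) ` C)"
  have sp: "\<And>j. j < k \<Longrightarrow> sqs (\<psi> j)" using es by (simp add: eigen_system_def orthonormal_on_def)
  have ne: "C \<noteq> {}" using eigen_system_not_complete[OF es] unfolding C_def by blast
  have bdd: "bdd_below ((\<lambda>f. qf b f f) ` C)"
    using qf_nonneg[OF b] by (intro bdd_belowI2[of _ 0]) auto
  have low: "m * ip u u \<le> qf b u u" if u: "qdom u" "\<And>j. j < k \<Longrightarrow> ip u (\<psi> j) = 0" for u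
  proof (cases "ip u u = 0")
    case True then show ?thesis using qf_nonneg[OF b, of u] by simp
  next
    case False
    then have p: "ip u u > 0" using ip_self_nonneg[of u] by simp
    define c where "c = 1 / sqrt (ip u u)"
    have c: "c * (c * z) = z / ip u u" for z using p by (simp add: c_def)
    have "(\<lambda>x. c * u x) \<in> C"
      unfolding C_def using u p c by (simp add: qdom_scale ip_scale_left ip_scale_right)
    then have "m \<le> qf b (\<lambda>x. c * u x) (\<lambda>x. c * u x)"
      unfolding m_def by (intro cInf_lower bdd imageI)
    also have "\<dots> = qf b u u / ip u u" using c by (simp add: qf_scale_left qf_scale_right)
    finally show ?thesis using p by (simp add: field_simps)
  qed
  have "\<exists>f. f \<in> C \<and> qf b f f < m + 1 / (real n + 1)" for n :: nat
  proof -
    have "Inf ((\<lambda>f. qf b f f) ` C) < m + 1 / (real n + 1)" unfolding m_def by simp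
    from cInf_lessD[OF _ this] ne show ?thesis by blast
  qed
  then obtain f where f: "\<And>n. f n \<in> C" "\<And>n. qf b (f n) (f n) < m + 1 / (real n + 1)"
    by metis
  have fC: "qdom (f n)" "ip (f n) (f n) = 1" "\<And>j. j < k \<Longrightarrow> ip (f n) (\<psi> j) = 0" for n
    using f(1)[of n] by (auto simp: C_def)
  have "\<bar>f n x\<bar> \<le> 1" for n x
    using square_le_ip_self[of "f n" x] fC[of n] by (simp add: qdomD abs_square_le_1)
  then obtain r g where r: "strict_mono r" and lim0: "\<And>x. (\<lambda>n. f (r n) x) \<longlonglongrightarrow> g x"
    using pointwise_convergent_subsequence by blast
  define h where "h n = f (r n)" for n
  have h: "qdom (h n)" "ip (h n) (h n) = 1" "\<And>j. j < k \<Longrightarrow> ip (h n) (\<psi> j) = 0" for n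
    using fC by (auto simp: h_def)
  have lim: "\<And>x. (\<lambda>n. h n x) \<longlonglongrightarrow> g x" using lim0 by (simp add: h_def)
  have hq: "qf b (h n) (h n) \<le> m + 1 / (real n + 1)" for n
  proof -
    have "1 / (real (r n) + 1) \<le> 1 / (real n + 1)"
      using seq_suble[OF r, of n] by (intro divide_left_mono) auto
    with f(2)[of "r n"] show ?thesis by (simp add: h_def)
  qed
  define R where "R = 2 * b * (m + 1)"
  have hR: "ip (xmul (h n)) (xmul (h n)) \<le> R" for n
  proof -
    have "1 / (real n + 1) \<le> 1" by simp
    with hq[of n] have "qf b (h n) (h n) \<le> m + 1" by linarith
    moreover have "0 \<le> b / 2 * ip (fdiff (h n)) (fdiff (h n))"
      using b by (intro mult_nonneg_nonneg ip_self_nonneg) auto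
    ultimately have "1 / (2 * b) * ip (xmul (h n)) (xmul (h n)) \<le> m + 1"
      unfolding qf_def by linarith
    then show ?thesis using b by (simp add: R_def field_simps)
  qed
  have sg: "sqs g"
  proof (rule ip_self_le_finite_sums(1))
    fix F :: "int set" assume F: "finite F"
    have "(\<lambda>n. \<Sum>x\<in>F. (h n x)\<^sup>2) \<longlonglongrightarrow> (\<Sum>x\<in>F. (g x)\<^sup>2)"
      by (intro tendsto_sum tendsto_power lim)
    then show "(\<Sum>x\<in>F. (g x)\<^sup>2) \<le> 1"
      by (rule LIMSEQ_le_const2) (use finite_sum_le_ip_self[OF qdomD(1)[OF h(1)] F] h(2) in auto)
  qed
  have xg: "sqs (xmul g)" "ip (xmul g) (xmul g) \<le> R"
  proof -
    have "(\<Sum>x\<in>F. (xmul g x)\<^sup>2) \<le> R" if F: "finite F" for F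
    proof -
      have "(\<lambda>n. \<Sum>x\<in>F. (xmul (h n) x)\<^sup>2) \<longlonglongrightarrow> (\<Sum>x\<in>F. (xmul g x)\<^sup>2)"
        unfolding xmul_def by (intro tendsto_sum tendsto_power tendsto_mult lim tendsto_const)
      then show ?thesis
        by (rule LIMSEQ_le_const2)
           (use order_trans[OF finite_sum_le_ip_self[OF qdomD(2)[OF h(1)] F] hR] in auto)
    qed
    then show "sqs (xmul g)" "ip (xmul g) (xmul g) \<le> R"
      using ip_self_le_finite_sums[of "xmul g" R] by auto
  qed
  have dg: "qdom g" using sg xg by (simp add: qdom_def)
  define d where "d n = (\<lambda>x. h n x - g x)" for n
  have dd: "qdom (d n)" for n unfolding d_def by (rule qdom_diff[OF h(1) dg])
  have d0: "(\<lambda>n. ip (d n) (d n)) \<longlonglongrightarrow> 0"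
  proof (rule ip_tendsto_of_pointwise)
    show "sqs (xmul (d n))" for n using dd by (simp add: qdomD)
    show "(\<lambda>n. d n x) \<longlonglongrightarrow> 0" for x
      unfolding d_def using tendsto_diff[OF lim[of x] tendsto_const[of "g x"]] by simp
    have "xmul (d n) = (\<lambda>x. xmul (h n) x - xmul g x)" for n
      by (auto simp: d_def xmul_def algebra_simps)
    then show "ip (xmul (d n)) (xmul (d n)) \<le> 4 * R" for n
      using ip_self_diff_le[OF qdomD(2)[OF h(1)[of n]] xg(1)] hR[of n] xg(2) by simp
  qed
  have weak: "(\<lambda>n. ip (h n) p) \<longlonglongrightarrow> ip g p" if p: "sqs p" for p
  proof -
    have "(\<lambda>n. ip (d n) (d n) * ip p p) \<longlonglongrightarrow> 0 * ip p p"
      by (intro tendsto_mult d0 tendsto_const)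
    then have "(\<lambda>n. ip (d n) (d n) * ip p p) \<longlonglongrightarrow> 0" by simp
    then have "(\<lambda>n. (ip (d n) p)\<^sup>2) \<longlonglongrightarrow> 0"
      by (rule tendsto_sandwich[OF _ _ tendsto_const, rotated 2])
         (use ip_Cauchy_Schwarz[OF qdomD(1)[OF dd] p] in auto)
    then have "(\<lambda>n. ip (d n) p) \<longlonglongrightarrow> 0" by simp
    then have "(\<lambda>n. ip (d n) p + ip g p) \<longlonglongrightarrow> 0 + ip g p" by (intro tendsto_add tendsto_const)
    then show ?thesis by (simp add: d_def ip_diff_left[OF qdomD(1)[OF h(1)] sg p])
  qed
  have g1: "ip g g = 1"
  proof -
    have "ip (d n) (d n) = 1 - 2 * ip (h n) g + ip g g" for n
      using ip_self_add[OF qdomD(1)[OF h(1)[of n]] sg, of "-1"] h(2)[of n] by (simp add: d_def)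
    then have "(\<lambda>n. ip (d n) (d n)) \<longlonglongrightarrow> 1 - 2 * ip g g + ip g g"
      by (simp only:) (intro tendsto_intros weak sg)
    from LIMSEQ_unique[OF this d0] show ?thesis by simp
  qed
  have go: "ip g (\<psi> j) = 0" if "j < k" for j
    using weak[OF sp[OF that]] h(3)[OF that] by (simp add: LIMSEQ_const_iff)
  have "qf b g g \<le> m"
  proof (rule qf_le_finite_sums[OF dg])
    fix F :: "int set" assume F: "finite F"
    let ?e = "\<lambda>f x. b / 2 * (fdiff f x)\<^sup>2 + 1 / (2 * b) * (xmul f x)\<^sup>2"
    have 1: "(\<lambda>n. \<Sum>x\<in>F. ?e (h n) x) \<longlonglongrightarrow> (\<Sum>x\<in>F. ?e g x)"
      unfolding xmul_def fdiff_def by (intro tendsto_intros lim)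
    have "(\<lambda>n. m + 1 / (real n + 1)) \<longlonglongrightarrow> m + 0"
      using LIMSEQ_inverse_real_of_nat by (intro tendsto_add tendsto_const) (simp add: inverse_eq_divide add.commute)
    then have 2: "(\<lambda>n. m + 1 / (real n + 1)) \<longlonglongrightarrow> m" by simp
    have 3: "(\<Sum>x\<in>F. ?e (h n) x) \<le> m + 1 / (real n + 1)" for n
    proof -
      have "(\<Sum>x\<in>F. ?e (h n) x) \<le> qf b (h n) (h n)"
        unfolding qf_def sum.distrib sum_distrib_left[symmetric]
        using b F h(1)[of n]
        by (intro add_mono mult_left_mono finite_sum_le_ip_self) (auto simp: qdomD)
      with hq[of n] show ?thesis by linarith
    qed
    show "(\<Sum>x\<in>F. ?e g x) \<le> m" using LIMSEQ_le[OF 1 2] 3 by blast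
  qed
  moreover have "m \<le> qf b g g" using low[OF dg go] g1 by simp
  ultimately have "qf b g g = m" by simp
  with dg g1 go low show ?thesis using that by blast
qed

text \<open>Varying the minimiser gives the equation only against functions orthogonal to the
  earlier \<open>\<psi> j\<close>. The components along those contribute nothing: they are
  eigenfunctions orthogonal to \<open>g\<close>, so the form and the inner product with
  \<open>g\<close> both vanish on them. Hence point masses are admissible test functions.\<close>

lemma next_eigenfunction:
  assumes b: "b > 0" and es: "eigen_system b k \<psi> E"
  obtains g m where "qdom g" "ip g g = 1" "\<And>j. j < k \<Longrightarrow> ip g (\<psi> j) = 0"
    "\<And>x. osc b g x = m * g x"
    "\<And>u. qdom u \<Longrightarrow> (\<And>j. j < k \<Longrightarrow> ip u (\<psi> j) = 0) \<Longrightarrow> m * ip u u \<le> qf b u u"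
proof -
  obtain g m where g: "qdom g" "ip g g = 1" "\<And>j. j < k \<Longrightarrow> ip g (\<psi> j) = 0" "qf b g g = m"
    and low: "\<And>u. qdom u \<Longrightarrow> (\<And>j. j < k \<Longrightarrow> ip u (\<psi> j) = 0) \<Longrightarrow> m * ip u u \<le> qf b u u"
    using minimizer_exists[OF assms] by blast
  have o: "orthonormal_on {..<k} \<psi>"
    and \<psi>: "\<And>j. j < k \<Longrightarrow> qdom (\<psi> j)" "\<And>j x. j < k \<Longrightarrow> osc b (\<psi> j) x = E j * \<psi> j x"
    using es by (auto simp: eigen_system_def)
  have EL: "qf b g u = m * ip g u" if u: "qdom u" "\<And>j. j < k \<Longrightarrow> ip u (\<psi> j) = 0" for u
  proof -
    have "0 \<le> 2 * t * (qf b g u - m * ip g u) + t\<^sup>2 * (qf b u u - m * ip u u)" for t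
    proof -
      have "m * ip (\<lambda>x. g x + t * u x) (\<lambda>x. g x + t * u x)
          \<le> qf b (\<lambda>x. g x + t * u x) (\<lambda>x. g x + t * u x)"
        using g u \<psi> by (intro low qdom_add qdom_scale)
          (auto simp: ip_add_left ip_scale_left qdomD sqs_scale)
      then show ?thesis
        using g u by (simp add: qf_self_add ip_self_add qdomD algebra_simps)
    qed
    from linear_coeff_zero[OF this] show ?thesis by simp
  qed
  have "osc b g a = m * g a" for a
  proof -
    define u where "u = (\<lambda>x. delta a x - (\<Sum>j<k. ip (delta a) (\<psi> j) * \<psi> j x))"
    define v where "v = (\<lambda>x. \<Sum>j<k. \<psi> j a * \<psi> j x)"
    have du: "qdom u" unfolding u_def by (rule qdom_residual[OF es qdom_delta])
    have dv: "qdom v" unfolding v_def using \<psi> by (intro qdom_sum qdom_scale) auto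
    have dl: "delta a = (\<lambda>x. u x + v x)" by (simp add: u_def v_def)
    have v: "qf b v g = 0" "ip v g = 0"
    proof -
      have "qf b (\<psi> j) g = 0" if "j < k" for j
        using qf_eigen[OF g(1) \<psi>(1)[OF that] \<psi>(2)[OF that]] g(3)[OF that] by (simp add: qf_commute)
      then show "qf b v g = 0"
        unfolding v_def using \<psi> g(1) by (subst qf_sum_left) (auto simp: qdom_scale qf_scale_left)
      show "ip v g = 0"
        unfolding v_def using \<psi> g
        by (subst ip_sum_left) (auto simp: qdomD sqs_scale ip_scale_left ip_commute[of "\<psi> _" g])
    qed
    have "ip u (\<psi> j) = 0" if "j < k" for j
      unfolding u_def using orthonormal_residual(2)[OF o finite_lessThan sqs_delta] that by simp
    from EL[OF du this] have "qf b u g = m * ip u g" by (simp add: qf_commute ip_commute)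
    moreover have "qf b (delta a) g = qf b u g"
      unfolding dl by (simp add: qf_add_left du dv g(1) v)
    moreover have "ip (delta a) g = ip u g"
      unfolding dl using du dv g(1) by (simp add: ip_add_left qdomD v)
    ultimately show ?thesis using osc_delta[OF g(1)] by simp
  qed
  with g low that show ?thesis by blast
qed

section \<open>Complete spectral systems of the oscillator\<close>

text \<open>The variational clause is carried along because it yields monotonicity of the
  eigenvalues and the lower bound \<open>qf_ge_ev\<close> behind Ky Fan and completeness.\<close>

definition spectral_system :: "real \<Rightarrow> (nat \<Rightarrow> int \<Rightarrow> real) \<Rightarrow> (nat \<Rightarrow> real) \<Rightarrow> bool" where
  "spectral_system b \<psi> E \<longleftrightarrow> (\<forall>k. eigen_system b k \<psi> E) \<and>
     (\<forall>j u. qdom u \<longrightarrow> (\<forall>i<j. ip u (\<psi> i) = 0) \<longrightarrow> E j * ip u u \<le> qf b u u)"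

lemma spectral_system_exists:
  assumes b: "b > 0"
  shows "\<exists>\<psi> E. spectral_system b \<psi> E"
proof -
  define P where "P n S \<longleftrightarrow> eigen_system b n (fst S) (snd S) \<and>
     (\<forall>j<n. \<forall>u. qdom u \<longrightarrow> (\<forall>i<j. ip u (fst S i) = 0) \<longrightarrow> snd S j * ip u u \<le> qf b u u)"
    for n :: nat and S :: "(nat \<Rightarrow> int \<Rightarrow> real) \<times> (nat \<Rightarrow> real)"
  \<comment> \<open>Coherence of the stages: each extension leaves earlier entries alone, so the
    diagonal of the chosen sequence is a single infinite system.\<close>
  define Q where "Q n S S' \<longleftrightarrow> (\<forall>j<n. fst S' j = fst S j \<and> snd S' j = snd S j)"
    for n :: nat and S S' :: "(nat \<Rightarrow> int \<Rightarrow> real) \<times> (nat \<Rightarrow> real)"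
  have "\<exists>F. \<forall>n. P n (F n) \<and> Q n (F n) (F (Suc n))"
  proof (rule dependent_nat_choice)
    show "\<exists>S. P 0 S" by (auto simp: P_def eigen_system_def orthonormal_on_def)
    fix S n assume P: "P n S"
    then have es: "eigen_system b n (fst S) (snd S)" by (simp add: P_def)
    obtain g m where g: "qdom g" "ip g g = 1" "\<And>j. j < n \<Longrightarrow> ip g (fst S j) = 0"
        "\<And>x. osc b g x = m * g x"
      and low: "\<And>u. qdom u \<Longrightarrow> (\<And>j. j < n \<Longrightarrow> ip u (fst S j) = 0) \<Longrightarrow> m * ip u u \<le> qf b u u"
      using next_eigenfunction[OF b es] by blast
    define S' where "S' = ((fst S)(n := g), (snd S)(n := m))"
    have "P (Suc n) S'"
      using P g low unfolding P_def eigen_system_def orthonormal_on_def S'_def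
      by (auto simp: less_Suc_eq qdomD ip_commute)
    moreover have "Q n S S'" by (simp add: Q_def S'_def)
    ultimately show "\<exists>S'. P (Suc n) S' \<and> Q n S S'" by blast
  qed
  then obtain F where F: "\<And>n. P n (F n)" "\<And>n. Q n (F n) (F (Suc n))" by blast
  define \<psi> where "\<psi> j = fst (F (Suc j)) j" for j
  define E where "E j = snd (F (Suc j)) j" for j
  have eq: "fst (F n) j = \<psi> j \<and> snd (F n) j = E j" if "j < n" for n j
    using that
  proof (induction n)
    case (Suc n)
    then show ?case using F(2)[of n] by (cases "j = n") (auto simp: Q_def \<psi>_def E_def)
  qed simp
  have "eigen_system b k \<psi> E" for k
    using F(1)[of k] eq[of _ k] unfolding P_def eigen_system_def orthonormal_on_def by auto
  moreover have "E j * ip u u \<le> qf b u u" if "qdom u" "\<forall>i<j. ip u (\<psi> i) = 0" for j u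
  proof -
    have "snd (F (Suc j)) j * ip u u \<le> qf b u u"
      using F(1)[of "Suc j"] that eq[of _ "Suc j"] unfolding P_def by auto
    then show ?thesis by (simp add: E_def)
  qed
  ultimately show ?thesis unfolding spectral_system_def by blast
qed

definition lattice_spectrum :: "real \<Rightarrow> (nat \<Rightarrow> int \<Rightarrow> real) \<times> (nat \<Rightarrow> real)" where
  "lattice_spectrum b = (SOME p. spectral_system b (fst p) (snd p))"

definition psi :: "real \<Rightarrow> nat \<Rightarrow> int \<Rightarrow> real" where "psi b = fst (lattice_spectrum b)"

definition ev :: "real \<Rightarrow> nat \<Rightarrow> real" where "ev b = snd (lattice_spectrum b)"

context
  fixes b :: real
  assumes b: "b > 0"
begin

lemma spectral_system_psi: "spectral_system b (psi b) (ev b)"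
proof -
  from spectral_system_exists[OF b] have "\<exists>p. spectral_system b (fst p) (snd p)" by auto
  from someI_ex[OF this] show ?thesis by (simp add: psi_def ev_def lattice_spectrum_def)
qed

lemma psi_eigen_system: "eigen_system b k (psi b) (ev b)"
  using spectral_system_psi by (simp add: spectral_system_def)

lemma psi_orthonormal: "orthonormal_on UNIV (psi b)"
  unfolding orthonormal_on_def
proof (intro conjI ballI)
  fix i j :: nat
  show "sqs (psi b i)" "ip (psi b i) (psi b j) = (if i = j then 1 else 0)"
    using psi_eigen_system[of "Suc (max i j)"] unfolding eigen_system_def orthonormal_on_def
    by (auto simp: less_Suc_eq_le)
qed

lemma psi_sqs: "sqs (psi b j)"
  using psi_orthonormal by (simp add: orthonormal_on_def)

lemma ip_psi: "ip (psi b i) (psi b j) = (if i = j then 1 else 0)"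
  using psi_orthonormal by (simp add: orthonormal_on_def)

lemma psi_qdom: "qdom (psi b j)"
  using psi_eigen_system[of "Suc j"] by (simp add: eigen_system_def)

lemma osc_psi: "osc b (psi b j) x = ev b j * psi b j x"
  using psi_eigen_system[of "Suc j"] by (simp add: eigen_system_def)

lemma qf_psi: "qdom f \<Longrightarrow> qf b f (psi b j) = ev b j * ip f (psi b j)"
  by (rule qf_eigen[OF _ psi_qdom osc_psi])

lemma ev_low: "qdom u \<Longrightarrow> (\<And>i. i < j \<Longrightarrow> ip u (psi b i) = 0) \<Longrightarrow> ev b j * ip u u \<le> qf b u u"
  using spectral_system_psi by (simp add: spectral_system_def)

lemma qf_psi_self: "qf b (psi b j) (psi b j) = ev b j"
  by (simp add: qf_psi[OF psi_qdom] ip_psi)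

lemma ev_nonneg: "0 \<le> ev b j"
  using qf_nonneg[OF b, of "psi b j"] by (simp add: qf_psi_self)

lemma ev_mono: "j \<le> k \<Longrightarrow> ev b j \<le> ev b k"
  using ev_low[OF psi_qdom, of j k] by (simp add: ip_psi qf_psi_self)

text \<open>Split \<open>f\<close> into its component \<open>v\<close> in the span and the residual
  \<open>g\<close>. The cross term vanishes because \<open>v\<close> combines eigenfunctions
  orthogonal to \<open>g\<close>, and the variational bound applies to \<open>g\<close>. For
  normalised \<open>f\<close> this is the hypothesis of \<open>Ky_Fan\<close>.\<close>

lemma qf_ge_ev:
  assumes f: "qdom f"
  shows "ev b k * ip f f - (\<Sum>j<k. (ev b k - ev b j) * (ip f (psi b j))\<^sup>2) \<le> qf b f f"
proof -
  have o: "orthonormal_on {..<k} (psi b)" by (rule orthonormal_on_subset[OF psi_orthonormal]) simp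
  define g where "g = (\<lambda>x. f x - (\<Sum>j<k. ip f (psi b j) * psi b j x))"
  define v where "v = (\<lambda>x. \<Sum>j<k. ip f (psi b j) * psi b j x)"
  have dg: "qdom g" unfolding g_def by (rule qdom_residual[OF psi_eigen_system f])
  have dv: "qdom v" unfolding v_def by (intro qdom_sum qdom_scale psi_qdom)
  have fgv: "f = (\<lambda>x. g x + 1 * v x)" by (simp add: g_def v_def)
  have fgv': "(\<lambda>x. g x + v x) = f" using fgv by simp
  have r: "\<And>i. i < k \<Longrightarrow> ip g (psi b i) = 0" "ip g g = ip f f - (\<Sum>i<k. (ip f (psi b i))\<^sup>2)"
    using orthonormal_residual(2,3)[OF o finite_lessThan qdomD(1)[OF f]] by (simp_all add: g_def)
  have vi: "ip v (psi b i) = ip f (psi b i)" if "i < k" for i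
  proof -
    have "ip f (psi b i) = ip g (psi b i) + 1 * ip v (psi b i)"
      by (subst fgv) (simp add: ip_add_left qdomD dg dv psi_sqs)
    then show ?thesis using r(1)[OF that] by simp
  qed
  have qv: "qf b v h = (\<Sum>j<k. ev b j * ip f (psi b j) * ip h (psi b j))" if "qdom h" for h
    unfolding v_def using that
    by (subst qf_sum_left)
       (auto simp: psi_qdom qdom_scale qf_scale_left qf_commute[of b "psi b _" h] qf_psi
         intro!: sum.cong)
  have "qf b f f = qf b g g + qf b v v"
    using qf_self_add[OF dg dv, of b 1] qv[OF dg] r(1)
    by (simp add: fgv' qf_commute[of b g v])
  moreover have "qf b v v = (\<Sum>j<k. ev b j * (ip f (psi b j))\<^sup>2)"
    using qv[OF dv] vi by (simp add: power2_eq_square mult.assoc)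
  moreover have "ev b k * ip g g \<le> qf b g g" using ev_low[OF dg r(1)] by simp
  ultimately show ?thesis
    by (simp add: r(2) sum_subtractf left_diff_distrib sum_distrib_left right_diff_distrib)
qed

text \<open>Bounded energy confines at least half of the mass of each \<open>psi b k\<close> to one
  fixed box, while Bessel for point masses allows every site a total of at most 1; infinitely many
  orthonormal functions do not fit.\<close>

lemma ev_unbounded: "\<exists>k. C \<le> ev b k"
proof (rule ccontr)
  assume "\<not> ?thesis"
  then have C: "ev b k < C" for k by (simp add: not_le)
  have C0: "C > 0" using C[of 0] ev_nonneg[of 0] by simp
  obtain M :: nat where M: "real M > 4 * b * C + 1" using reals_Archimedean2 by blast
  have M1: "real M > 1" using M b C0 by (smt (verit) mult_pos_pos)
  have MM: "4 * b * C \<le> (real M)\<^sup>2"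
    using M self_le_power[of "real M" 2] M1 by linarith
  define B where "B = {- int M..int M}"
  have half: "1 / 2 \<le> (\<Sum>x\<in>B. (psi b k x)\<^sup>2)" for k
  proof -
    have "0 \<le> b / 2 * ip (fdiff (psi b k)) (fdiff (psi b k))"
      using b by (intro mult_nonneg_nonneg ip_self_nonneg) auto
    with qf_psi_self[of k] C[of k]
    have "1 / (2 * b) * ip (xmul (psi b k)) (xmul (psi b k)) \<le> C"
      unfolding qf_def by linarith
    then have "2 * ip (xmul (psi b k)) (xmul (psi b k)) \<le> 4 * b * C"
      using b by (simp add: field_simps)
    also note MM
    finally have "ip (xmul (psi b k)) (xmul (psi b k)) / (real M)\<^sup>2 \<le> 1 / 2"
      using M1 by (simp add: field_simps)
    moreover have "1 \<le> (\<Sum>x\<in>B. (psi b k x)\<^sup>2) + ip (xmul (psi b k)) (xmul (psi b k)) / (real M)\<^sup>2"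
      using ip_le_box_sum[OF qdomD(2)[OF psi_qdom[of k]], of M] M1
      by (simp add: ip_psi B_def)
    ultimately show ?thesis by linarith
  qed
  \<comment> \<open>Twice the number of sites in the box, plus one, so that n halves exceed the
    capacity 2M + 1.\<close>
  define n where "n = 2 * (2 * M + 1) + 1"
  have "real n / 2 = (\<Sum>k<n. 1 / 2)" by simp
  also have "\<dots> \<le> (\<Sum>k<n. \<Sum>x\<in>B. (psi b k x)\<^sup>2)" using half by (intro sum_mono)
  also have "\<dots> = (\<Sum>x\<in>B. \<Sum>k<n. (psi b k x)\<^sup>2)" by (rule sum.swap)
  also have "\<dots> \<le> (\<Sum>x\<in>B. 1)"
  proof (rule sum_mono)
    fix x
    show "(\<Sum>k<n. (psi b k x)\<^sup>2) \<le> 1"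
      using Bessel[OF orthonormal_on_subset[OF psi_orthonormal] finite_lessThan sqs_delta, of n x]
      by (simp add: delta_def)
  qed
  also have "\<dots> = real (2 * M + 1)" by (simp add: B_def)
  finally show False by (simp add: n_def)
qed

text \<open>By \<open>qf_ge_ev\<close> for a point mass, the missing mass times
  \<open>ev b K\<close> stays below the fixed energy \<open>q\<close>, and \<open>ev b K\<close> is
  unbounded. Completeness at point masses is the form that multiplies well over the
  coordinates.\<close>

lemma Parseval_psi: "(\<lambda>K. \<Sum>k<K. (psi b k a)\<^sup>2) \<longlonglongrightarrow> 1"
proof (rule LIMSEQ_I)
  fix e :: real assume e: "e > 0"
  define q where "q = qf b (delta a) (delta a)"
  have q0: "q \<ge> 0" unfolding q_def by (rule qf_nonneg[OF b])
  have le1: "(\<Sum>k<K. (psi b k a)\<^sup>2) \<le> 1" for K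
    using Bessel[OF orthonormal_on_subset[OF psi_orthonormal] finite_lessThan sqs_delta, of K a]
    by (simp add: delta_def)
  have key: "ev b K * (1 - (\<Sum>k<K. (psi b k a)\<^sup>2)) \<le> q" for K
  proof -
    have "0 \<le> (\<Sum>j<K. ev b j * (psi b j a)\<^sup>2)" by (intro sum_nonneg mult_nonneg_nonneg ev_nonneg) auto
    then show ?thesis
      using qf_ge_ev[OF qdom_delta[of a], of K]
      by (simp add: q_def delta_def sum_subtractf left_diff_distrib sum_distrib_left right_diff_distrib)
  qed
  obtain K0 where K0: "q / e + 1 \<le> ev b K0" using ev_unbounded by blast
  show "\<exists>K0. \<forall>K\<ge>K0. norm ((\<Sum>k<K. (psi b k a)\<^sup>2) - 1) < e"
  proof (intro exI allI impI)
    fix K assume "K \<ge> K0"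
    then have E: "q / e + 1 \<le> ev b K" using K0 ev_mono by (meson order_trans)
    have "1 - (\<Sum>k<K. (psi b k a)\<^sup>2) < e"
    proof (rule ccontr)
      assume "\<not> ?thesis"
      then have "(q / e + 1) * e \<le> ev b K * (1 - (\<Sum>k<K. (psi b k a)\<^sup>2))"
        using E e q0 by (intro mult_mono) (auto simp: ev_nonneg)
      with key[of K] have "(q / e + 1) * e \<le> q" by linarith
      then show False using e by (simp add: distrib_right)
    qed
    with le1[of K] show "norm ((\<Sum>k<K. (psi b k a)\<^sup>2) - 1) < e" by simp
  qed
qed

end

section \<open>The spin operator and its Kravchuk eigenfunctions\<close>

text \<open>Generating polynomial of the Kravchuk polynomials: for fixed \<open>a + c\<close>, the
  k-th coefficient is the Kravchuk polynomial of degree k in \<open>c\<close>.\<close>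

definition kpoly :: "nat \<Rightarrow> nat \<Rightarrow> real poly" where
  "kpoly a c = [:1, 1:] ^ a * [:1, -1:] ^ c"

text \<open>Since 1 - X = (1 + X) - 2X, each shifted product differs from \<open>kpoly a c\<close>
  by a multiple of 2X, and the product rule assembles the corrections into the derivative. Truncated
  subtraction is harmless: it takes effect only under the vanishing factor \<open>a\<close> or
  \<open>c\<close>.\<close>

lemma kpoly_ladder:
  "of_nat a * kpoly (a - 1) (c + 1) + of_nat c * kpoly (a + 1) (c - 1)
    = of_nat (a + c) * kpoly a c - 2 * [:0, 1:] * pderiv (kpoly a c)"
proof -
  define X P M :: "real poly" where "X = [:0, 1:]" and "P = [:1, 1:]" and "M = [:1, -1:]"
  have k: "kpoly a c = P ^ a * M ^ c" for a c by (simp add: kpoly_def P_def M_def)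
  have m: "M * q = P * q - 2 * X * q" for q
  proof -
    have "M = P - 2 * X" by (simp add: M_def P_def X_def numeral_poly)
    then show ?thesis by (simp only: left_diff_distrib)
  qed
  define A where "A = of_nat a * (P ^ (a - 1) * M ^ c)"
  define B where "B = of_nat c * (P ^ a * M ^ (c - 1))"
  have 1: "of_nat a * kpoly (a - 1) (c + 1) = of_nat a * kpoly a c - 2 * X * A"
  proof (cases a)
    case (Suc a')
    have "kpoly a' (c + 1) = M * (P ^ a' * M ^ c)" unfolding k by (simp only: power_add power_one_right mult_ac)
    also have "\<dots> = kpoly a c - 2 * X * (P ^ a' * M ^ c)"
      unfolding m k Suc by (simp only: power_Suc mult_ac)
    finally show ?thesis
      by (simp only: Suc A_def diff_Suc_1 right_diff_distrib mult_ac)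
  qed (simp add: A_def)
  have 2: "of_nat c * kpoly (a + 1) (c - 1) = of_nat c * kpoly a c + 2 * X * B"
  proof (cases c)
    case (Suc c')
    have "kpoly (a + 1) c' = P * (P ^ a * M ^ c')" unfolding k by (simp only: power_add power_one_right mult_ac)
    also have "\<dots> = M * (P ^ a * M ^ c') + 2 * X * (P ^ a * M ^ c')"
      unfolding m by simp
    also have "M * (P ^ a * M ^ c') = kpoly a c" unfolding k Suc by (simp only: power_Suc mult_ac)
    finally show ?thesis
      by (simp only: Suc B_def diff_Suc_1 distrib_left mult_ac)
  qed (simp add: B_def)
  have 3: "pderiv (kpoly a c) = A - B"
  proof -
    have d: "pderiv (q ^ n) = of_nat n * q ^ (n - 1) * pderiv q" for q :: "real poly" and n
      by (cases n) (simp_all add: pderiv_power_Suc of_nat_poly del: power_Suc of_nat_Suc)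
    have "pderiv (P ^ a) = of_nat a * P ^ (a - 1)"
      unfolding d by (simp add: P_def pderiv_pCons)
    moreover have "pderiv (M ^ c) = - (of_nat c * M ^ (c - 1))"
      unfolding d by (simp add: M_def pderiv_pCons)
    ultimately show ?thesis
      by (simp add: k pderiv_mult A_def B_def algebra_simps)
  qed
  show ?thesis
    unfolding 1 2 3 X_def[symmetric] by (simp add: algebra_simps)
qed

text \<open>X times the derivative acts on the k-th coefficient as multiplication by k. The result
  is the three-term recurrence in the position variable, with eigenvalue linear in k.\<close>

lemma coeff_kpoly_ladder:
  "real a * coeff (kpoly (a - 1) (c + 1)) k + real c * coeff (kpoly (a + 1) (c - 1)) k
    = (real (a + c) - 2 * real k) * coeff (kpoly a c) k"
proof -
  have 1: "coeff (2 * [:0, 1:] * pderiv p) k = 2 * real k * coeff p k" for p :: "real poly"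
    by (cases k) (simp_all add: coeff_pderiv numeral_poly)
  have 2: "coeff (of_nat n * p) k = real n * coeff p k" for n and p :: "real poly"
    by (simp add: of_nat_poly)
  show ?thesis
    using arg_cong[OF kpoly_ladder[of a c], of "\<lambda>p. coeff p k"]
    unfolding coeff_add coeff_diff 1 2 by (simp only: left_diff_distrib)
qed

definition spinJ :: "nat \<Rightarrow> real" where "spinJ j = real j + 1 / 2"

text \<open>The matrix element of J_x between the weights x and x + 1. The cutoff by
  \<open>max\<close> kills it outside the spin space, so there \<open>spin\<close> is multiplication
  by \<open>spinJ j\<close>.\<close>

definition hop :: "nat \<Rightarrow> int \<Rightarrow> real" where
  "hop j x = 1 / 2 * sqrt (max 0 ((spinJ j)\<^sup>2 - (of_int x + 1 / 2)\<^sup>2))"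

definition spin :: "nat \<Rightarrow> (int \<Rightarrow> real) \<Rightarrow> int \<Rightarrow> real" where
  "spin j f x = spinJ j * f x - hop j x * f (x + 1) - hop j (x - 1) * f (x - 1)"

lemma spinJ_pos [simp]: "spinJ j > 0" by (simp add: spinJ_def)

lemma hop_nonneg [simp]: "0 \<le> hop j x" by (simp add: hop_def)

lemma hop_le: "hop j x \<le> spinJ j / 2"
proof -
  have "sqrt (max 0 ((spinJ j)\<^sup>2 - (of_int x + 1 / 2)\<^sup>2)) \<le> sqrt ((spinJ j)\<^sup>2)"
    by (intro real_sqrt_le_mono) simp
  then show ?thesis by (simp add: hop_def less_imp_le)
qed

lemma hop_eq_0: "x \<ge> int j \<or> x \<le> - int j - 1 \<Longrightarrow> hop j x = 0"
proof -
  assume "x \<ge> int j \<or> x \<le> - int j - 1"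
  then have "spinJ j \<le> \<bar>of_int x + 1 / 2\<bar>" by (auto simp: spinJ_def)
  then have "(spinJ j)\<^sup>2 \<le> (of_int x + 1 / 2)\<^sup>2"
    using abs_le_square_iff[of "spinJ j" "of_int x + 1 / 2"] by (simp add: spinJ_def)
  then show ?thesis by (simp add: hop_def)
qed

lemma hop_eq:
  assumes "- int j \<le> x" "x < int j"
  shows "hop j x = 1 / 2 * sqrt ((real j - of_int x) * (real j + of_int x + 1))"
proof -
  have "(spinJ j)\<^sup>2 - (of_int x + 1 / 2)\<^sup>2 = (real j - of_int x) * (real j + of_int x + 1)"
    by (simp add: spinJ_def power2_eq_square algebra_simps)
  moreover have "(real j - of_int x) * (real j + of_int x + 1) \<ge> 0"
    using assms by (intro mult_nonneg_nonneg) linarith+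
  ultimately show ?thesis by (simp add: hop_def)
qed

text \<open>The square root of the binomial weight makes the recurrence symmetric; site
  \<open>x\<close> corresponds to the Kravchuk argument j + x.\<close>

definition krav :: "nat \<Rightarrow> nat \<Rightarrow> int \<Rightarrow> real" where
  "krav j k x = (if \<bar>x\<bar> \<le> int j
     then sqrt (real ((2 * j) choose nat (int j + x))) *
          coeff (kpoly (nat (int j - x)) (nat (int j + x))) k
     else 0)"

lemma choose_Suc_ratio: "Suc y * (n choose Suc y) = (n - y) * (n choose y)"
  by (metis Suc_times_binomial_eq binomial_absorb_comp binomial_absorption mult.commute)

lemma sqrt_choose_up:
  assumes "y < n"
  shows "sqrt (real (n - y) * real (Suc y)) * sqrt (real (n choose Suc y))
    = real (n - y) * sqrt (real (n choose y))"
proof -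
  have "real (n - y) * real (Suc y) * real (n choose Suc y) = real (n - y) * real (Suc y * (n choose Suc y))"
    by (simp only: of_nat_mult mult_ac)
  also have "\<dots> = (real (n - y))\<^sup>2 * real (n choose y)"
    unfolding choose_Suc_ratio by (simp add: power2_eq_square)
  finally have "sqrt (real (n - y) * real (Suc y)) * sqrt (real (n choose Suc y))
      = sqrt ((real (n - y))\<^sup>2 * real (n choose y))"
    by (simp only: real_sqrt_mult[symmetric])
  then show ?thesis by (simp add: real_sqrt_mult)
qed

lemma sqrt_choose_down:
  assumes "y < n"
  shows "sqrt (real (n - y) * real (Suc y)) * sqrt (real (n choose y))
    = real (Suc y) * sqrt (real (n choose Suc y))"
proof -
  have "real (n - y) * real (Suc y) * real (n choose y) = real (Suc y) * real ((n - y) * (n choose y))"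
    by (simp only: of_nat_mult mult_ac)
  also have "\<dots> = (real (Suc y))\<^sup>2 * real (n choose Suc y)"
    unfolding choose_Suc_ratio[symmetric] by (simp only: power2_eq_square of_nat_mult mult_ac)
  finally have "sqrt (real (n - y) * real (Suc y)) * sqrt (real (n choose y))
      = sqrt ((real (Suc y))\<^sup>2 * real (n choose Suc y))"
    by (simp only: real_sqrt_mult[symmetric])
  then show ?thesis by (simp add: real_sqrt_mult del: of_nat_Suc)
qed

text \<open>Between the end points the binomial square roots turn each hopping term into one term of
  the ladder recurrence. At and beyond the ends either the hopping or the function vanishes.\<close>

lemma spin_krav: "spin j (krav j k) x = (real k + 1 / 2) * krav j k x"
proof (cases "\<bar>x\<bar> \<le> int j")
  case False
  then have "krav j k x = 0" by (simp add: krav_def)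
  moreover have "hop j x * krav j k (x + 1) = 0"
  proof (cases "\<bar>x + 1\<bar> \<le> int j")
    case True
    with False have "x \<le> - int j - 1" by linarith
    then show ?thesis by (simp add: hop_eq_0)
  qed (simp add: krav_def)
  moreover have "hop j (x - 1) * krav j k (x - 1) = 0"
  proof (cases "\<bar>x - 1\<bar> \<le> int j")
    case True
    with False have "x - 1 \<ge> int j" by linarith
    then show ?thesis by (simp add: hop_eq_0)
  qed (simp add: krav_def)
  ultimately show ?thesis by (simp only: spin_def mult_zero_right diff_0_right)
next
  case True
  define y where "y = nat (int j + x)"
  define a where "a = nat (int j - x)"
  define n where "n = 2 * j"
  have n: "n = a + y" using True by (auto simp: n_def a_def y_def)
  have x: "real_of_int x = real y - real j" "real y + real a = 2 * real j"
    using True by (auto simp: y_def a_def)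
  have 1: "hop j x * krav j k (x + 1)
    = 1 / 2 * (real a * (sqrt (real (n choose y)) * coeff (kpoly (a - 1) (y + 1)) k))"
  proof (cases "x < int j")
    case False
    then have "hop j x = 0" "a = 0" by (auto simp: a_def hop_eq_0)
    then show ?thesis by simp
  next
    case lt: True
    have "nat (int j + (x + 1)) = Suc y" "nat (int j - (x + 1)) = a - 1"
      using lt True by (auto simp: y_def a_def)
    then have kr: "krav j k (x + 1) = sqrt (real (n choose Suc y)) * coeff (kpoly (a - 1) (y + 1)) k"
    proof -
      have "\<bar>x + 1\<bar> \<le> int j" using lt True by linarith
      then show ?thesis
        using \<open>nat (int j + (x + 1)) = Suc y\<close> \<open>nat (int j - (x + 1)) = a - 1\<close>
        by (simp add: krav_def n_def)
    qed
    have "real j - of_int x = real (n - y)" "real j + of_int x + 1 = real (Suc y)"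
      using x n by simp_all
    then have "(real j - of_int x) * (real j + of_int x + 1) = real (n - y) * real (Suc y)"
      by (simp only:)
    then have h: "hop j x = 1 / 2 * sqrt (real (n - y) * real (Suc y))"
      using hop_eq[of j x] lt True by simp
    have "y < n" using lt True by (auto simp: y_def n_def)
    from sqrt_choose_up[OF this] show ?thesis
      unfolding kr h using n by simp
  qed
  have 2: "hop j (x - 1) * krav j k (x - 1)
    = 1 / 2 * (real y * (sqrt (real (n choose y)) * coeff (kpoly (a + 1) (y - 1)) k))"
  proof (cases "x > - int j")
    case False
    then have "hop j (x - 1) = 0" "y = 0" by (auto simp: y_def hop_eq_0)
    then show ?thesis by simp
  next
    case gt: True
    define z where "z = y - 1"
    have y: "y = Suc z" using gt by (auto simp: y_def z_def)
    have "nat (int j + (x - 1)) = z" "nat (int j - (x - 1)) = a + 1"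
      using gt True by (auto simp: y_def a_def z_def)
    then have kr: "krav j k (x - 1) = sqrt (real (n choose z)) * coeff (kpoly (a + 1) z) k"
    proof -
      have "\<bar>x - 1\<bar> \<le> int j" using gt True by linarith
      then show ?thesis
        using \<open>nat (int j + (x - 1)) = z\<close> \<open>nat (int j - (x - 1)) = a + 1\<close>
        by (simp add: krav_def n_def)
    qed
    have "real j - of_int (x - 1) = real (n - z)" "real j + of_int (x - 1) + 1 = real (Suc z)"
      using x n y by simp_all
    then have "(real j - of_int (x - 1)) * (real j + of_int (x - 1) + 1) = real (n - z) * real (Suc z)"
      by (simp only:)
    then have h: "hop j (x - 1) = 1 / 2 * sqrt (real (n - z) * real (Suc z))"
      using hop_eq[of j "x - 1"] gt True by simp
    have "z < n" using n y by simp
    from sqrt_choose_down[OF this] show ?thesis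
      unfolding kr h y by simp
  qed
  have kr: "krav j k x = sqrt (real (n choose y)) * coeff (kpoly a y) k"
    using True by (simp add: krav_def n_def a_def y_def)
  have "hop j x * krav j k (x + 1) + hop j (x - 1) * krav j k (x - 1)
    = 1 / 2 * sqrt (real (n choose y)) *
      (real a * coeff (kpoly (a - 1) (y + 1)) k + real y * coeff (kpoly (a + 1) (y - 1)) k)"
    unfolding 1 2 by (simp add: algebra_simps)
  also have "\<dots> = (real j - real k) * krav j k x"
    unfolding coeff_kpoly_ladder kr using x by (simp add: algebra_simps)
  finally show ?thesis
    by (simp add: spin_def spinJ_def algebra_simps)
qed

lemma sqs_krav: "sqs (krav j k)"
proof (rule sqs_finite_support, rule finite_subset)
  show "{x. krav j k x \<noteq> 0} \<subseteq> {- int j..int j}" by (auto simp: krav_def)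
qed simp

lemma spin_symmetric:
  assumes "sqs f" "sqs g"
  shows "ip f (spin j g) = ip (spin j f) g"
proof -
  have bd: "\<bar>hop j x\<bar> \<le> spinJ j / 2" for x using hop_le[of j x] by simp
  have s: "sqs (\<lambda>x. hop j x * h (x + 1))" "sqs (\<lambda>x. hop j (x - 1) * h (x - 1))" if "sqs h" for h
    using sqs_bounded_mult[OF sqs_shift(1)[OF that], of "hop j" "spinJ j / 2"]
      sqs_bounded_mult[OF sqs_shift(2)[OF that], of "\<lambda>x. hop j (x - 1)" "spinJ j / 2"] bd by auto
  have sw: "ip u (\<lambda>x. hop j x * v (x + 1)) = ip (\<lambda>x. hop j (x - 1) * u (x - 1)) v" for u v
    using ip_reindex[OF bij_int_shift(1)[of 1], of "\<lambda>x. hop j (x - 1) * u (x - 1)" v]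
    by (simp add: ip_def mult_ac)
  have exp1: "ip u (spin j v) = spinJ j * ip u v - ip u (\<lambda>x. hop j x * v (x + 1))
      - ip u (\<lambda>x. hop j (x - 1) * v (x - 1))" if "sqs u" "sqs v" for u v
    unfolding spin_def using s[OF that(2)] that
    by (simp add: ip_diff_right sqs_diff sqs_scale ip_scale_right)
  show ?thesis
    using exp1[OF assms] exp1[OF assms(2,1)] sw[of f g] sw[of g f]
    by (simp add: ip_commute[of "spin j f" g] ip_commute[of g f]
        ip_commute[of g "\<lambda>x. hop j (x - 1) * f (x - 1)"]
        ip_commute[of "\<lambda>x. hop j (x - 1) * g (x - 1)" f])
qed

lemma krav_support: "\<bar>x\<bar> > int j \<Longrightarrow> krav j k x = 0"
  by (simp add: krav_def)

lemma ip_supported: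
  assumes "\<And>x. \<bar>x\<bar> > int j \<Longrightarrow> f x = 0"
  shows "ip f g = (\<Sum>x\<in>{- int j..int j}. f x * g x)"
proof -
  have "ip f g = (\<Sum>\<^sub>\<infinity>x\<in>{- int j..int j}. f x * g x)"
    unfolding ip_def using assms by (intro infsum_cong_neutral) auto
  then show ?thesis by simp
qed

text \<open>At the left end the generating polynomial is a pure power of 1 + X, so the value there
  is a positive binomial coefficient.\<close>

lemma ip_krav_pos:
  assumes "k \<le> 2 * j" shows "ip (krav j k) (krav j k) > 0"
proof -
  have "krav j k (- int j) = real ((2 * j) choose k)"
  proof -
    have "nat (int j - - int j) = 2 * j" "nat (int j + - int j) = 0" by auto
    then show ?thesis using assms by (simp add: krav_def kpoly_def coeff_linear_poly_power)
  qed
  moreover have "((2 * j) choose k) > 0" using assms by simp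
  ultimately have "(krav j k (- int j))\<^sup>2 > 0" by simp
  with square_le_ip_self[OF sqs_krav, of j k "- int j"] show ?thesis by linarith
qed

section \<open>The orthonormal Kravchuk basis and the spin form\<close>

definition phi :: "nat \<Rightarrow> nat \<Rightarrow> int \<Rightarrow> real" where
  "phi j k = (\<lambda>x. inverse (sqrt (ip (krav j k) (krav j k))) * krav j k x)"

lemma sqs_phi: "sqs (phi j k)"
  unfolding phi_def by (rule sqs_scale[OF sqs_krav])

lemma phi_support: "\<bar>x\<bar> > int j \<Longrightarrow> phi j k x = 0"
  by (simp add: phi_def krav_support)

lemma spin_phi: "spin j (phi j k) x = (real k + 1 / 2) * phi j k x"
proof -
  have "spin j (\<lambda>x. c * f x) x = c * spin j f x" for c f
    by (simp add: spin_def algebra_simps)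
  then show ?thesis by (simp add: phi_def spin_krav)
qed

lemma qdom_phi: "qdom (phi j k)"
proof (rule qdom_finite_support, rule finite_subset)
  show "{x. phi j k x \<noteq> 0} \<subseteq> {- int j..int j}"
    using phi_support[of j _ k] by (force simp: abs_le_iff)
qed simp

lemma phi_orthonormal: "orthonormal_on {..2 * j} (phi j)"
  unfolding orthonormal_on_def
proof (intro conjI ballI)
  fix k l assume k: "k \<in> {..2 * j}" and l: "l \<in> {..2 * j}"
  show "sqs (phi j k)" by (rule sqs_phi)
  show "ip (phi j k) (phi j l) = (if k = l then 1 else 0)"
  proof (cases "k = l")
    case True
    then show ?thesis
      using ip_krav_pos[of k j] k unfolding phi_def ip_scale_left ip_scale_right
      by (simp add: mult.assoc[symmetric] inverse_mult_distrib[symmetric])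
  next
    case False
    have "(real l + 1 / 2) * ip (phi j k) (phi j l) = ip (phi j k) (spin j (phi j l))"
      unfolding spin_phi by (simp add: ip_scale_right)
    also have "\<dots> = ip (spin j (phi j k)) (phi j l)" by (rule spin_symmetric[OF sqs_phi sqs_phi])
    also have "\<dots> = (real k + 1 / 2) * ip (phi j k) (phi j l)"
      unfolding spin_phi by (simp add: ip_scale_left)
    finally show ?thesis using False by simp
  qed
qed

text \<open>Counting replaces a dimension argument: Bessel bounds the sum at each site by 1, while
  the total over the 2j + 1 sites is the number 2j + 1 of unit vectors, so equality holds
  everywhere.\<close>

lemma phi_complete:
  assumes "\<bar>a\<bar> \<le> int j"
  shows "(\<Sum>k\<le>2 * j. (phi j k a)\<^sup>2) = 1"
proof -
  let ?B = "{- int j..int j}"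
  have le: "(\<Sum>k\<le>2 * j. (phi j k x)\<^sup>2) \<le> 1" for x
    using Bessel[OF phi_orthonormal[of j] finite_atMost sqs_delta[of x]] by (simp add: delta_def)
  have "(\<Sum>x\<in>?B. \<Sum>k\<le>2 * j. (phi j k x)\<^sup>2) = (\<Sum>k\<le>2 * j. \<Sum>x\<in>?B. (phi j k x)\<^sup>2)"
    by (rule sum.swap)
  also have "\<dots> = (\<Sum>k\<le>2 * j. 1)"
  proof (rule sum.cong)
    fix k assume "k \<in> {..2 * j}"
    then have "ip (phi j k) (phi j k) = 1" using orthonormal_onD(2)[OF phi_orthonormal] by simp
    then show "(\<Sum>x\<in>?B. (phi j k x)\<^sup>2) = 1"
      using ip_supported[of j "phi j k" "phi j k", OF phi_support] by (simp add: power2_eq_square)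
  qed simp
  also have "\<dots> = (\<Sum>x\<in>?B. 1)" by simp
  finally show ?thesis
    using sum_mono_inv[of "\<lambda>x. \<Sum>k\<le>2 * j. (phi j k x)\<^sup>2" ?B "\<lambda>x. 1" a] le assms by (auto simp: abs_le_iff)
qed

lemma phi_expansion:
  assumes "\<bar>a\<bar> \<le> int j" "sqs f"
  shows "f a = (\<Sum>k\<le>2 * j. ip f (phi j k) * phi j k a)"
proof -
  define g where "g = (\<lambda>x. delta a x - (\<Sum>k\<le>2 * j. ip (delta a) (phi j k) * phi j k x))"
  note r = orthonormal_residual[OF phi_orthonormal[of j] finite_atMost sqs_delta[of a]]
  have "ip g g = 0" unfolding g_def r(3) using phi_complete[OF assms(1)] by (simp add: delta_def)
  then have "ip f g = 0"
    using ip_Cauchy_Schwarz[OF assms(2), of g] r(1) by (simp add: g_def)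
  moreover have "ip f g = f a - (\<Sum>k\<le>2 * j. phi j k a * ip f (phi j k))"
    unfolding g_def using assms(2)
    by (subst ip_diff_right) (auto simp: sqs_phi sqs_sum sqs_scale ip_sum_right[OF sqs_scale] ip_scale_right)
  ultimately show ?thesis by (simp add: mult.commute)
qed

text \<open>The form is diagonal on the Kravchuk part. The residual \<open>w\<close> is supported
  outside the spin space, where \<open>spin\<close> multiplies by \<open>spinJ j\<close>;
  \<open>k \<le> j\<close> keeps this value at or above k + 1/2.\<close>

lemma spin_ge:
  assumes f: "sqs f" and k: "k \<le> j"
  shows "(real k + 1 / 2) * ip f f - (\<Sum>l<k. (real k - real l) * (ip f (phi j l))\<^sup>2) \<le> ip f (spin j f)"
proof -
  let ?c = "\<lambda>l. ip f (phi j l)"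
  define v where "v = (\<lambda>x. \<Sum>l\<le>2 * j. ?c l * phi j l x)"
  define w where "w = (\<lambda>x. f x - (\<Sum>l\<le>2 * j. ?c l * phi j l x))"
  have r: "sqs w" "\<And>i. i \<le> 2 * j \<Longrightarrow> ip w (phi j i) = 0" "ip w w = ip f f - (\<Sum>l\<le>2 * j. (?c l)\<^sup>2)"
    using orthonormal_residual[OF phi_orthonormal finite_atMost f] by (simp_all add: w_def)
  have sv: "sqs v" unfolding v_def by (intro sqs_sum sqs_scale sqs_phi)
  have w0: "w x = 0" if "\<bar>x\<bar> \<le> int j" for x
    using phi_expansion[OF that f] by (simp add: w_def)
  have sw: "spin j w x = spinJ j * w x" for x
  proof -
    have "hop j x * w (x + 1) = 0"
    proof (cases "\<bar>x + 1\<bar> \<le> int j")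
      case False
      then have "x \<ge> int j \<or> x \<le> - int j - 1" by linarith
      then show ?thesis by (simp add: hop_eq_0)
    qed (simp add: w0)
    moreover have "hop j (x - 1) * w (x - 1) = 0"
    proof (cases "\<bar>x - 1\<bar> \<le> int j")
      case False
      then have "x - 1 \<ge> int j \<or> x - 1 \<le> - int j - 1" by linarith
      then show ?thesis by (simp add: hop_eq_0)
    qed (simp add: w0)
    ultimately show ?thesis by (simp only: spin_def diff_0_right)
  qed
  have sp: "spin j v x = (\<Sum>l\<le>2 * j. (?c l * (real l + 1 / 2)) * phi j l x)" for x
  proof -
    have "spin j v x = (\<Sum>l\<le>2 * j. ?c l * spin j (phi j l) x)"
      unfolding v_def spin_def sum_distrib_left sum_subtractf[symmetric]
      by (rule sum.cong) (simp_all add: algebra_simps)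
    then show ?thesis by (simp add: spin_phi mult_ac)
  qed
  have fs: "spin j f = (\<lambda>x. spin j v x + spinJ j * w x)"
  proof
    fix x
    have "spin j f x = spin j v x + spin j w x"
      by (simp add: spin_def v_def w_def algebra_simps)
    then show "spin j f x = spin j v x + spinJ j * w x" by (simp add: sw)
  qed
  have svs: "sqs (spin j v)"
    unfolding sp by (intro sqs_sum sqs_scale sqs_phi)
  have fv: "ip f (spin j v) = (\<Sum>l\<le>2 * j. (real l + 1 / 2) * (?c l)\<^sup>2)"
    unfolding sp using f
    by (subst ip_sum_right) (auto simp: sqs_phi sqs_scale ip_scale_right power2_eq_square intro!: sum.cong)
  have fw: "ip f w = ip w w"
  proof -
    have "ip v w = 0" unfolding v_def using r(1,2)
      by (subst ip_sum_left) (auto simp: sqs_phi sqs_scale ip_scale_left ip_commute[of "phi j _" w])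
    moreover have "f = (\<lambda>x. v x + w x)" by (simp add: v_def w_def)
    ultimately show ?thesis using ip_add_left[OF sv r(1) r(1)] by simp
  qed
  have "ip f (spin j f) = (\<Sum>l\<le>2 * j. (real l + 1 / 2) * (?c l)\<^sup>2) + spinJ j * ip w w"
    unfolding fs using f r(1) svs fv fw by (simp add: ip_add_right sqs_scale ip_scale_right)
  moreover have "(real k + 1 / 2) * ip w w \<le> spinJ j * ip w w"
    using k by (intro mult_right_mono ip_self_nonneg) (simp add: spinJ_def)
  moreover have "(real k + 1 / 2) * (\<Sum>l\<le>2 * j. (?c l)\<^sup>2) - (\<Sum>l<k. (real k - real l) * (?c l)\<^sup>2)
      \<le> (\<Sum>l\<le>2 * j. (real l + 1 / 2) * (?c l)\<^sup>2)"
  proof -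
    have "(\<Sum>l<k. (real k - real l) * (?c l)\<^sup>2)
        = (\<Sum>l\<le>2 * j. if l < k then (real k - real l) * (?c l)\<^sup>2 else 0)"
      using k by (subst sum.inter_filter[symmetric]) (auto intro!: sum.cong)
    moreover have "(\<Sum>l\<le>2 * j. (real k + 1 / 2) * (?c l)\<^sup>2)
        - (\<Sum>l\<le>2 * j. if l < k then (real k - real l) * (?c l)\<^sup>2 else 0)
        \<le> (\<Sum>l\<le>2 * j. (real l + 1 / 2) * (?c l)\<^sup>2)"
      unfolding sum_subtractf[symmetric]
    proof (rule sum_mono)
      fix l
      show "(real k + 1 / 2) * (?c l)\<^sup>2 - (if l < k then (real k - real l) * (?c l)\<^sup>2 else 0)
          \<le> (real l + 1 / 2) * (?c l)\<^sup>2"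
        by (auto simp: left_diff_distrib[symmetric] intro!: mult_right_mono)
    qed
    ultimately show ?thesis by (simp add: sum_distrib_left)
  qed
  moreover have "ip f f = (\<Sum>l\<le>2 * j. (?c l)\<^sup>2) + ip w w" using r(3) by simp
  ultimately show ?thesis by (simp add: distrib_left)
qed

text \<open>Summation by parts splits the form into hopping energy and an effective potential, the
  shape that can be compared site by site with the oscillator form.\<close>

lemma spin_form:
  assumes f: "sqs f"
  shows "((\<lambda>x. hop j x * (fdiff f x)\<^sup>2 + (spinJ j - hop j x - hop j (x - 1)) * (f x)\<^sup>2)
    has_sum ip f (spin j f)) UNIV"
proof -
  have bd: "\<bar>hop j x\<bar> \<le> spinJ j / 2" for x using hop_le[of j x] by simp
  have s: "sqs (\<lambda>x. hop j x * h (x + 1))" "sqs (\<lambda>x. hop j (x - 1) * h (x - 1))" if "sqs h" for h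
    using sqs_bounded_mult[OF sqs_shift(1)[OF that], of "hop j" "spinJ j / 2"]
      sqs_bounded_mult[OF sqs_shift(2)[OF that], of "\<lambda>x. hop j (x - 1)" "spinJ j / 2"] bd by auto
  have ss: "sqs (spin j f)"
    unfolding spin_def by (intro sqs_diff sqs_scale s f)
  define G where "G = (\<lambda>x. fdiff f x * (hop j x * f (x + 1)))"
  have "G summable_on UNIV"
    unfolding G_def by (intro ip_summable sqs_fdiff s f)
  from has_sum_add[OF has_sum_infsum[OF ip_summable[OF f ss]] has_sum_telescope_int[OF this]]
  have "((\<lambda>x. f x * spin j f x + (G x - G (x - 1))) has_sum ip f (spin j f)) UNIV"
    by (simp add: ip_def)
  also have "(\<lambda>x. f x * spin j f x + (G x - G (x - 1)))
      = (\<lambda>x. hop j x * (fdiff f x)\<^sup>2 + (spinJ j - hop j x - hop j (x - 1)) * (f x)\<^sup>2)"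
    unfolding G_def fdiff_def spin_def by (rule ext) (simp add: power2_eq_square algebra_simps)
  finally show ?thesis .
qed

text \<open>The weight \<open>x\<^sup>2\<close> turns the eigenvalue equation into a bound for the fourth moment.\<close>
lemma weighted_eigen:
  fixes s q :: "int \<Rightarrow> real"
  assumes f: "qdom f"
    and eigen: "\<And>x. q x * f x - s x * f (x + 1) - s (x - 1) * f (x - 1) = E * f x"
    and bd: "\<And>x. \<bar>s x\<bar> \<le> C"
    and S: "\<And>x. s x * (2 * of_int x + 1) - s (x - 1) * (2 * of_int x - 1) \<le> S"
  defines "T \<equiv> \<lambda>x. (q x - s x - s (x - 1)) * (of_int x)\<^sup>2 * (f x)\<^sup>2
    + s x * (((of_int x)\<^sup>2 + (of_int x + 1)\<^sup>2) / 2) * (fdiff f x)\<^sup>2"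
  shows "T summable_on UNIV" "infsum T UNIV \<le> E * ip (xmul f) (xmul f) + S / 2 * ip f f"
proof -
  have sf: "sqs f" "sqs (xmul f)" using f by (simp_all add: qdomD)
  \<comment> \<open>Only \<open>f\<close> and \<open>xmul f\<close> are known to be square summable,
    so the quadratically weighted telescoping term is built from factors carrying a single power of
    x.\<close>
  define X1 where "X1 = (\<lambda>x. (of_int x + 1) * f (x + 1))"
  define X0 where "X0 = (\<lambda>x. of_int x * f (x + 1))"
  define Y1 where "Y1 = (\<lambda>x. (of_int x + 1) * f x)"
  have sX1: "sqs X1" using sqs_shift(1)[OF sf(2)] by (simp add: X1_def xmul_def)
  have sX0: "sqs X0"
  proof -
    have "X0 = (\<lambda>x. X1 x - f (x + 1))" by (auto simp: X0_def X1_def algebra_simps)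
    then show ?thesis using sqs_diff[OF sX1 sqs_shift(1)[OF sf(1)]] by simp
  qed
  have sY1: "sqs Y1"
  proof -
    have "Y1 = (\<lambda>x. xmul f x + f x)" by (auto simp: Y1_def xmul_def algebra_simps)
    then show ?thesis using sqs_add[OF sf(2,1)] by simp
  qed
  have bdm: "sqs (\<lambda>x. s x * h x)" "sqs (\<lambda>x. s (x - 1) * h x)" if "sqs h" for h
    using sqs_bounded_mult[OF that, of s C] sqs_bounded_mult[OF that, of "\<lambda>x. s (x - 1)" C] bd by auto
  define G where "G = (\<lambda>x. 1 / 2 * (X0 x * (s x * X0 x)) + 1 / 2 * (X1 x * (s x * X1 x))
      - X1 x * (s x * Y1 x))"
  have sum_diff: "(\<lambda>x. u x - v x) summable_on UNIV"
    if "u summable_on UNIV" "v summable_on UNIV" for u v :: "int \<Rightarrow> real"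
    using summable_on_add[OF that(1) summable_on_uminus[THEN iffD2, OF that(2)]] by simp
  have G: "G summable_on UNIV"
    unfolding G_def
    by (intro sum_diff summable_on_add summable_on_cmult_right ip_summable bdm sX0 sX1 sY1)
  \<comment> \<open>An edge carries the average of the squares at its two ends. Relative to x^2 the
    averages on the edges at x are off by (2x + 1)/2 and -(2x - 1)/2, which leaves half of
    \<open>D\<close>.\<close>
  define D where "D = (\<lambda>x. s x * (2 * of_int x + 1) - s (x - 1) * (2 * of_int x - 1))"
  have Df: "(\<lambda>x. f x * (D x * f x)) summable_on UNIV"
  proof -
    have "sqs (\<lambda>x. s x * (2 * xmul f x + f x) - s (x - 1) * (2 * xmul f x - f x))"
      by (intro sqs_diff bdm sqs_add sqs_scale sf)
    also have "(\<lambda>x. s x * (2 * xmul f x + f x) - s (x - 1) * (2 * xmul f x - f x)) = (\<lambda>x. D x * f x)"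
      by (auto simp: D_def xmul_def algebra_simps)
    finally show ?thesis by (rule ip_summable[OF sf(1)])
  qed
  have "T x = E * (xmul f x * xmul f x) + 1 / 2 * (f x * (D x * f x)) + (G x - G (x - 1))" for x
  proof -
    have "T x - (E * (xmul f x * xmul f x) + 1 / 2 * (f x * (D x * f x)) + (G x - G (x - 1)))
        = (of_int x)\<^sup>2 * f x * (q x * f x - s x * f (x + 1) - s (x - 1) * f (x - 1) - E * f x)"
      unfolding T_def D_def G_def X0_def X1_def Y1_def xmul_def fdiff_def
      by (simp add: power2_eq_square field_simps)
    then show ?thesis using eigen[of x] by simp
  qed
  then have T: "T = (\<lambda>x. (E * (xmul f x * xmul f x) + 1 / 2 * (f x * (D x * f x))) + (G x - G (x - 1)))"
    by auto
  have "(T has_sum ((E * ip (xmul f) (xmul f) + 1 / 2 * (\<Sum>\<^sub>\<infinity>x. f x * (D x * f x))) + 0)) UNIV"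
    unfolding T ip_def
    by (intro has_sum_add has_sum_telescope_int G has_sum_cmult_right has_sum_infsum ip_summable sf Df)
  then show "T summable_on UNIV" "infsum T UNIV \<le> E * ip (xmul f) (xmul f) + S / 2 * ip f f"
  proof -
    assume h: "(T has_sum ((E * ip (xmul f) (xmul f) + 1 / 2 * (\<Sum>\<^sub>\<infinity>x. f x * (D x * f x))) + 0)) UNIV"
    then show "T summable_on UNIV" by (rule has_sum_imp_summable)
    have "(\<Sum>\<^sub>\<infinity>x. f x * (D x * f x)) \<le> (\<Sum>\<^sub>\<infinity>x. S * (f x * f x))"
    proof (rule infsum_mono[OF Df])
      show "(\<lambda>x. S * (f x * f x)) summable_on UNIV"
        by (intro summable_on_cmult_right ip_summable sf)
      show "f x * (D x * f x) \<le> S * (f x * f x)" for x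
        using mult_right_mono[OF S[of x], of "f x * f x"] by (simp add: D_def mult_ac)
    qed
    then show "infsum T UNIV \<le> E * ip (xmul f) (xmul f) + S / 2 * ip f f"
      unfolding infsumI[OF h] ip_def by (simp add: infsum_cmult_right')
  qed
qed

section \<open>Convergence of the one-dimensional eigenvalues\<close>

lemma hop_upper:
  assumes "(of_int x + 1 / 2)\<^sup>2 \<le> 2 * (spinJ j)\<^sup>2"
  shows "hop j x \<le> spinJ j / 2 - (of_int x + 1 / 2)\<^sup>2 / (4 * spinJ j)"
proof -
  define J where "J = spinJ j"
  define u where "u = (of_int x + 1 / 2 :: real)\<^sup>2"
  have J: "J > 0" by (simp add: J_def)
  \<comment> \<open>The hypothesis is exactly the nonnegativity of J - u/(2J), so that squaring
    proves the bound sqrt(1 - s) <= 1 - s/2 with s = u/J^2.\<close>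
  have "u / (2 * J) \<le> J" using assms J by (simp add: J_def u_def power2_eq_square field_simps)
  then have nn: "0 \<le> J - u / (2 * J)" by simp
  have "(J - u / (2 * J))\<^sup>2 = J\<^sup>2 - u + (u / (2 * J))\<^sup>2"
    using J by (simp add: power2_diff)
  then have "J\<^sup>2 - u \<le> (J - u / (2 * J))\<^sup>2" using zero_le_power2[of "u / (2 * J)"] by linarith
  then have "max 0 (J\<^sup>2 - u) \<le> (J - u / (2 * J))\<^sup>2" by (intro max.boundedI zero_le_power2)
  then have "sqrt (max 0 (J\<^sup>2 - u)) \<le> J - u / (2 * J)" using nn by (intro real_le_lsqrt) auto
  then show ?thesis by (simp add: hop_def J_def u_def)
qed

text \<open>With u = ((x + 1/2)/J)^2 this is sqrt(1 - u) >= (1 - u)(1 + u/2) = 1 - u/2 - u^2/2. For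
  u > 1 the polynomial is negative and the hopping vanishes, so the bound is global.\<close>

lemma hop_lower:
  "spinJ j / 2 - (of_int x + 1 / 2)\<^sup>2 / (4 * spinJ j) - (of_int x + 1 / 2) ^ 4 / (4 * spinJ j ^ 3)
    \<le> hop j x"
proof -
  define J where "J = spinJ j"
  define u where "u = ((of_int x + 1 / 2) / J)\<^sup>2"
  have J: "J > 0" by (simp add: J_def)
  have t2: "(of_int x + 1 / 2)\<^sup>2 = J\<^sup>2 * u" using J by (simp add: u_def power_divide)
  have t4: "(of_int x + 1 / 2) ^ 4 = J ^ 4 * u\<^sup>2"
    using J by (simp add: u_def power_divide flip: power_mult)
  have u0: "u \<ge> 0" by (simp add: u_def)
  have "J * ((1 - u) * (1 + u / 2)) \<le> sqrt (max 0 (J\<^sup>2 - J\<^sup>2 * u))"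
  proof (cases "u \<le> 1")
    case True
    have "(1 - u) * (1 + u / 2)\<^sup>2 \<le> 1"
    proof -
      have "(1 - u) * (1 + u / 2)\<^sup>2 = 1 - (3 / 4 * u\<^sup>2 + u ^ 3 / 4)"
        by (simp add: power2_eq_square power3_eq_cube field_simps)
      moreover have "0 \<le> 3 / 4 * u\<^sup>2 + u ^ 3 / 4" using u0 by simp
      ultimately show ?thesis by linarith
    qed
    then have "(1 - u) * ((1 - u) * (1 + u / 2)\<^sup>2) \<le> (1 - u) * 1"
      using True by (intro mult_left_mono) auto
    then have "J\<^sup>2 * ((1 - u) * ((1 - u) * (1 + u / 2)\<^sup>2)) \<le> J\<^sup>2 * ((1 - u) * 1)"
      by (rule mult_left_mono) simp
    then have "(J * ((1 - u) * (1 + u / 2)))\<^sup>2 \<le> J\<^sup>2 - J\<^sup>2 * u"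
      by (simp add: power2_eq_square algebra_simps)
    then show ?thesis by (intro real_le_rsqrt) simp
  next
    case False
    then have "J * ((1 - u) * (1 + u / 2)) \<le> 0"
      using J u0 by (intro mult_nonneg_nonpos mult_nonpos_nonneg) auto
    also have "0 \<le> sqrt (max 0 (J\<^sup>2 - J\<^sup>2 * u))" by simp
    finally show ?thesis .
  qed
  moreover have "J * ((1 - u) * (1 + u / 2)) = 2 * (J / 2 - J\<^sup>2 * u / (4 * J) - J ^ 4 * u\<^sup>2 / (4 * J ^ 3))"
    using J by (simp add: power2_eq_square power3_eq_cube power4_eq_xxxx field_simps)
  ultimately show ?thesis
    unfolding hop_def t2 t4 J_def[symmetric] by simp
qed

text \<open>The cruder sqrt(1 - u) >= 1 - u doubles the quadratic loss but has no quartic term,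
  which suits the estimate of the hopping defect.\<close>

lemma hop_lower':
  "spinJ j / 2 - (of_int x + 1 / 2)\<^sup>2 / (2 * spinJ j) \<le> hop j x"
proof -
  define J where "J = spinJ j"
  define u where "u = ((of_int x + 1 / 2) / J)\<^sup>2"
  have J: "J > 0" by (simp add: J_def)
  have t2: "(of_int x + 1 / 2)\<^sup>2 = J\<^sup>2 * u" using J by (simp add: u_def power_divide)
  have u0: "u \<ge> 0" by (simp add: u_def)
  have "J * (1 - u) \<le> sqrt (max 0 (J\<^sup>2 - J\<^sup>2 * u))"
  proof (cases "u \<le> 1")
    case True
    then have "(1 - u) * (1 - u) \<le> (1 - u) * 1" using u0 by (intro mult_left_mono) auto
    then have "J\<^sup>2 * ((1 - u) * (1 - u)) \<le> J\<^sup>2 * ((1 - u) * 1)"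
      by (rule mult_left_mono) simp
    then have "(J * (1 - u))\<^sup>2 \<le> J\<^sup>2 - J\<^sup>2 * u"
      by (simp add: power2_eq_square algebra_simps)
    then show ?thesis by (intro real_le_rsqrt) simp
  next
    case False
    then have "J * (1 - u) \<le> 0" using J by (intro mult_nonneg_nonpos) auto
    also have "0 \<le> sqrt (max 0 (J\<^sup>2 - J\<^sup>2 * u))" by simp
    finally show ?thesis .
  qed
  moreover have "J * (1 - u) = 2 * (J / 2 - J\<^sup>2 * u / (2 * J))"
    using J by (simp add: power2_eq_square field_simps)
  ultimately show ?thesis
    unfolding hop_def t2 J_def[symmetric] by simp
qed

definition spinW :: "nat \<Rightarrow> int \<Rightarrow> real" where
  "spinW j x = spinJ j - hop j x - hop j (x - 1)"

lemma spinW_nonneg: "0 \<le> spinW j x"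
  using hop_le[of j x] hop_le[of j "x - 1"] by (simp add: spinW_def)

lemma shifted_squares:
  fixes y c :: real
  shows "(y + 1 / 2)\<^sup>2 / (4 * c) + (y - 1 / 2)\<^sup>2 / (4 * c) = y\<^sup>2 / (2 * c) + 1 / (8 * c)"
proof -
  have "(y + 1 / 2)\<^sup>2 + (y - 1 / 2)\<^sup>2 = 2 * y\<^sup>2 + 1 / 2"
    by (simp add: power2_eq_square algebra_simps)
  then have "(y + 1 / 2)\<^sup>2 / (4 * c) + (y - 1 / 2)\<^sup>2 / (4 * c) = (2 * y\<^sup>2 + 1 / 2) / (4 * c)"
    by (simp only: add_divide_distrib[symmetric])
  then show ?thesis by (simp add: add_divide_distrib)
qed

lemma spinW_lower:
  assumes "\<bar>x\<bar> \<le> int j"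
  shows "(of_int x)\<^sup>2 / (2 * spinJ j) \<le> spinW j x"
proof -
  define y where "y = real_of_int x"
  have y: "\<bar>y + 1 / 2\<bar> \<le> spinJ j" "\<bar>y - 1 / 2\<bar> \<le> spinJ j"
    using assms by (auto simp: spinJ_def y_def abs_le_iff)
  have sq: "t\<^sup>2 \<le> 2 * (spinJ j)\<^sup>2" if "\<bar>t\<bar> \<le> spinJ j" for t
  proof -
    have "t\<^sup>2 \<le> (spinJ j)\<^sup>2" using power_mono[OF that, of 2] by simp
    then show ?thesis using zero_le_power2[of "spinJ j"] by linarith
  qed
  have "hop j x \<le> spinJ j / 2 - (y + 1 / 2)\<^sup>2 / (4 * spinJ j)"
    unfolding y_def by (rule hop_upper) (use sq[OF y(1)] in \<open>simp add: y_def\<close>)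
  moreover have "hop j (x - 1) \<le> spinJ j / 2 - (y - 1 / 2)\<^sup>2 / (4 * spinJ j)"
    using hop_upper[of "x - 1" j] sq[OF y(2)] by (simp add: y_def)
  moreover have "(y + 1 / 2)\<^sup>2 / (4 * spinJ j) + (y - 1 / 2)\<^sup>2 / (4 * spinJ j)
      = y\<^sup>2 / (2 * spinJ j) + 1 / (8 * spinJ j)"
    by (rule shifted_squares)
  moreover have "1 / (8 * spinJ j) \<ge> 0" using spinJ_pos[of j] by (simp add: less_imp_le)
  ultimately show ?thesis unfolding spinW_def y_def by linarith
qed

lemma spinW_upper:
  "spinW j x \<le> (of_int x)\<^sup>2 / (2 * spinJ j) + 1 / (8 * spinJ j)
    + (2 * of_int x ^ 4 + 3 * (of_int x)\<^sup>2 + 1 / 8) / (4 * spinJ j ^ 3)"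
proof -
  define y where "y = real_of_int x"
  have "hop j x \<ge> spinJ j / 2 - (y + 1 / 2)\<^sup>2 / (4 * spinJ j) - (y + 1 / 2) ^ 4 / (4 * spinJ j ^ 3)"
    unfolding y_def by (rule hop_lower)
  moreover have "hop j (x - 1) \<ge> spinJ j / 2 - (y - 1 / 2)\<^sup>2 / (4 * spinJ j) - (y - 1 / 2) ^ 4 / (4 * spinJ j ^ 3)"
    using hop_lower[of j "x - 1"] by (simp add: y_def)
  moreover have "(y + 1 / 2)\<^sup>2 / (4 * spinJ j) + (y - 1 / 2)\<^sup>2 / (4 * spinJ j)
      = y\<^sup>2 / (2 * spinJ j) + 1 / (8 * spinJ j)"
    by (rule shifted_squares)
  moreover have "(y + 1 / 2) ^ 4 / (4 * spinJ j ^ 3) + (y - 1 / 2) ^ 4 / (4 * spinJ j ^ 3)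
      = (2 * y ^ 4 + 3 * y\<^sup>2 + 1 / 8) / (4 * spinJ j ^ 3)"
    unfolding add_divide_distrib[symmetric]
    by (rule arg_cong[where f = "\<lambda>z. z / _"]) (simp add: power2_eq_square power4_eq_xxxx field_simps)
  ultimately show ?thesis unfolding spinW_def y_def by linarith
qed

section \<open>Moment bounds and comparison of the two forms\<close>

definition x2mul :: "(int \<Rightarrow> real) \<Rightarrow> int \<Rightarrow> real" where
  "x2mul f x = (of_int x)\<^sup>2 * f x"

lemma sqs_infsum_dominated:
  assumes T: "T summable_on UNIV" and le: "\<And>x. (f x)\<^sup>2 \<le> c * T x"
  shows "sqs f" "ip f f \<le> c * infsum T UNIV"
proof -
  have cT: "(\<lambda>x. c * T x) summable_on UNIV" by (rule summable_on_cmult_right[OF T])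
  show s: "sqs f" unfolding sqs_def
    by (rule summable_on_dominated[OF cT]) (use le in simp)
  have "ip f f \<le> (\<Sum>\<^sub>\<infinity>x. c * T x)"
    unfolding ip_def using ip_summable[OF s s] cT le by (intro infsum_mono) (auto simp: power2_eq_square)
  then show "ip f f \<le> c * infsum T UNIV" by (simp add: infsum_cmult_right')
qed

text \<open>The energy controls the second moment. The weighted eigenvalue equation with constant
  hopping b/2, for which \<open>S\<close> equals b, then trades a further x^2 for a factor of order
  b.\<close>

lemma psi_moments:
  assumes b: "b > 0"
  shows "ip (xmul (psi b l)) (xmul (psi b l)) \<le> 2 * b * ev b l"
    "sqs (x2mul (psi b l))"
    "ip (x2mul (psi b l)) (x2mul (psi b l)) \<le> b\<^sup>2 * (4 * (ev b l)\<^sup>2 + 1)"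
proof -
  define f where "f = psi b l"
  define E where "E = ev b l"
  have E0: "E \<ge> 0" by (simp add: E_def ev_nonneg[OF b])
  have f: "qdom f" "sqs f" "ip f f = 1"
    using psi_qdom[OF b] psi_sqs[OF b] ip_psi[OF b] by (simp_all add: f_def)
  have "qf b f f = E" by (simp add: f_def E_def qf_psi_self[OF b])
  moreover have "0 \<le> b / 2 * ip (fdiff f) (fdiff f)"
    using b by (intro mult_nonneg_nonneg ip_self_nonneg) auto
  ultimately have "1 / (2 * b) * ip (xmul f) (xmul f) \<le> E" unfolding qf_def by linarith
  then have M2: "ip (xmul f) (xmul f) \<le> 2 * b * E" using b by (simp add: field_simps)
  then show "ip (xmul (psi b l)) (xmul (psi b l)) \<le> 2 * b * ev b l" by (simp add: f_def E_def)
  define q where "q = (\<lambda>x::int. b + (real_of_int x)\<^sup>2 / (2 * b))"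
  define T where "T = (\<lambda>x. (q x - b / 2 - b / 2) * (of_int x)\<^sup>2 * (f x)\<^sup>2
    + b / 2 * (((of_int x)\<^sup>2 + (of_int x + 1)\<^sup>2) / 2) * (fdiff f x)\<^sup>2)"
  have T: "T summable_on UNIV" "infsum T UNIV \<le> E * ip (xmul f) (xmul f) + b / 2 * ip f f"
  proof -
    have eig: "q x * f x - b / 2 * f (x + 1) - b / 2 * f (x - 1) = E * f x" for x
      using osc_psi[OF b, of l x] b by (simp add: osc_def f_def E_def q_def field_simps)
    have "\<bar>b / 2\<bar> \<le> b / 2" using b by simp
    note w = weighted_eigen[OF f(1), of q "\<lambda>_. b / 2" E "b / 2" b, OF eig this]
    show "T summable_on UNIV" "infsum T UNIV \<le> E * ip (xmul f) (xmul f) + b / 2 * ip f f"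
      unfolding T_def using w by (simp_all add: algebra_simps)
  qed
  have le: "(x2mul f x)\<^sup>2 \<le> 2 * b * T x" for x
  proof -
    have "0 \<le> b / 2 * (((of_int x)\<^sup>2 + (of_int x + 1)\<^sup>2) / 2) * (fdiff f x)\<^sup>2"
      using b by simp
    then have "(q x - b / 2 - b / 2) * (of_int x)\<^sup>2 * (f x)\<^sup>2 \<le> T x" by (simp add: T_def)
    then have "2 * b * ((q x - b / 2 - b / 2) * (of_int x)\<^sup>2 * (f x)\<^sup>2) \<le> 2 * b * T x"
      using b by (intro mult_left_mono) auto
    moreover have "2 * b * ((q x - b / 2 - b / 2) * (of_int x)\<^sup>2 * (f x)\<^sup>2) = (x2mul f x)\<^sup>2"
      using b by (simp add: q_def x2mul_def power2_eq_square)
    ultimately show ?thesis by simp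
  qed
  show "sqs (x2mul (psi b l))"
    using sqs_infsum_dominated(1)[OF T(1) le] by (simp add: f_def)
  have "ip (x2mul f) (x2mul f) \<le> 2 * b * infsum T UNIV"
    by (rule sqs_infsum_dominated(2)[OF T(1) le])
  also have "\<dots> \<le> 2 * b * (E * (2 * b * E) + b / 2 * 1)"
    using T(2) mult_left_mono[OF M2 E0] b f(3) by (intro mult_left_mono) auto
  also have "\<dots> = b\<^sup>2 * (4 * E\<^sup>2 + 1)" by (simp add: power2_eq_square algebra_simps)
  finally show "ip (x2mul (psi b l)) (x2mul (psi b l)) \<le> b\<^sup>2 * (4 * (ev b l)\<^sup>2 + 1)"
    by (simp add: f_def E_def)
qed

lemma spin_form_psi_le:
  fixes b :: real and l :: nat
  assumes J: "spinJ j \<le> b" "b \<le> spinJ j + 1" "1 \<le> spinJ j"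
  defines "E \<equiv> ev b l"
  shows "ip (psi b l) (spin j (psi b l)) \<le> E + (8 * E\<^sup>2 + 4 * E + 3) / spinJ j"
proof -
  define K where "K = spinJ j"
  define f where "f = psi b l"
  have K: "K \<ge> 1" "K \<le> b" "b \<le> K + 1" using J by (simp_all add: K_def)
  have b: "b > 0" using K by simp
  have E0: "E \<ge> 0" by (simp add: E_def ev_nonneg[OF b])
  have f: "qdom f" "sqs f" "ip f f = 1"
    using psi_qdom[OF b] psi_sqs[OF b] ip_psi[OF b] by (simp_all add: f_def)
  define M2 where "M2 = ip (xmul f) (xmul f)"
  define M4 where "M4 = ip (x2mul f) (x2mul f)"
  have M2: "M2 \<le> 2 * b * E" and x2: "sqs (x2mul f)" and M4: "M4 \<le> b\<^sup>2 * (4 * E\<^sup>2 + 1)"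
    using psi_moments[OF b, of l] by (simp_all add: f_def E_def M2_def M4_def)
  \<comment> \<open>The hopping is at most b/2, so only potentials are compared: \<open>c\<close>
    collects the x^2 mismatch, including that of K and b, and \<open>d\<close> the constants. By the
    moment bounds the errors are 4E/K from \<open>c\<close>, 1/K from \<open>d\<close> and (8E^2 +
    2)/K from the quartic term.\<close>
  define c where "c = 1 / (2 * K) - 1 / (2 * b) + 3 / (4 * K ^ 3)"
  define d where "d = 1 / (8 * K) + 1 / (32 * K ^ 3)"
  have pt: "hop j x * (fdiff f x)\<^sup>2 + (spinJ j - hop j x - hop j (x - 1)) * (f x)\<^sup>2
      \<le> (b / 2 * (fdiff f x)\<^sup>2 + 1 / (2 * b) * (xmul f x)\<^sup>2)
       + (c * (xmul f x * xmul f x) + d * (f x * f x) + 1 / (2 * K ^ 3) * (x2mul f x * x2mul f x))" for x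
  proof -
    have "hop j x \<le> b / 2" using hop_le[of j x] K by (simp add: K_def)
    then have 1: "hop j x * (fdiff f x)\<^sup>2 \<le> b / 2 * (fdiff f x)\<^sup>2" by (rule mult_right_mono) simp
    have "spinW j x * (f x)\<^sup>2 \<le> ((of_int x)\<^sup>2 / (2 * K) + 1 / (8 * K)
      + (2 * of_int x ^ 4 + 3 * (of_int x)\<^sup>2 + 1 / 8) / (4 * K ^ 3)) * (f x)\<^sup>2"
      unfolding K_def by (rule mult_right_mono[OF spinW_upper]) simp
    also have "\<dots> = 1 / (2 * b) * (xmul f x)\<^sup>2
       + (c * (xmul f x * xmul f x) + d * (f x * f x) + 1 / (2 * K ^ 3) * (x2mul f x * x2mul f x))"
      by (simp add: c_def d_def xmul_def x2mul_def power2_eq_square power4_eq_xxxx add_divide_distrib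
          algebra_simps)
    finally show ?thesis using 1 by (simp add: spinW_def)
  qed
  have "ip f (spin j f) \<le> qf b f f + (c * M2 + d * ip f f + 1 / (2 * K ^ 3) * M4)"
  proof (rule has_sum_mono[OF spin_form[OF f(2)] _ pt])
    show "((\<lambda>x. (b / 2 * (fdiff f x)\<^sup>2 + 1 / (2 * b) * (xmul f x)\<^sup>2)
       + (c * (xmul f x * xmul f x) + d * (f x * f x) + 1 / (2 * K ^ 3) * (x2mul f x * x2mul f x)))
       has_sum qf b f f + (c * M2 + d * ip f f + 1 / (2 * K ^ 3) * M4)) UNIV"
      unfolding M2_def M4_def ip_def
      by (intro has_sum_add has_sum_cmult_right has_sum_infsum ip_summable qf_has_sum f x2 qdomD(2)[OF f(1)])
  qed
  also have "qf b f f = E" by (simp add: f_def E_def qf_psi_self[OF b])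
  finally have 1: "ip f (spin j f) \<le> E + (c * M2 + d + 1 / (2 * K ^ 3) * M4)" by (simp add: f(3))
  have b2: "b \<le> 2 * K" using K by simp
  have K3: "1 / K ^ 3 \<le> 1 / K" "1 / K\<^sup>2 \<le> 1 / K"
    using K by (auto intro!: divide_left_mono self_le_power)
  have c0: "c \<ge> 0" using K by (simp add: c_def frac_le)
  have "c * M2 \<le> c * (2 * b * E)" using M2 c0 by (rule mult_left_mono)
  also have "\<dots> = (b / K - 1) * E + 3 / (2 * K ^ 3) * b * E"
    using b K by (simp add: c_def field_simps)
  also have "\<dots> \<le> 1 / K * E + 3 / K * E"
  proof (rule add_mono)
    have "b / K \<le> (K + 1) / K" using K by (intro divide_right_mono) auto
    also have "\<dots> = 1 + 1 / K" using K by (simp add: add_divide_distrib)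
    finally show "(b / K - 1) * E \<le> 1 / K * E" using E0 by (intro mult_right_mono) auto
    have "3 / (2 * K ^ 3) * b \<le> 3 / (2 * K ^ 3) * (2 * K)" using b2 K by (intro mult_left_mono) auto
    also have "\<dots> = 3 * (1 / K\<^sup>2)" using K by (simp add: power2_eq_square power3_eq_cube)
    also have "\<dots> \<le> 3 / K" using K3 by simp
    finally show "3 / (2 * K ^ 3) * b * E \<le> 3 / K * E" using E0 by (rule mult_right_mono)
  qed
  finally have e1: "c * M2 \<le> 4 * E / K" by (simp add: field_simps)
  have e2: "d \<le> 1 / K"
  proof -
    have "d = 1 / 8 * (1 / K) + 1 / 32 * (1 / K ^ 3)" by (simp add: d_def)
    moreover have "0 \<le> 1 / K" using K by simp
    ultimately show ?thesis using K3 by linarith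
  qed
  have "b\<^sup>2 \<le> (2 * K)\<^sup>2" using b b2 by (intro power_mono) auto
  then have "M4 \<le> (2 * K)\<^sup>2 * (4 * E\<^sup>2 + 1)"
    using M4 by (smt (verit) mult_right_mono zero_le_power2)
  then have "1 / (2 * K ^ 3) * M4 \<le> 1 / (2 * K ^ 3) * ((2 * K)\<^sup>2 * (4 * E\<^sup>2 + 1))"
    using K by (intro mult_left_mono) auto
  also have "\<dots> = (8 * E\<^sup>2 + 2) / K"
    using K by (simp add: power2_eq_square power3_eq_cube field_simps)
  finally have e3: "1 / (2 * K ^ 3) * M4 \<le> (8 * E\<^sup>2 + 2) / K" .
  have "c * M2 + d + 1 / (2 * K ^ 3) * M4 \<le> 4 * E / K + 1 / K + (8 * E\<^sup>2 + 2) / K"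
    using e1 e2 e3 by simp
  also have "\<dots> = (8 * E\<^sup>2 + 4 * E + 3) / K" by (simp add: add_divide_distrib)
  finally show ?thesis using 1 by (simp add: f_def K_def)
qed

text \<open>Away from the turning points \<open>\<plusminus>J\<close> the hopping is comparable to \<open>J\<close>; near them the
  fourth moment takes over.\<close>
lemma hopping_defect:
  assumes J: "spinJ j \<le> b" "b \<le> spinJ j + 1" "1 \<le> spinJ j"
  shows "(b / 2 - hop j x) * (v - u)\<^sup>2 \<le>
     4 / (spinJ j)\<^sup>2 * (hop j x * (((of_int x)\<^sup>2 + (of_int x + 1)\<^sup>2) / 2) * (v - u)\<^sup>2)
     + 2 / spinJ j * (hop j x * (v - u)\<^sup>2)
     + 4 / spinJ j ^ 3 * ((8 * of_int x ^ 4 + 1 / 2) * u\<^sup>2 + (8 * (of_int x + 1) ^ 4 + 1 / 2) * v\<^sup>2)"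
proof -
  define K where "K = spinJ j"
  define y where "y = real_of_int x"
  define h where "h = hop j x"
  define t where "t = y + 1 / 2"
  define A where "A = 4 / K\<^sup>2 * (h * ((y\<^sup>2 + (y + 1)\<^sup>2) / 2) * (v - u)\<^sup>2)"
  define B where "B = 2 / K * (h * (v - u)\<^sup>2)"
  define C where "C = 4 / K ^ 3 * ((8 * y ^ 4 + 1 / 2) * u\<^sup>2 + (8 * (y + 1) ^ 4 + 1 / 2) * v\<^sup>2)"
  have K: "K \<ge> 1" "K \<le> b" "b \<le> K + 1" using J by (simp_all add: K_def)
  have h0: "h \<ge> 0" by (simp add: h_def)
  have nn: "A \<ge> 0" "B \<ge> 0" "C \<ge> 0" unfolding A_def B_def C_def using K h0 by auto
  have "(b / 2 - h) * (v - u)\<^sup>2 \<le> A + B + C"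
  \<comment> \<open>The value 3/4 makes sqrt(K^2 - t^2) at least K/2 in the first case, hence
    \<open>h \<ge> K / 4\<close>. In the second, t^4 is at least 9/16 K^4 and pays for the whole
    defect.\<close>
  proof (cases "t\<^sup>2 \<le> 3 / 4 * K\<^sup>2")
    case True
    have 1: "K / 2 - t\<^sup>2 / (2 * K) \<le> h"
      using hop_lower'[of j x] by (simp add: K_def h_def t_def y_def)
    have "K / 4 \<le> h"
    proof -
      have "(K / 2)\<^sup>2 = K\<^sup>2 / 4" by (simp add: power_divide)
      then have "(K / 2)\<^sup>2 \<le> K\<^sup>2 - t\<^sup>2" using True by linarith
      then have "max 0 (K\<^sup>2 - t\<^sup>2) \<ge> (K / 2)\<^sup>2" by linarith
      then have "sqrt (max 0 (K\<^sup>2 - t\<^sup>2)) \<ge> K / 2" by (rule real_le_rsqrt)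
      then show ?thesis by (simp add: h_def hop_def K_def t_def y_def)
    qed
    then have h4: "1 \<le> 4 / K * h" using K by (simp add: field_simps)
    have "t\<^sup>2 / (2 * K) \<le> t\<^sup>2 / (2 * K) * (4 / K * h)"
      using mult_left_mono[OF h4, of "t\<^sup>2 / (2 * K)"] K by simp
    moreover have "1 / 2 \<le> 2 / K * h" using h4 by simp
    moreover have "b / 2 - h \<le> t\<^sup>2 / (2 * K) + 1 / 2" using 1 K by linarith
    ultimately have "b / 2 - h \<le> t\<^sup>2 / (2 * K) * (4 / K * h) + 2 / K * h"
      by (meson add_mono order_trans)
    also have "t\<^sup>2 / (2 * K) * (4 / K * h) = 2 / K\<^sup>2 * (h * t\<^sup>2)"
      using K by (simp add: power2_eq_square)
    also have "2 / K\<^sup>2 * (h * t\<^sup>2) \<le> 4 / K\<^sup>2 * (h * ((y\<^sup>2 + (y + 1)\<^sup>2) / 2))"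
    proof (intro mult_mono)
      show "t\<^sup>2 \<le> (y\<^sup>2 + (y + 1)\<^sup>2) / 2" by (simp add: t_def power2_eq_square field_simps)
    qed (use h0 in \<open>auto intro: divide_right_mono\<close>)
    finally have "(b / 2 - h) * (v - u)\<^sup>2
        \<le> (4 / K\<^sup>2 * (h * ((y\<^sup>2 + (y + 1)\<^sup>2) / 2)) + 2 / K * h) * (v - u)\<^sup>2"
      by (intro mult_right_mono) auto
    also have "\<dots> = A + B" by (simp add: A_def B_def algebra_simps)
    finally show ?thesis using nn by linarith
  next
    case False
    have bK: "b / 2 - h \<le> K" using K h0 by simp
    have sq: "(v - u)\<^sup>2 \<le> 2 * (u\<^sup>2 + v\<^sup>2)"
      using zero_le_power2[of "v + u"] by (simp add: power2_eq_square algebra_simps)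
    have "(9 / 16) * K ^ 4 \<le> t ^ 4"
    proof -
      have "(3 / 4 * K\<^sup>2)\<^sup>2 \<le> (t\<^sup>2)\<^sup>2" using False by (intro power_mono) auto
      then show ?thesis by (simp add: power_mult_distrib power_divide flip: power_mult)
    qed
    then have "K ^ 4 \<le> 2 * t ^ 4" using K zero_le_power[of K 4] by linarith
    then have Kt: "K \<le> 2 * t ^ 4 / K ^ 3" using K
      by (simp add: pos_le_divide_eq power4_eq_xxxx power3_eq_cube mult.assoc)
    \<comment> \<open>Both ends of the edge lie at distance 1/2 from its midpoint \<open>t\<close>.
      The fourth power is moved to the site where \<open>u\<close> or \<open>v\<close> sits, so that
      summing over x produces fourth moments.\<close>
    have t4: "t ^ 4 \<le> 8 * z ^ 4 + 1 / 2" if "z = y \<or> z = y + 1" for z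
    proof -
      have p2: "(p + q)\<^sup>2 \<le> 2 * (p\<^sup>2 + q\<^sup>2)" for p q :: real
        using zero_le_power2[of "p - q"] by (simp add: power2_eq_square algebra_simps)
      define q where "q = t - z"
      have "\<bar>q\<bar> = 1 / 2" using that by (auto simp: q_def t_def)
      then have "\<bar>q\<bar>\<^sup>2 = (1 / 2)\<^sup>2" by (simp only:)
      then have q2: "q\<^sup>2 = 1 / 4" by (simp add: power_divide)
      have q: "t = z + q" by (simp add: q_def)
      have "t\<^sup>2 \<le> 2 * (z\<^sup>2 + 1 / 4)" using p2[of z q] by (simp only: q q2)
      then have "(t\<^sup>2)\<^sup>2 \<le> (2 * (z\<^sup>2 + 1 / 4))\<^sup>2" by (intro power_mono) auto
      also have "\<dots> = 4 * (z\<^sup>2 + 1 / 4)\<^sup>2" by (simp only: power_mult_distrib) simp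
      also have "\<dots> \<le> 4 * (2 * ((z\<^sup>2)\<^sup>2 + (1 / 4)\<^sup>2))" using p2[of "z\<^sup>2" "1 / 4"] by simp
      finally show ?thesis by (simp add: power2_eq_square power4_eq_xxxx)
    qed
    have "(b / 2 - h) * (v - u)\<^sup>2 \<le> K * (2 * (u\<^sup>2 + v\<^sup>2))"
      using bK sq K by (intro mult_mono) auto
    also have "\<dots> \<le> 2 * t ^ 4 / K ^ 3 * (2 * (u\<^sup>2 + v\<^sup>2))"
      using Kt by (rule mult_right_mono) simp
    also have "\<dots> = 4 / K ^ 3 * (t ^ 4 * u\<^sup>2 + t ^ 4 * v\<^sup>2)" by (simp add: field_simps)
    also have "\<dots> \<le> C"
      unfolding C_def using t4 K by (intro mult_left_mono add_mono mult_right_mono) auto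
    finally show ?thesis using nn by linarith
  qed
  then show ?thesis by (simp add: A_def B_def C_def K_def y_def h_def)
qed

text \<open>Here the larger hopping b/2 is on the wrong side, so the kinetic defect has to be paid
  for: by \<open>T\<close> and \<open>A\<close> in the bulk and by the fourth moment near the
  turning points. In 264 = 8 + 256 the parts come from \<open>T\<close> and from
  \<open>M4\<close>.\<close>

lemma qf_phi_le:
  fixes b :: real and l :: nat
  assumes J: "spinJ j \<le> b" "b \<le> spinJ j + 1" "1 \<le> spinJ j" and l: "l \<le> 2 * j"
  defines "E \<equiv> real l + 1 / 2"
  shows "qf b (phi j l) (phi j l) \<le> E + (264 * E\<^sup>2 + 2 * E + 71) / spinJ j"
proof -
  define K where "K = spinJ j"
  define f where "f = phi j l"
  have K: "K \<ge> 1" "K \<le> b" "b \<le> K + 1" using J by (simp_all add: K_def)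
  have E0: "E \<ge> 0" by (simp add: E_def)
  have f: "qdom f" "sqs f" "ip f f = 1" and f0: "\<And>x. \<bar>x\<bar> > int j \<Longrightarrow> f x = 0"
    using orthonormal_onD(2)[OF phi_orthonormal, of l j l] l
    by (simp_all add: f_def qdom_phi sqs_phi phi_support)
  define A where "A = (\<lambda>x. hop j x * (fdiff f x)\<^sup>2 + (spinJ j - hop j x - hop j (x - 1)) * (f x)\<^sup>2)"
  have "ip f (spin j f) = E"
    using f(3) unfolding f_def spin_phi E_def by (simp add: ip_scale_right)
  then have A: "(A has_sum E) UNIV" using spin_form[OF f(2), of j] by (simp add: A_def)
  \<comment> \<open>The parabola eventually exceeds \<open>spinW\<close> outside the band, but
    \<open>f\<close> vanishes there.\<close>
  have wA: "(of_int x)\<^sup>2 / (2 * K) * (f x)\<^sup>2 \<le> spinW j x * (f x)\<^sup>2" for x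
  proof (cases "\<bar>x\<bar> \<le> int j")
    case True
    then show ?thesis unfolding K_def by (intro mult_right_mono spinW_lower) auto
  qed (simp add: f0)
  have xA: "(xmul f x)\<^sup>2 \<le> 2 * K * A x" for x
  proof -
    have "(of_int x)\<^sup>2 / (2 * K) * (f x)\<^sup>2 \<le> A x"
      using wA[of x] by (simp add: A_def spinW_def[symmetric] add_increasing)
    then have "2 * K * ((of_int x)\<^sup>2 / (2 * K) * (f x)\<^sup>2) \<le> 2 * K * A x"
      using K by (intro mult_left_mono) auto
    then show ?thesis using K by (simp add: xmul_def power_mult_distrib)
  qed
  define M2 where "M2 = ip (xmul f) (xmul f)"
  have M2: "M2 \<le> 2 * K * E"
    using sqs_infsum_dominated(2)[OF has_sum_imp_summable[OF A] xA] infsumI[OF A] by (simp add: M2_def)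
  define T where "T = (\<lambda>x. spinW j x * (of_int x)\<^sup>2 * (f x)\<^sup>2
    + hop j x * (((of_int x)\<^sup>2 + (of_int x + 1)\<^sup>2) / 2) * (fdiff f x)\<^sup>2)"
  have T: "T summable_on UNIV" "infsum T UNIV \<le> E * M2 + K / 2"
  proof -
    have eig: "spinJ j * f x - hop j x * f (x + 1) - hop j (x - 1) * f (x - 1) = E * f x" for x
      using spin_phi[of j l x] by (simp add: spin_def f_def E_def)
    have bd: "\<bar>hop j x\<bar> \<le> spinJ j / 2" for x using hop_le[of j x] by simp
    \<comment> \<open>The hopping decreases away from the centre, so 2x (hop x - hop (x - 1)) is
      nonpositive; the remaining hop x + hop (x - 1) is at most J.\<close>
    have S: "hop j x * (2 * of_int x + 1) - hop j (x - 1) * (2 * of_int x - 1) \<le> spinJ j" for x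
    proof -
      have "of_int x * (hop j x - hop j (x - 1)) \<le> 0"
      proof (cases "x \<ge> 0")
        case True
        have "hop j x \<le> hop j (x - 1)"
          unfolding hop_def using True
          by (intro mult_left_mono real_sqrt_le_mono max.mono) (auto simp: power2_eq_square algebra_simps)
        then show ?thesis using True by (intro mult_nonneg_nonpos) auto
      next
        case False
        have "hop j (x - 1) \<le> hop j x"
          unfolding hop_def using False
          by (intro mult_left_mono real_sqrt_le_mono max.mono) (auto simp: power2_eq_square algebra_simps)
        then show ?thesis using False by (intro mult_nonpos_nonneg) auto
      qed
      then show ?thesis
        using hop_le[of j x] hop_le[of j "x - 1"] by (simp add: algebra_simps)
    qed
    note w = weighted_eigen[OF f(1), of "\<lambda>_. spinJ j" "hop j" E "spinJ j / 2" "spinJ j", OF eig bd S]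
    show "T summable_on UNIV" "infsum T UNIV \<le> E * M2 + K / 2"
      unfolding T_def spinW_def using w by (simp_all add: K_def M2_def f(3))
  qed
  have TE: "infsum T UNIV \<le> K * (2 * E\<^sup>2 + 1 / 2)"
  proof -
    have "E * M2 \<le> E * (2 * K * E)" using M2 E0 by (rule mult_left_mono)
    with T(2) show ?thesis by (simp add: power2_eq_square algebra_simps)
  qed
  have T4: "(x2mul f x)\<^sup>2 \<le> 2 * K * T x" for x
  proof -
    have "(of_int x)\<^sup>2 * ((of_int x)\<^sup>2 / (2 * K) * (f x)\<^sup>2) \<le> (of_int x)\<^sup>2 * (spinW j x * (f x)\<^sup>2)"
      using wA by (rule mult_left_mono) simp
    also have "\<dots> \<le> T x" by (simp add: T_def mult_ac)
    finally have "2 * K * ((of_int x)\<^sup>2 * ((of_int x)\<^sup>2 / (2 * K) * (f x)\<^sup>2)) \<le> 2 * K * T x"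
      using K by (intro mult_left_mono) auto
    then show ?thesis using K by (simp add: x2mul_def power2_eq_square mult_ac)
  qed
  define M4 where "M4 = ip (x2mul f) (x2mul f)"
  have x2: "sqs (x2mul f)" by (rule sqs_infsum_dominated(1)[OF T(1) T4])
  have M4: "M4 \<le> K\<^sup>2 * (4 * E\<^sup>2 + 1)"
  proof -
    have "M4 \<le> 2 * K * infsum T UNIV"
      unfolding M4_def by (rule sqs_infsum_dominated(2)[OF T(1) T4])
    also have "\<dots> \<le> 2 * K * (K * (2 * E\<^sup>2 + 1 / 2))" using TE K by (intro mult_left_mono) auto
    finally show ?thesis by (simp add: power2_eq_square algebra_simps)
  qed
  define Z where "Z = (\<lambda>x. 8 * (x2mul f x * x2mul f x) + 1 / 2 * (f x * f x))"
  have Z: "(Z has_sum (8 * M4 + 1 / 2)) UNIV"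
  proof -
    have "(Z has_sum (8 * M4 + 1 / 2 * ip f f)) UNIV"
      unfolding Z_def M4_def ip_def
      by (intro has_sum_add has_sum_cmult_right has_sum_infsum ip_summable x2 f)
    then show ?thesis by (simp add: f(3))
  qed
  have Z1: "((\<lambda>x. Z (x + 1)) has_sum (8 * M4 + 1 / 2)) UNIV"
    using has_sum_reindex_bij_betw[OF bij_int_shift(1)[of 1], of Z] Z by simp
  have pt: "b / 2 * (fdiff f x)\<^sup>2 + 1 / (2 * b) * (xmul f x)\<^sup>2
     \<le> A x + (4 / K\<^sup>2 * T x + 2 / K * A x + 4 / K ^ 3 * (Z x + Z (x + 1)))" for x
  proof -
    have 1: "(b / 2 - hop j x) * (fdiff f x)\<^sup>2
      \<le> 4 / K\<^sup>2 * (hop j x * (((of_int x)\<^sup>2 + (of_int x + 1)\<^sup>2) / 2) * (fdiff f x)\<^sup>2)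
     + 2 / K * (hop j x * (fdiff f x)\<^sup>2)
     + 4 / K ^ 3 * ((8 * of_int x ^ 4 + 1 / 2) * (f x)\<^sup>2 + (8 * (of_int x + 1) ^ 4 + 1 / 2) * (f (x + 1))\<^sup>2)"
      unfolding fdiff_def K_def by (rule hopping_defect[OF J])
    have 2: "4 / K\<^sup>2 * (hop j x * (((of_int x)\<^sup>2 + (of_int x + 1)\<^sup>2) / 2) * (fdiff f x)\<^sup>2) \<le> 4 / K\<^sup>2 * T x"
      using spinW_nonneg[of j x] by (intro mult_left_mono) (auto simp: T_def)
    have 3: "2 / K * (hop j x * (fdiff f x)\<^sup>2) \<le> 2 / K * A x"
      using spinW_nonneg[of j x] K by (intro mult_left_mono) (auto simp: A_def spinW_def[symmetric])
    have 4: "(8 * of_int x ^ 4 + 1 / 2) * (f x)\<^sup>2 + (8 * (of_int x + 1) ^ 4 + 1 / 2) * (f (x + 1))\<^sup>2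
        = Z x + Z (x + 1)"
      by (simp add: Z_def x2mul_def power2_eq_square power4_eq_xxxx algebra_simps)
    have 5: "1 / (2 * b) * (xmul f x)\<^sup>2 \<le> spinW j x * (f x)\<^sup>2"
    proof -
      have "1 / (2 * b) * (xmul f x)\<^sup>2 \<le> 1 / (2 * K) * (xmul f x)\<^sup>2"
        using K by (intro mult_right_mono divide_left_mono) auto
      also have "\<dots> = (of_int x)\<^sup>2 / (2 * K) * (f x)\<^sup>2" by (simp add: xmul_def power_mult_distrib)
      also note wA
      finally show ?thesis .
    qed
    have 6: "A x = hop j x * (fdiff f x)\<^sup>2 + spinW j x * (f x)\<^sup>2" by (simp add: A_def spinW_def)
    have 7: "(b / 2 - hop j x) * (fdiff f x)\<^sup>2 = b / 2 * (fdiff f x)\<^sup>2 - hop j x * (fdiff f x)\<^sup>2"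
      by (rule left_diff_distrib)
    show ?thesis using 1 2 3 5 6 7 unfolding 4 by linarith
  qed
  have "qf b f f \<le> E + (4 / K\<^sup>2 * infsum T UNIV + 2 / K * E + 4 / K ^ 3 * ((8 * M4 + 1 / 2) + (8 * M4 + 1 / 2)))"
    by (rule has_sum_mono[OF qf_has_sum[OF f(1)] _ pt])
       (intro has_sum_add has_sum_cmult_right A Z Z1 has_sum_infsum T(1))
  moreover have "4 / K\<^sup>2 * infsum T UNIV \<le> 4 / K\<^sup>2 * (K * (2 * E\<^sup>2 + 1 / 2))"
    using TE by (rule mult_left_mono) simp
  moreover have "4 / K\<^sup>2 * (K * (2 * E\<^sup>2 + 1 / 2)) = (8 * E\<^sup>2 + 2) / K"
    using K by (simp add: power2_eq_square field_simps)
  moreover have "4 / K ^ 3 * ((8 * M4 + 1 / 2) + (8 * M4 + 1 / 2)) \<le> (64 * (4 * E\<^sup>2 + 1) + 4) / K"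
  proof -
    have "4 / K ^ 3 * ((8 * M4 + 1 / 2) + (8 * M4 + 1 / 2)) = 4 / K ^ 3 * (16 * M4 + 1)" by simp
    also have "\<dots> \<le> 4 / K ^ 3 * (16 * (K\<^sup>2 * (4 * E\<^sup>2 + 1)) + K\<^sup>2)"
      using M4 K by (intro mult_left_mono add_mono) (auto intro: one_le_power)
    also have "\<dots> = (64 * (4 * E\<^sup>2 + 1) + 4) / K"
      using K by (simp add: power2_eq_square power3_eq_cube field_simps)
    finally show ?thesis .
  qed
  ultimately have "qf b f f \<le> E + ((8 * E\<^sup>2 + 2) / K + 2 / K * E + (64 * (4 * E\<^sup>2 + 1) + 4) / K)"
    by linarith
  also have "(8 * E\<^sup>2 + 2) / K + 2 / K * E + (64 * (4 * E\<^sup>2 + 1) + 4) / K = (264 * E\<^sup>2 + 2 * E + 70) / K"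
    by (simp add: add_divide_distrib[symmetric])
  also have "\<dots> \<le> (264 * E\<^sup>2 + 2 * E + 71) / K" using K by (intro divide_right_mono) auto
  finally show ?thesis by (simp add: f_def K_def)
qed

section \<open>Convergence of the eigenvalue sums\<close>

lemma ev_sum_upper:
  assumes J: "spinJ j \<le> b" "b \<le> spinJ j + 1" "1 \<le> spinJ j" and k: "k \<le> 2 * j"
  shows "(\<Sum>l\<le>k. ev b l) \<le> (\<Sum>l\<le>k. (real l + 1 / 2)
    + (264 * (real l + 1 / 2)\<^sup>2 + 2 * (real l + 1 / 2) + 71) / spinJ j)"
proof -
  have b: "b > 0" using J by simp
  have "(\<Sum>l\<le>k. ev b l) \<le> (\<Sum>l\<le>k. qf b (phi j l) (phi j l))"
  proof (rule Ky_Fan)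
    show "orthonormal_on {..<k} (psi b)"
      by (rule orthonormal_on_subset[OF psi_orthonormal[OF b]]) simp
    show "orthonormal_on {..k} (phi j)"
      by (rule orthonormal_on_subset[OF phi_orthonormal]) (use k in auto)
    show "ev b i \<le> ev b k" if "i < k" for i using ev_mono[OF b] that by simp
    show "ev b k - (\<Sum>i<k. (ev b k - ev b i) * (ip (phi j l) (psi b i))\<^sup>2) \<le> qf b (phi j l) (phi j l)"
      if "l \<le> k" for l
      using qf_ge_ev[OF b qdom_phi, of k j l] orthonormal_onD(2)[OF phi_orthonormal, of l j l] that k
      by simp
  qed
  also have "\<dots> \<le> (\<Sum>l\<le>k. (real l + 1 / 2)
    + (264 * (real l + 1 / 2)\<^sup>2 + 2 * (real l + 1 / 2) + 71) / spinJ j)"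
    using k by (intro sum_mono qf_phi_le J) auto
  finally show ?thesis .
qed

lemma ev_sum_lower:
  assumes J: "spinJ j \<le> b" "b \<le> spinJ j + 1" "1 \<le> spinJ j" and k: "k \<le> j"
  shows "(\<Sum>l\<le>k. real l + 1 / 2)
    \<le> (\<Sum>l\<le>k. ev b l + (8 * (ev b l)\<^sup>2 + 4 * ev b l + 3) / spinJ j)"
proof -
  have b: "b > 0" using J by simp
  have "(\<Sum>l\<le>k. real l + 1 / 2) \<le> (\<Sum>l\<le>k. ip (psi b l) (spin j (psi b l)))"
  proof (rule Ky_Fan)
    show "orthonormal_on {..<k} (phi j)"
      by (rule orthonormal_on_subset[OF phi_orthonormal]) (use k in auto)
    show "orthonormal_on {..k} (psi b)"
      by (rule orthonormal_on_subset[OF psi_orthonormal[OF b]]) simp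
    show "real k + 1 / 2 - (\<Sum>i<k. (real k + 1 / 2 - (real i + 1 / 2)) * (ip (psi b l) (phi j i))\<^sup>2)
      \<le> ip (psi b l) (spin j (psi b l))" for l
      using spin_ge[OF psi_sqs[OF b] k, of l] ip_psi[OF b, of l l] by simp
  qed simp
  also have "\<dots> \<le> (\<Sum>l\<le>k. ev b l + (8 * (ev b l)\<^sup>2 + 4 * ev b l + 3) / spinJ j)"
    by (intro sum_mono spin_form_psi_le J)
  finally show ?thesis .
qed

lemma ev_sums_tendsto:
  "((\<lambda>b. \<Sum>l\<le>k. ev b l) \<longlongrightarrow> (\<Sum>l\<le>k. real l + 1 / 2)) at_top"
proof -
  define L where "L = (\<Sum>l\<le>k. real l + 1 / 2)"
  define C1 where "C1 = (\<Sum>l\<le>k. 264 * (real l + 1 / 2)\<^sup>2 + 2 * (real l + 1 / 2) + 71)"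
  define C where "C = L + C1"
  define C2 where "C2 = (real k + 1) * (8 * C\<^sup>2 + 4 * C + 3)"
  have C1: "C1 \<ge> 0" unfolding C1_def by (intro sum_nonneg) auto
  have "L \<ge> 0" unfolding L_def by (intro sum_nonneg) auto
  then have C0: "C \<ge> 0" using C1 by (simp add: C_def)
  have C2: "C2 \<ge> 0" using C0 by (simp add: C2_def)
  have bounds: "L - C2 / (b - 1) \<le> (\<Sum>l\<le>k. ev b l) \<and> (\<Sum>l\<le>k. ev b l) \<le> L + C1 / (b - 1)"
    if b: "b \<ge> real k + 4" for b
  proof -
    \<comment> \<open>Then J = j + 1/2 satisfies J <= b < J + 1, and
      \<open>b \<ge> real k + 4\<close> guarantees \<open>k \<le> j\<close> and J >= 1.\<close>
    define j where "j = nat \<lfloor>b - 1 / 2\<rfloor>"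
    have j: "real j = of_int \<lfloor>b - 1 / 2\<rfloor>" using b by (simp add: j_def)
    have J: "spinJ j \<le> b" "b \<le> spinJ j + 1" "1 \<le> spinJ j" "b - 1 \<le> spinJ j" and k: "k \<le> j"
      unfolding spinJ_def j using b floor_correct[of "b - 1 / 2"] j by linarith+
    have b0: "b > 0" "b - 1 > 0" using b by auto
    have up: "(\<Sum>l\<le>k. ev b l) \<le> L + C1 / spinJ j"
      unfolding L_def C1_def sum_divide_distrib sum.distrib[symmetric]
      using ev_sum_upper[OF J(1-3), of k] k by simp
    moreover have "C1 / spinJ j \<le> C1 / (b - 1)" using C1 J b0 by (intro divide_left_mono) auto
    moreover have "C1 / spinJ j \<le> C1" using C1 J(3) by (simp add: divide_le_eq mult_left_le_one_le)
        (metis C1 mult.right_neutral mult_left_mono)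
    ultimately have S: "(\<Sum>l\<le>k. ev b l) \<le> L + C1 / (b - 1)" "(\<Sum>l\<le>k. ev b l) \<le> C"
      by (simp_all add: C_def)
    \<comment> \<open>The upper bound on a sum of nonnegative terms bounds each of them; this makes
      the error in the lower bound uniform in b.\<close>
    have ev: "ev b l \<le> C" if "l \<le> k" for l
      using member_le_sum[of l "{..k}" "ev b"] that ev_nonneg[OF b0(1)] S(2) by auto
    have "L \<le> (\<Sum>l\<le>k. ev b l) + (\<Sum>l\<le>k. (8 * (ev b l)\<^sup>2 + 4 * ev b l + 3) / spinJ j)"
      using ev_sum_lower[OF J(1-3) k] by (simp add: L_def sum.distrib)
    also have "(\<Sum>l\<le>k. (8 * (ev b l)\<^sup>2 + 4 * ev b l + 3) / spinJ j)
        \<le> (\<Sum>l\<le>k. (8 * C\<^sup>2 + 4 * C + 3) / (b - 1))"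
    proof (intro sum_mono frac_le)
      fix l assume "l \<in> {..k}"
      then have "ev b l \<le> C" using ev by simp
      moreover from this have "(ev b l)\<^sup>2 \<le> C\<^sup>2" using ev_nonneg[OF b0(1)] by (intro power_mono) auto
      ultimately show "8 * (ev b l)\<^sup>2 + 4 * ev b l + 3 \<le> 8 * C\<^sup>2 + 4 * C + 3" by simp
    qed (use C0 J b0 in auto)
    also have "\<dots> = C2 / (b - 1)" by (simp add: C2_def algebra_simps)
    finally show ?thesis using S(1) by simp
  qed
  have ev: "\<forall>\<^sub>F b in at_top. b \<ge> real k + 4" by (rule eventually_ge_at_top)
  have lim: "((\<lambda>b::real. c / (b - 1)) \<longlongrightarrow> 0) at_top" for c :: real
    by real_asymp
  have "((\<lambda>b. L - C2 / (b - 1)) \<longlongrightarrow> L) at_top" "((\<lambda>b. L + C1 / (b - 1)) \<longlongrightarrow> L) at_top"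
    using tendsto_diff[OF tendsto_const lim[of C2], of L] tendsto_add[OF tendsto_const lim[of C1], of L]
    by simp_all
  then show ?thesis
    unfolding L_def[symmetric]
    by (rule tendsto_sandwich[rotated 2]) (use bounds in \<open>blast intro: eventually_mono[OF ev]\<close>)+
qed

lemma ev_tendsto: "((\<lambda>b. ev b k) \<longlongrightarrow> real k + 1 / 2) at_top"
proof (cases k)
  case 0
  then show ?thesis using ev_sums_tendsto[of 0] by simp
next
  case (Suc m)
  have "((\<lambda>b. (\<Sum>l\<le>k. ev b l) - (\<Sum>l\<le>m. ev b l)) \<longlongrightarrow>
      (\<Sum>l\<le>k. real l + 1 / 2) - (\<Sum>l\<le>m. real l + 1 / 2)) at_top"
    by (intro tendsto_diff ev_sums_tendsto)
  then show ?thesis by (simp add: Suc)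
qed

section \<open>Separation of variables\<close>

lemma bij_vec_nth: "bij (vec_nth :: 'a ^ 'd \<Rightarrow> 'd \<Rightarrow> 'a)"
  by (rule bij_betw_byWitness[where f' = vec_lambda]) auto

lemma infsum_vec_prod:
  fixes f :: "'d::finite \<Rightarrow> 'b \<Rightarrow> real"
  assumes "\<And>i. f i summable_on UNIV"
  shows "(\<Sum>\<^sub>\<infinity>x::'b ^ 'd. \<Prod>i\<in>UNIV. f i (x $ i)) = (\<Prod>i\<in>UNIV. infsum (f i) UNIV)"
proof -
  have "(\<Sum>\<^sub>\<infinity>x::'b ^ 'd. \<Prod>i\<in>UNIV. f i (x $ i)) = (\<Sum>\<^sub>\<infinity>g\<in>UNIV. \<Prod>i\<in>UNIV. f i (g i))"
    by (rule infsum_reindex_bij_betw[OF bij_vec_nth, of "\<lambda>g. \<Prod>i\<in>UNIV. f i (g i)"])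
  also have "\<dots> = (\<Prod>i\<in>UNIV. infsum (f i) UNIV)"
    using infsum_prod_PiE_abs[of UNIV f "\<lambda>_. UNIV", OF finite]
      assms[THEN summable_on_iff_abs_summable_on_real[THEN iffD1]]
    by (simp add: PiE_UNIV_domain)
  finally show ?thesis .
qed

lemma finite_box: "finite {m :: nat ^ 'd. \<forall>i. m $ i < K}"
  and sum_box_prod: "(\<Sum>m | \<forall>i. m $ i < K. \<Prod>i\<in>UNIV. f i (m $ i)) = (\<Prod>i\<in>UNIV. \<Sum>k<K. f i k)"
  for f :: "'d::finite \<Rightarrow> nat \<Rightarrow> real"
proof -
  have bij: "bij_betw vec_nth {m :: nat ^ 'd. \<forall>i. m $ i < K} (PiE UNIV (\<lambda>_. {..<K}))"
    by (rule bij_betw_byWitness[where f' = vec_lambda]) auto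
  then show "finite {m :: nat ^ 'd. \<forall>i. m $ i < K}"
    by (simp add: bij_betw_finite finite_PiE)
  show "(\<Sum>m | \<forall>i. m $ i < K. \<Prod>i\<in>UNIV. f i (m $ i)) = (\<Prod>i\<in>UNIV. \<Sum>k<K. f i k)"
    using sum.reindex_bij_betw[OF bij, of "\<lambda>g. \<Prod>i\<in>UNIV. f i (g i)"]
    by (simp add: prod_sum_PiE)
qed

section \<open>Product eigenfunctions and completeness on the lattice\<close>

definition osc_vec :: "('d::finite \<Rightarrow> real) \<Rightarrow> ('d \<Rightarrow> real) \<Rightarrow> (int ^ 'd \<Rightarrow> real) \<Rightarrow> int ^ 'd \<Rightarrow> real" where
  "osc_vec w b f x = (\<Sum>i\<in>UNIV. w i *
     (b i / 2 * (2 * f x - f (x + axis i 1) - f (x - axis i 1)) + (of_int (x $ i))\<^sup>2 / (2 * b i) * f x))"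

definition Psi :: "('d::finite \<Rightarrow> real) \<Rightarrow> nat ^ 'd \<Rightarrow> int ^ 'd \<Rightarrow> real" where
  "Psi b m x = (\<Prod>i\<in>UNIV. psi (b i) (m $ i) (x $ i))"

definition level :: "('d::finite \<Rightarrow> real) \<Rightarrow> ('d \<Rightarrow> real) \<Rightarrow> nat ^ 'd \<Rightarrow> real" where
  "level w b m = (\<Sum>i\<in>UNIV. w i * ev (b i) (m $ i))"

lemma bij_vec_shift [simp]:
  fixes c :: "int ^ 'd"
  shows "bij (\<lambda>x. x + c)" "bij (\<lambda>x. x - c)"
  by (rule bij_betw_byWitness[where f' = "\<lambda>x. x - c"]; auto)
     (rule bij_betw_byWitness[where f' = "\<lambda>x. x + c"]; auto)

text \<open>The unbounded potential \<open>V\<close> acts diagonally and cancels pointwise in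
  \<open>r x * kin P x - kin r x * P x\<close>; the kinetic part that remains is bounded and
  symmetric. This covers eigenfunctions about which only square summability is known.\<close>

lemma osc_vec_symmetric:
  fixes r P :: "int ^ 'd \<Rightarrow> real"
  assumes r: "sqs r" "\<And>x. osc_vec w b r x = \<mu> * r x"
    and P: "sqs P" "\<And>x. osc_vec w b P x = L * P x" and ne: "L \<noteq> \<mu>"
  shows "ip r P = 0"
proof -
  define kin where "kin f x = (\<Sum>i\<in>UNIV. (w i * b i / 2) *
    (2 * f x - (f (x + axis i 1) + f (x - axis i 1))))" for f :: "int ^ 'd \<Rightarrow> real" and x
  define V where "V x = (\<Sum>i\<in>UNIV. w i * ((of_int (x $ i))\<^sup>2 / (2 * b i)))" for x :: "int ^ 'd"
  have split: "osc_vec w b f x = kin f x + V x * f x" for f x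
    unfolding osc_vec_def kin_def V_def sum_distrib_right sum.distrib[symmetric]
    by (rule sum.cong) (simp_all add: algebra_simps)
  have sh: "sqs (\<lambda>x. f (x + c))" "sqs (\<lambda>x. f (x - c))" if "sqs f" for f :: "int ^ 'd \<Rightarrow> real" and c
    using that sqs_reindex[OF bij_vec_shift(1), of f c] sqs_reindex[OF bij_vec_shift(2), of f c] by auto
  have lap: "sqs (\<lambda>x. 2 * f x - (f (x + c) + f (x - c)))" if "sqs f" for f :: "int ^ 'd \<Rightarrow> real" and c
    using that by (intro sqs_diff sqs_scale sqs_add sh)
  have sk: "sqs (kin f)" if "sqs f" for f
    unfolding kin_def using that by (intro sqs_sum sqs_scale lap)
  have swp: "ip u (\<lambda>x. v (x + c)) = ip (\<lambda>x. u (x - c)) v" for u v :: "int ^ 'd \<Rightarrow> real" and c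
    using ip_reindex[OF bij_vec_shift(1)[of c], of "\<lambda>x. u (x - c)" v] by simp
  have lsym: "ip u (\<lambda>x. 2 * v x - (v (x + c) + v (x - c))) = ip (\<lambda>x. 2 * u x - (u (x + c) + u (x - c))) v"
    if "sqs u" "sqs v" for u v :: "int ^ 'd \<Rightarrow> real" and c
    using that swp[of u v c] swp[of u v "- c"]
    by (simp add: ip_diff_left ip_diff_right ip_add_left ip_add_right ip_scale_left ip_scale_right
        sqs_scale sqs_add sh)
  have "ip r (kin P) = ip (kin r) P"
  proof -
    have "ip r (kin P) = (\<Sum>i\<in>UNIV. w i * b i / 2 *
        ip r (\<lambda>x. 2 * P x - (P (x + axis i 1) + P (x - axis i 1))))"
      unfolding kin_def ip_scale_right[symmetric] using r(1) P(1)
      by (intro ip_sum_right sqs_scale lap)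
    also have "\<dots> = (\<Sum>i\<in>UNIV. w i * b i / 2 *
        ip (\<lambda>x. 2 * r x - (r (x + axis i 1) + r (x - axis i 1))) P)"
      by (simp only: lsym[OF r(1) P(1)])
    also have "\<dots> = ip (kin r) P"
      unfolding kin_def ip_scale_left[symmetric] using r(1) P(1)
      by (intro ip_sum_left[symmetric] sqs_scale lap)
    finally show ?thesis .
  qed
  moreover have "kin P = (\<lambda>x. L * P x - V x * P x)" "kin r = (\<lambda>x. \<mu> * r x - V x * r x)"
    using split P(2) r(2) by (auto simp: fun_eq_iff algebra_simps)
  then have "r x * kin P x - kin r x * P x = (L - \<mu>) * (r x * P x)" for x
    by (simp add: algebra_simps)
  then have "(\<Sum>\<^sub>\<infinity>x. r x * kin P x - kin r x * P x) = (L - \<mu>) * ip r P"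
    by (simp add: ip_def infsum_cmult_right')
  moreover have "(\<Sum>\<^sub>\<infinity>x. r x * kin P x - kin r x * P x) = ip r (kin P) - ip (kin r) P"
  proof -
    have "((\<lambda>x. r x * kin P x + - (kin r x * P x)) has_sum ip r (kin P) + - ip (kin r) P) UNIV"
      unfolding ip_def using r(1) P(1) sk
      by (intro has_sum_add has_sum_uminusI has_sum_infsum ip_summable) auto
    then show ?thesis by (simp add: infsumI)
  qed
  ultimately show ?thesis using ne by simp
qed

context
  fixes b :: "'d::finite \<Rightarrow> real"
  assumes b: "\<And>i. b i > 0"
begin

lemma infsum_Psi: "(\<Sum>\<^sub>\<infinity>x. Psi b m x * Psi b m' x) = (if m = m' then 1 else 0)"
proof -
  have "(\<Sum>\<^sub>\<infinity>x. Psi b m x * Psi b m' x)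
      = (\<Sum>\<^sub>\<infinity>x::int ^ 'd. \<Prod>i\<in>UNIV. psi (b i) (m $ i) (x $ i) * psi (b i) (m' $ i) (x $ i))"
    by (simp add: Psi_def prod.distrib)
  also have "\<dots> = (\<Prod>i\<in>UNIV. ip (psi (b i) (m $ i)) (psi (b i) (m' $ i)))"
    unfolding ip_def by (rule infsum_vec_prod) (intro ip_summable psi_sqs b)
  also have "\<dots> = (\<Prod>i\<in>UNIV. if m $ i = m' $ i then 1 else 0)"
    using b by (simp add: ip_psi)
  also have "\<dots> = (if m = m' then 1 else 0)"
    by (auto simp: vec_eq_iff)
  finally show ?thesis .
qed

lemma ip_Psi: "ip (Psi b m) (Psi b m') = (if m = m' then 1 else 0)"
  using infsum_Psi by (simp add: ip_def)

text \<open>A vanishing \<open>infsum\<close> could be a junk value; the value 1 forces summability.\<close>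
lemma sqs_Psi: "sqs (Psi b m)"
proof (rule ccontr)
  assume "\<not> ?thesis"
  then have "(\<Sum>\<^sub>\<infinity>x. Psi b m x * Psi b m x) = 0"
    unfolding sqs_def power2_eq_square by (rule infsum_not_exists)
  then show False using infsum_Psi[of m m] by simp
qed

lemma osc_vec_Psi: "osc_vec w b (Psi b m) x = level w b m * Psi b m x"
proof -
  have "b i / 2 * (2 * Psi b m x - Psi b m (x + axis i 1) - Psi b m (x - axis i 1))
      + (of_int (x $ i))\<^sup>2 / (2 * b i) * Psi b m x = ev (b i) (m $ i) * Psi b m x" for i
  proof -
    define R where "R = (\<Prod>j\<in>UNIV - {i}. psi (b j) (m $ j) (x $ j))"
    have eq: "Psi b m y = psi (b i) (m $ i) (y $ i) * R" if "\<And>j. j \<noteq> i \<Longrightarrow> y $ j = x $ j" for y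
      unfolding Psi_def R_def using that by (subst prod.remove[of _ i]) auto
    have "Psi b m x = psi (b i) (m $ i) (x $ i) * R"
      "Psi b m (x + axis i 1) = psi (b i) (m $ i) (x $ i + 1) * R"
      "Psi b m (x - axis i 1) = psi (b i) (m $ i) (x $ i - 1) * R"
      using eq[of x] eq[of "x + axis i 1"] eq[of "x - axis i 1"] by (simp_all add: axis_def)
    moreover have "osc (b i) (psi (b i) (m $ i)) (x $ i) * R = ev (b i) (m $ i) * psi (b i) (m $ i) (x $ i) * R"
      using osc_psi[OF b] by simp
    ultimately show ?thesis by (simp add: osc_def algebra_simps)
  qed
  then show ?thesis by (simp add: osc_vec_def level_def sum_distrib_right mult.assoc)
qed

end

context
  fixes w b :: "'d::finite \<Rightarrow> real"
  assumes w: "\<And>i. w i > 0" and b: "\<And>i. b i > 0"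
begin

lemma level_ge: "w i * ev (b i) (m $ i) \<le> level w b m"
  unfolding level_def
  by (rule member_le_sum) (auto intro!: mult_nonneg_nonneg less_imp_le[OF w] ev_nonneg[OF b])

lemma finite_level: "finite {m. level w b m \<le> t}"
proof -
  have "\<exists>K. \<forall>i k. w i * ev (b i) k \<le> t \<longrightarrow> k < K"
  proof -
    have "\<exists>K. \<forall>k. w i * ev (b i) k \<le> t \<longrightarrow> k < K" for i
    proof -
      obtain K where K: "t / w i + 1 \<le> ev (b i) K" using ev_unbounded[OF b] by blast
      have "k < K" if "w i * ev (b i) k \<le> t" for k
      proof (rule ccontr)
        assume "\<not> k < K"
        then have "t / w i + 1 \<le> ev (b i) k" using K ev_mono[OF b, of K k i] by simp
        then have "w i * (t / w i + 1) \<le> w i * ev (b i) k" using w[of i] by (intro mult_left_mono) auto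
        then show False using that w[of i] by (simp add: distrib_left)
      qed
      then show ?thesis by blast
    qed
    then obtain K where K: "\<And>i k. w i * ev (b i) k \<le> t \<Longrightarrow> k < K i" by metis
    have "k < Max (range K)" if "w i * ev (b i) k \<le> t" for i k
      using K[OF that] Max_ge[OF finite_imageI[OF finite] rangeI] less_le_trans by blast
    then show ?thesis by blast
  qed
  then obtain K where K: "\<And>i k. w i * ev (b i) k \<le> t \<Longrightarrow> k < K" by blast
  have "{m. level w b m \<le> t} \<subseteq> {m. \<forall>i. m $ i < K}"
    using K level_ge order_trans by blast
  then show ?thesis using finite_box finite_subset by blast
qed

text \<open>Coefficients at levels above \<open>t\<close> vanish by orthogonality, since they differ
  from \<open>\<mu>\<close>. For equality, project the point mass at x onto a growing box of
  indices: its residual has squared norm 1 minus a product of one-dimensional Parseval sums, which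
  tends to 0, and Cauchy-Schwarz transfers this to \<open>r\<close>.\<close>

lemma eigenfunction_expansion:
  assumes r: "sqs r" "\<And>x. osc_vec w b r x = \<mu> * r x" and t: "\<mu> \<le> t"
  shows "r x = (\<Sum>m | level w b m \<le> t. ip r (Psi b m) * Psi b m x)"
proof -
  let ?M = "{m. level w b m \<le> t}"
  have zero: "ip r (Psi b m) = 0" if "m \<notin> ?M" for m
    by (rule osc_vec_symmetric[OF r sqs_Psi[where b = b, OF b] osc_vec_Psi[where b = b, OF b]]) (use that t in auto)
  define D where "D = r x - (\<Sum>m\<in>?M. ip r (Psi b m) * Psi b m x)"
  define Bx where "Bx K = {m :: nat ^ 'd. \<forall>i. m $ i < K}" for K
  have fin: "finite (Bx K)" for K unfolding Bx_def by (rule finite_box)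
  define e where "e K = 1 - (\<Prod>i\<in>UNIV. \<Sum>k<K. (psi (b i) k (x $ i))\<^sup>2)" for K
  obtain K0 where K0: "?M \<subseteq> Bx K0"
  proof -
    have "m \<in> Bx (Suc (Max (insert 0 (\<Union>m\<in>?M. range (vec_nth m)))))" if "m \<in> ?M" for m
    proof -
      have "m $ i \<le> Max (insert 0 (\<Union>m\<in>?M. range (vec_nth m)))" for i
        using that finite_level by (intro Max_ge) auto
      then show ?thesis by (simp add: Bx_def less_Suc_eq_le)
    qed
    then show ?thesis using that by blast
  qed
  have on: "orthonormal_on (Bx K) (Psi b)" for K
    unfolding orthonormal_on_def using sqs_Psi[where b = b, OF b] ip_Psi[where b = b, OF b] by auto
  have key: "D\<^sup>2 \<le> ip r r * e K" if "K \<ge> K0" for K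
  proof -
    define g where "g = (\<lambda>y. delta x y - (\<Sum>m\<in>Bx K. ip (delta x) (Psi b m) * Psi b m y))"
    note res = orthonormal_residual[OF on[of K] fin sqs_delta[of x]]
    have "ip g g = 1 - (\<Sum>m\<in>Bx K. (Psi b m x)\<^sup>2)" unfolding g_def res(3) by (simp add: delta_def)
    also have "(\<Sum>m\<in>Bx K. (Psi b m x)\<^sup>2) = (\<Prod>i\<in>UNIV. \<Sum>k<K. (psi (b i) k (x $ i))\<^sup>2)"
      unfolding Psi_def Bx_def prod_power_distrib by (rule sum_box_prod)
    finally have g: "ip g g = e K" by (simp add: e_def)
    have "ip r g = r x - (\<Sum>m\<in>Bx K. Psi b m x * ip r (Psi b m))"
      unfolding g_def using r(1) sqs_Psi[where b = b, OF b]
      by (subst ip_diff_right) (auto intro!: sqs_sum simp: ip_sum_right[OF sqs_scale] ip_scale_right)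
    also have "(\<Sum>m\<in>Bx K. Psi b m x * ip r (Psi b m)) = (\<Sum>m\<in>?M. Psi b m x * ip r (Psi b m))"
    proof (rule sum.mono_neutral_right[OF fin])
      have "Bx K0 \<subseteq> Bx K" using that by (auto simp: Bx_def intro: less_le_trans)
      with K0 show "?M \<subseteq> Bx K" by blast
    qed (use zero in auto)
    finally have "ip r g = D" by (simp add: D_def mult.commute)
    then show ?thesis using ip_Cauchy_Schwarz[OF r(1), of g] res(1) g by (simp add: g_def)
  qed
  have "(\<lambda>K. ip r r * e K) \<longlonglongrightarrow> ip r r * (1 - (\<Prod>i\<in>(UNIV::'d set). 1))"
    unfolding e_def by (intro tendsto_intros tendsto_prod Parseval_psi b)
  then have "D\<^sup>2 \<le> ip r r * (1 - (\<Prod>i\<in>(UNIV::'d set). 1))"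
    by (rule LIMSEQ_le_const) (use key in blast)
  then show ?thesis by (simp add: D_def)
qed

end

text \<open>Gaussian elimination on the equation \<open>j\<close> with pivot \<open>i0\<close>,
  whose own coefficient is chosen last so that this equation holds. It will force linear dependence
  among too many eigenfunctions.\<close>

lemma homogeneous_system_nontrivial:
  fixes a :: "'i \<Rightarrow> 'j \<Rightarrow> 'k::field"
  assumes "finite J" "finite I" "card J < card I"
  shows "\<exists>c. (\<exists>i\<in>I. c i \<noteq> 0) \<and> (\<forall>j\<in>J. (\<Sum>i\<in>I. c i * a i j) = 0)"
  using assms
proof (induction J arbitrary: I a rule: finite_induct)
  case empty
  then obtain i where "i \<in> I" by fastforce
  then show ?case by (intro exI[of _ "\<lambda>_. 1"]) auto
next
  case (insert j J)
  show ?case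
  proof (cases "\<forall>i\<in>I. a i j = 0")
    case True
    have "card J < card I" using insert.prems insert.hyps by simp
    from insert.IH[OF insert.prems(1) this, of a] True show ?thesis by auto
  next
    case False
    then obtain i0 where i0: "i0 \<in> I" "a i0 j \<noteq> 0" by blast
    define I' where "I' = I - {i0}"
    have I': "finite I'" "card J < card I'" using insert.prems insert.hyps i0 by (auto simp: I'_def)
    obtain c where c: "\<exists>i\<in>I'. c i \<noteq> 0"
      "\<And>l. l \<in> J \<Longrightarrow> (\<Sum>i\<in>I'. c i * (a i l - a i j / a i0 j * a i0 l)) = 0"
      using insert.IH[OF I', of "\<lambda>i l. a i l - a i j / a i0 j * a i0 l"] by blast
    define s where "s = (\<Sum>i\<in>I'. c i * a i j) / a i0 j"
    define c' where "c' = c(i0 := - s)"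
    have sum: "(\<Sum>i\<in>I. c' i * a i l) = - s * a i0 l + (\<Sum>i\<in>I'. c i * a i l)" for l
    proof -
      have "(\<Sum>i\<in>I. c' i * a i l) = c' i0 * a i0 l + (\<Sum>i\<in>I'. c' i * a i l)"
        unfolding I'_def using i0 insert.prems by (intro sum.remove)
      also have "(\<Sum>i\<in>I'. c' i * a i l) = (\<Sum>i\<in>I'. c i * a i l)"
        by (rule sum.cong) (auto simp: c'_def I'_def)
      finally show ?thesis by (simp add: c'_def)
    qed
    have "(\<Sum>i\<in>I. c' i * a i j) = 0" using i0 by (simp add: sum s_def)
    moreover have "(\<Sum>i\<in>I. c' i * a i l) = 0" if "l \<in> J" for l
    proof -
      have "0 = (\<Sum>i\<in>I'. c i * a i l - c i * a i j / a i0 j * a i0 l)"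
        using c(2)[OF that] by (simp add: right_diff_distrib mult.assoc)
      also have "\<dots> = (\<Sum>i\<in>I'. c i * a i l) - s * a i0 l"
        by (simp add: sum_subtractf s_def sum_distrib_right sum_divide_distrib)
      finally show ?thesis by (simp add: sum)
    qed
    moreover have "\<exists>i\<in>I. c' i \<noteq> 0" using c(1) by (auto simp: c'_def I'_def)
    ultimately show ?thesis by blast
  qed
qed

section \<open>Enumerating levels\<close>

text \<open>Common abstraction of the rescaled \<open>En\<close> and of \<open>e_harm\<close>: both
  enumerate levels over the same index set, so convergence can be proved level by level.\<close>

definition nth_level :: "('m \<Rightarrow> real) \<Rightarrow> nat \<Rightarrow> real" where
  "nth_level L n = Inf {t. card {m. L m \<le> t} > n}"

lemma Inf_scale:
  fixes c :: real
  assumes "c > 0" "A \<noteq> {}" "bdd_below A"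
  shows "Inf ((\<lambda>t. c * t) ` A) = c * Inf A"
proof (rule cInf_eq_non_empty)
  show "(\<lambda>t. c * t) ` A \<noteq> {}" using assms(2) by simp
  show "c * Inf A \<le> x" if "x \<in> (\<lambda>t. c * t) ` A" for x
    using that cInf_lower[OF _ assms(3)] assms(1) by auto
  show "y \<le> c * Inf A" if "\<And>x. x \<in> (\<lambda>t. c * t) ` A \<Longrightarrow> y \<le> x" for y
  proof -
    have "y / c \<le> Inf A"
      using that assms(1) by (intro cInf_greatest[OF assms(2)]) (auto simp: field_simps)
    then show ?thesis using assms(1) by (simp add: field_simps)
  qed
qed

lemma count_set_nonempty:
  assumes "infinite (UNIV :: 'm set)" "\<And>t. finite {m :: 'm. L m \<le> t}"
  shows "{t::real. card {m. L m \<le> t} > n} \<noteq> {}"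
proof -
  obtain B :: "'m set" where B: "finite B" "card B = Suc n"
    using infinite_arbitrarily_large[OF assms(1)] by blast
  have "B \<subseteq> {m. L m \<le> Max (L ` B)}" using B(1) by auto
  from card_mono[OF assms(2) this] B(2) have "card {m. L m \<le> Max (L ` B)} > n" by simp
  then show ?thesis by blast
qed

lemma count_set_bdd_below:
  assumes "\<And>m. 0 \<le> L m"
  shows "bdd_below {t::real. card {m. L m \<le> t} > n}"
proof (rule bdd_belowI)
  fix t assume "t \<in> {t. card {m. L m \<le> t} > n}"
  then have "{m. L m \<le> t} \<noteq> {}" by (metis card.empty mem_Collect_eq not_less_zero)
  then show "0 \<le> t" using assms order_trans by blast
qed

lemma nth_level_le:
  assumes "\<And>m. 0 \<le> L m" "card {m. L m \<le> t} > n"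
  shows "nth_level L n \<le> t"
  unfolding nth_level_def using assms by (intro cInf_lower count_set_bdd_below) auto

lemma nth_level_ge:
  assumes "infinite (UNIV :: 'm set)" "\<And>t. finite {m :: 'm. L m \<le> t}" "card {m. L m \<le> t} \<le> n"
  shows "t \<le> nth_level L n"
  unfolding nth_level_def
proof (rule cInf_greatest[OF count_set_nonempty[OF assms(1,2)]])
  fix s assume s: "s \<in> {t. card {m. L m \<le> t} > n}"
  show "t \<le> s"
  proof (rule ccontr)
    assume "\<not> t \<le> s"
    then have "card {m. L m \<le> s} \<le> card {m. L m \<le> t}"
      by (intro card_mono assms(2)) auto
    with s assms(3) show False by simp
  qed
qed

text \<open>The tightness assumption keeps levels from coming down from infinity.\<close>
lemma nth_level_tendsto:
  fixes L :: "'m \<Rightarrow> real" and M :: "nat \<Rightarrow> 'm \<Rightarrow> real"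
  assumes inf: "infinite (UNIV :: 'm set)"
    and L: "\<And>m. 0 \<le> L m" "\<And>t. finite {m. L m \<le> t}"
    and M: "\<forall>\<^sub>F N in sequentially. (\<forall>m. 0 \<le> M N m) \<and> (\<forall>t. finite {m. M N m \<le> t})"
    and lim: "\<And>m. (\<lambda>N. M N m) \<longlonglongrightarrow> L m"
    and tight: "\<And>C. \<exists>B. finite B \<and> (\<forall>\<^sub>F N in sequentially. \<forall>m. m \<notin> B \<longrightarrow> M N m > C)"
  shows "(\<lambda>N. nth_level (M N) n) \<longlonglongrightarrow> nth_level L n"
proof (rule tendstoI)
  fix e :: real assume e: "e > 0"
  define F where "F = nth_level L n"
  obtain t where t: "t < F + e / 2" "card {m. L m \<le> t} > n"
    using cInf_lessD[OF count_set_nonempty[OF inf L(2)], of n "F + e / 2"] e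
    unfolding F_def nth_level_def by auto
  \<comment> \<open>Strictly below the limit value, so at most n limit levels lie at or below
    \<open>s\<close>.\<close>
  define s where "s = F - e / 2"
  have s: "card {m. L m \<le> s} \<le> n"
    using nth_level_le[of L n s] L(1) e by (force simp: s_def F_def)
  obtain B where B: "finite B" "\<forall>\<^sub>F N in sequentially. \<forall>m. m \<notin> B \<longrightarrow> M N m > s"
    using tight by blast
  have "\<forall>\<^sub>F N in sequentially. \<forall>m\<in>{m. L m \<le> t}. M N m < t + e / 2"
    using L(2) e by (intro eventually_ball_finite ballI order_tendstoD(2)[OF lim]) auto
  moreover have "\<forall>\<^sub>F N in sequentially. \<forall>m\<in>B - {m. L m \<le> s}. s < M N m"
    using B(1) by (intro eventually_ball_finite ballI order_tendstoD(1)[OF lim]) auto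
  ultimately show "\<forall>\<^sub>F N in sequentially. dist (nth_level (M N) n) (nth_level L n) < e"
    using M B(2)
  proof eventually_elim
    case (elim N)
    have "card {m. L m \<le> t} \<le> card {m. M N m \<le> t + e / 2}"
      using elim by (intro card_mono) (auto intro: less_imp_le)
    then have "nth_level (M N) n \<le> t + e / 2"
      using t(2) elim by (intro nth_level_le) auto
    moreover have "s \<le> nth_level (M N) n"
    proof (rule nth_level_ge[OF inf])
      \<comment> \<open>Indices outside \<open>B\<close> exceed \<open>s\<close> by tightness, and
        those in \<open>B\<close> whose limit level exceeds \<open>s\<close> do so by
        convergence.\<close>
      have "{m. M N m \<le> s} \<subseteq> {m. L m \<le> s}" using elim by force
      from card_mono[OF L(2) this] s show "card {m. M N m \<le> s} \<le> n" by simp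
    qed (use elim in auto)
    ultimately show ?case using t(1) e by (simp add: dist_real_def s_def F_def)
  qed
qed

section \<open>The eigenvalues of the lattice operator\<close>

text \<open>Integer squares summing to 1 have exactly one nonzero term, and that term is 1.\<close>

lemma nbrs_eq: "nbrs x = (\<lambda>i. x + axis i 1) ` UNIV \<union> (\<lambda>i. x - axis i 1) ` UNIV"
  for x :: "int ^ 'd"
proof (intro set_eqI iffI)
  fix y assume "y \<in> nbrs x"
  define z where "z = x - y"
  have s: "(\<Sum>i\<in>UNIV. (z $ i)\<^sup>2) = 1"
    using \<open>y \<in> nbrs x\<close> by (simp add: nbrs_def sqnorm_int_def z_def)
  then obtain i where i: "z $ i \<noteq> 0"
    by (metis (no_types, lifting) power2_eq_square mult_zero_left sum.neutral zero_neq_one)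
  have split: "(z $ i)\<^sup>2 + (\<Sum>j\<in>UNIV - {i}. (z $ j)\<^sup>2) = 1"
    using s sum.remove[of UNIV i "\<lambda>j. (z $ j)\<^sup>2"] by simp
  have nn: "0 \<le> (\<Sum>j\<in>UNIV - {i}. (z $ j)\<^sup>2)" by (intro sum_nonneg) auto
  moreover have "0 < (z $ i)\<^sup>2" using i by simp
  ultimately have zi: "(z $ i)\<^sup>2 = 1" and "(\<Sum>j\<in>UNIV - {i}. (z $ j)\<^sup>2) = 0" using split by linarith+
  then have "z $ j = 0" if "j \<noteq> i" for j using that by (simp add: sum_nonneg_eq_0_iff)
  moreover have "z $ i = 1 \<or> z $ i = - 1" using zi by (simp add: power2_eq_1_iff)
  ultimately have "z = axis i 1 \<or> z = - axis i 1"
    by (auto simp: vec_eq_iff axis_def)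
  moreover have "y = x - z" by (simp add: z_def)
  ultimately have "y = x - axis i 1 \<or> y = x + axis i 1" by auto
  then show "y \<in> (\<lambda>i. x + axis i 1) ` UNIV \<union> (\<lambda>i. x - axis i 1) ` UNIV" by blast
next
  have "sqnorm_int (axis i 1 :: int ^ 'd) = 1" "sqnorm_int (- axis i 1 :: int ^ 'd) = 1" for i
    by (simp_all add: sqnorm_int_def axis_def if_distrib[of "\<lambda>z. z\<^sup>2"] cong: if_cong)
  then show "y \<in> nbrs x" if "y \<in> (\<lambda>i. x + axis i 1) ` UNIV \<union> (\<lambda>i. x - axis i 1) ` UNIV" for y
    using that by (auto simp: nbrs_def)
qed

lemma sum_nbrs:
  fixes F :: "int ^ 'd \<Rightarrow> 'a::comm_monoid_add"
  shows "(\<Sum>y\<in>nbrs x. F y) = (\<Sum>i\<in>UNIV. F (x + axis i 1) + F (x - axis i 1))"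
proof -
  have ne: "x + axis i 1 \<noteq> x - axis j 1" for i j
  proof
    assume "x + axis i 1 = x - axis j 1"
    then have "(x + axis i 1) $ i = (x - axis j 1) $ i" by simp
    then show False by (simp add: axis_def split: if_splits)
  qed
  have inj: "inj (\<lambda>i. x + axis i (1::int))" "inj (\<lambda>i. x - axis i (1::int))"
    by (auto simp: inj_on_def axis_eq_axis)
  have "(\<Sum>y\<in>nbrs x. F y) = (\<Sum>y\<in>(\<lambda>i. x + axis i 1) ` UNIV. F y) + (\<Sum>y\<in>(\<lambda>i. x - axis i 1) ` UNIV. F y)"
    unfolding nbrs_eq using ne by (intro sum.union_disjoint) auto
  then show ?thesis
    using inj by (simp add: sum.reindex o_def sum.distrib)
qed

lemma infinite_UNIV_nat_vec: "infinite (UNIV :: (nat ^ 'd) set)"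
proof
  assume "finite (UNIV :: (nat ^ 'd) set)"
  then have "finite ((\<lambda>m :: nat ^ 'd. m $ undefined) ` UNIV)" by (rule finite_imageI)
  moreover have "k \<in> (\<lambda>m :: nat ^ 'd. m $ undefined) ` UNIV" for k
    by (rule image_eqI[of _ _ "\<chi> i. k"]) auto
  then have "(\<lambda>m :: nat ^ 'd. m $ undefined) ` UNIV = UNIV" by blast
  ultimately show False by simp
qed

text \<open>The lattice spacing parameter: with \<open>b\<^sub>i = N\<^bsup>1+\<gamma>\<^esup> / \<omega>\<^sub>i\<close> the operator separates into
  one-dimensional oscillators, up to the overall factor \<open>\<lambda>\<^sub>N\<close>.\<close>
definition spacing :: "real ^ 'd \<Rightarrow> real \<Rightarrow> nat \<Rightarrow> 'd \<Rightarrow> real" where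
  "spacing \<omega> \<gamma> N i = real N powr (1 + \<gamma>) / \<omega> $ i"

context
  fixes \<omega> :: "real ^ 'd" and \<gamma> :: real and N :: nat
  assumes \<omega>: "\<And>i. \<omega> $ i > 0" and N: "N > 0"
begin

lemma spacing_pos: "spacing \<omega> \<gamma> N i > 0"
  using \<omega> N by (simp add: spacing_def)

text \<open>The exponents match because N^(1-\<gamma>) N^(1+\<gamma>) = N^2 gives the kinetic factor
  and N^(2(1-\<gamma>)) / N^2 = N^(1-\<gamma>) / N^(1+\<gamma>) the potential one.\<close>

lemma lattice_operator_separates:
  fixes F :: "int ^ 'd \<Rightarrow> real"
  shows "(real N)\<^sup>2 / 2 * (\<Sum>y\<in>nbrs x. F x - F y)
      + real N powr (2 * (1 - \<gamma>)) * Vharm \<omega> ((1 / real N) *\<^sub>R lattice_pt x) * F x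
    = real N powr (1 - \<gamma>) * osc_vec (vec_nth \<omega>) (spacing \<omega> \<gamma> N) F x"
proof -
  have p1: "real N powr (1 - \<gamma>) * real N powr (1 + \<gamma>) = (real N)\<^sup>2"
    using N by (simp add: powr_add[symmetric])
  have p2: "real N powr (2 * (1 - \<gamma>)) / (real N)\<^sup>2 = real N powr (1 - \<gamma>) / real N powr (1 + \<gamma>)"
  proof -
    have "real N powr (2 * (1 - \<gamma>)) = real N powr (1 - \<gamma>) * real N powr (1 - \<gamma>)"
      by (simp add: powr_add[symmetric])
    then show ?thesis using N by (simp add: p1[symmetric])
  qed
  have summand: "(real N)\<^sup>2 / 2 * ((F x - F (x + axis i 1)) + (F x - F (x - axis i 1)))
      + real N powr (2 * (1 - \<gamma>)) * (1 / 2 * ((\<omega> $ i)\<^sup>2 * (1 / real N * real_of_int (x $ i))\<^sup>2)) * F x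
    = real N powr (1 - \<gamma>) * (\<omega> $ i * (spacing \<omega> \<gamma> N i / 2 * (2 * F x - F (x + axis i 1) - F (x - axis i 1))
       + (of_int (x $ i))\<^sup>2 / (2 * spacing \<omega> \<gamma> N i) * F x))" for i
  proof -
    have kin: "real N powr (1 - \<gamma>) * (\<omega> $ i * (spacing \<omega> \<gamma> N i / 2)) = (real N)\<^sup>2 / 2"
      using \<omega>[of i] by (simp add: spacing_def p1[symmetric])
    have "real N powr (1 - \<gamma>) * (\<omega> $ i * ((of_int (x $ i))\<^sup>2 / (2 * spacing \<omega> \<gamma> N i)))
        = real N powr (1 - \<gamma>) / real N powr (1 + \<gamma>) * ((\<omega> $ i)\<^sup>2 * (of_int (x $ i))\<^sup>2 / 2)"
      by (simp add: spacing_def power2_eq_square mult_ac)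
    also have "\<dots> = real N powr (2 * (1 - \<gamma>)) * (1 / 2 * ((\<omega> $ i)\<^sup>2 * (1 / real N * real_of_int (x $ i))\<^sup>2))"
      by (simp add: p2[symmetric] power_mult_distrib power_divide)
    finally have pot: "real N powr (1 - \<gamma>) * (\<omega> $ i * ((of_int (x $ i))\<^sup>2 / (2 * spacing \<omega> \<gamma> N i)))
      = real N powr (2 * (1 - \<gamma>)) * (1 / 2 * ((\<omega> $ i)\<^sup>2 * (1 / real N * real_of_int (x $ i))\<^sup>2))" .
    show ?thesis
      unfolding kin[symmetric] pot[symmetric] by (simp add: field_simps)
  qed
  show ?thesis
    unfolding osc_vec_def sum_distrib_left summand[symmetric] sum_nbrs Vharm_def lattice_pt_def
    by (simp add: sum.distrib sum_distrib_left sum_distrib_right mult_ac)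
qed

text \<open>The coefficients of \<open>HN\<close> are real, so real and imaginary parts of a complex
  eigenfunction solve the equation separately and the real theory applies to each.\<close>

lemma HN_Re: "Re (HN \<omega> \<gamma> N f x)
    = real N powr (1 - \<gamma>) * osc_vec (vec_nth \<omega>) (spacing \<omega> \<gamma> N) (\<lambda>x. Re (f x)) x"
  unfolding lattice_operator_separates[symmetric] HN_def by (simp add: Re_sum)

lemma HN_Im: "Im (HN \<omega> \<gamma> N f x)
    = real N powr (1 - \<gamma>) * osc_vec (vec_nth \<omega>) (spacing \<omega> \<gamma> N) (\<lambda>x. Im (f x)) x"
  unfolding lattice_operator_separates[symmetric] HN_def by (simp add: Im_sum)

abbreviation (input) "lvl \<equiv> level (vec_nth \<omega>) (spacing \<omega> \<gamma> N)"
abbreviation (input) "lam \<equiv> real N powr (1 - \<gamma>)"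

lemma lam_pos: "lam > 0" using N by simp

lemma level_nonneg: "0 \<le> lvl m"
  unfolding level_def
  by (intro sum_nonneg mult_nonneg_nonneg less_imp_le[OF \<omega>] ev_nonneg spacing_pos)

lemmas Psi_facts = ip_Psi[where b = "spacing \<omega> \<gamma> N", OF spacing_pos]
  sqs_Psi[where b = "spacing \<omega> \<gamma> N", OF spacing_pos]
  osc_vec_Psi[where b = "spacing \<omega> \<gamma> N" and w = "vec_nth \<omega>", OF spacing_pos]
  finite_level[where b = "spacing \<omega> \<gamma> N" and w = "vec_nth \<omega>", OF \<omega> spacing_pos]

lemma is_eigenfun_Psi:
  "is_eigenfun \<omega> \<gamma> N (lam * lvl m) (\<lambda>x. complex_of_real (Psi (spacing \<omega> \<gamma> N) m x))"
  (is "is_eigenfun _ _ _ _ ?f")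
  unfolding is_eigenfun_def
proof (intro conjI allI)
  show "?f \<in> l2" using Psi_facts(2) by (simp add: l2_def sqs_def)
  show "?f \<noteq> (\<lambda>_. 0)"
  proof
    assume "?f = (\<lambda>_. 0)"
    then have "Psi (spacing \<omega> \<gamma> N) m = (\<lambda>_. 0)" by (simp add: fun_eq_iff)
    then show False using Psi_facts(1)[of m m] by simp
  qed
  show "HN \<omega> \<gamma> N ?f x = complex_of_real (lam * lvl m) * ?f x" for x
    by (rule complex_eqI) (simp_all add: HN_Re HN_Im Psi_facts(3), simp add: osc_vec_def)
qed

lemma eigenfun_span:
  assumes "is_eigenfun \<omega> \<gamma> N \<mu> f" "\<mu> \<le> t"
  obtains a where "\<And>x. f x = (\<Sum>m | lam * lvl m \<le> t. a m * complex_of_real (Psi (spacing \<omega> \<gamma> N) m x))"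
proof -
  have f: "(\<lambda>x. (norm (f x))\<^sup>2) summable_on UNIV" "\<And>x. HN \<omega> \<gamma> N f x = complex_of_real \<mu> * f x"
    using assms by (auto simp: is_eigenfun_def l2_def)
  have s: "sqs (\<lambda>x. Re (f x))" "sqs (\<lambda>x. Im (f x))"
    unfolding sqs_def
    by (rule summable_on_dominated[OF f(1)], simp add: cmod_power2)+
  have M: "{m. lam * lvl m \<le> t} = {m. lvl m \<le> t / lam}"
    using lam_pos by (simp add: field_simps)
  have mu: "\<mu> / lam \<le> t / lam" using assms(2) lam_pos by (simp add: divide_right_mono)
  have re: "osc_vec (vec_nth \<omega>) (spacing \<omega> \<gamma> N) (\<lambda>x. Re (f x)) x = \<mu> / lam * Re (f x)" for x
    using HN_Re[of f x] f(2)[of x] lam_pos by (simp add: field_simps)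
  have im: "osc_vec (vec_nth \<omega>) (spacing \<omega> \<gamma> N) (\<lambda>x. Im (f x)) x = \<mu> / lam * Im (f x)" for x
    using HN_Im[of f x] f(2)[of x] lam_pos by (simp add: field_simps)
  show ?thesis
  proof (rule that)
    fix x
    show "f x = (\<Sum>m | lam * lvl m \<le> t.
        Complex (ip (\<lambda>x. Re (f x)) (Psi (spacing \<omega> \<gamma> N) m)) (ip (\<lambda>x. Im (f x)) (Psi (spacing \<omega> \<gamma> N) m))
        * complex_of_real (Psi (spacing \<omega> \<gamma> N) m x))"
      unfolding M
      using eigenfunction_expansion[where w = "vec_nth \<omega>", OF \<omega> spacing_pos s(1) re mu, of x]
        eigenfunction_expansion[where w = "vec_nth \<omega>", OF \<omega> spacing_pos s(2) im mu, of x]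
      by (intro complex_eqI) (simp_all add: Re_sum Im_sum)
  qed
qed

text \<open>All eigenfunctions with eigenvalue at most \<open>t\<close> lie in the span of the
  products with levels at most \<open>t\<close>, where more than \<open>card ?M\<close> functions
  are dependent. Conversely the products are independent by orthonormality.\<close>

lemma eigenfunction_count:
  "(\<exists>S. lin_indep S \<and> card S > n \<and> (\<forall>f\<in>S. \<exists>\<mu>\<le>t. is_eigenfun \<omega> \<gamma> N \<mu> f))
    \<longleftrightarrow> card {m. lam * lvl m \<le> t} > n"
proof
  let ?M = "{m. lam * lvl m \<le> t}"
  let ?P = "\<lambda>m x. complex_of_real (Psi (spacing \<omega> \<gamma> N) m x)"
  have M: "?M = {m. lvl m \<le> t / lam}" using lam_pos by (simp add: field_simps)
  have fin: "finite ?M" unfolding M by (rule Psi_facts(4))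
  show "card ?M > n" if "\<exists>S. lin_indep S \<and> card S > n \<and> (\<forall>f\<in>S. \<exists>\<mu>\<le>t. is_eigenfun \<omega> \<gamma> N \<mu> f)"
  proof (rule ccontr)
    assume "\<not> card ?M > n"
    from that obtain S where S: "lin_indep S" "card S > n" "\<forall>f\<in>S. \<exists>\<mu>\<le>t. is_eigenfun \<omega> \<gamma> N \<mu> f"
      by blast
    have "\<forall>f\<in>S. \<exists>a. \<forall>x. f x = (\<Sum>m\<in>?M. a m * ?P m x)"
    proof
      fix f assume "f \<in> S"
      then obtain \<mu> where "is_eigenfun \<omega> \<gamma> N \<mu> f" "\<mu> \<le> t" using S(3) by blast
      from eigenfun_span[OF this] show "\<exists>a. \<forall>x. f x = (\<Sum>m\<in>?M. a m * ?P m x)" by blast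
    qed
    from bchoice[OF this] obtain a where "\<forall>f\<in>S. \<forall>x. f x = (\<Sum>m\<in>?M. a f m * ?P m x)" by blast
    then have a: "\<And>f x. f \<in> S \<Longrightarrow> f x = (\<Sum>m\<in>?M. a f m * ?P m x)" by blast
    have "card ?M < card S" using \<open>\<not> card ?M > n\<close> S(2) by simp
    moreover have "finite S" using S(1) by (simp add: lin_indep_def)
    ultimately obtain c where c: "\<exists>f\<in>S. c f \<noteq> 0" "\<And>m. m \<in> ?M \<Longrightarrow> (\<Sum>f\<in>S. c f * a f m) = 0"
      using homogeneous_system_nontrivial[OF fin, of S a] by blast
    have "(\<Sum>f\<in>S. c f * f x) = 0" for x
    proof -
      have "(\<Sum>f\<in>S. c f * f x) = (\<Sum>f\<in>S. \<Sum>m\<in>?M. c f * a f m * ?P m x)"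
        by (rule sum.cong) (simp_all add: a sum_distrib_left mult.assoc)
      also have "\<dots> = (\<Sum>m\<in>?M. \<Sum>f\<in>S. c f * a f m * ?P m x)" by (rule sum.swap)
      also have "\<dots> = (\<Sum>m\<in>?M. (\<Sum>f\<in>S. c f * a f m) * ?P m x)" by (simp only: sum_distrib_right)
      also have "\<dots> = 0" using c(2) by simp
      finally show ?thesis .
    qed
    then show False using S(1) c(1) unfolding lin_indep_def by blast
  qed
  show "\<exists>S. lin_indep S \<and> card S > n \<and> (\<forall>f\<in>S. \<exists>\<mu>\<le>t. is_eigenfun \<omega> \<gamma> N \<mu> f)" if "card ?M > n"
  proof (intro exI conjI)
    \<comment> \<open>\<open>lin_indep\<close> and \<open>card\<close> see a set of functions, so
      distinct indices must give distinct products; otherwise multiplicity would be lost.\<close>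
    have inj: "inj ?P"
    proof (rule injI)
      fix m m' assume "?P m = ?P m'"
      then have "Psi (spacing \<omega> \<gamma> N) m = Psi (spacing \<omega> \<gamma> N) m'" by (auto simp: fun_eq_iff)
      then show "m = m'" using Psi_facts(1)[of m m] Psi_facts(1)[of m m'] by (simp split: if_splits)
    qed
    then have inj': "inj_on ?P ?M" by (rule inj_on_subset) simp
    show "card (?P ` ?M) > n" using that card_image[OF inj'] by simp
    show "\<forall>f\<in>?P ` ?M. \<exists>\<mu>\<le>t. is_eigenfun \<omega> \<gamma> N \<mu> f" using is_eigenfun_Psi by blast
    \<comment> \<open>\<open>ip\<close> is real, so complex coefficients are tested through their
      real and imaginary parts.\<close>
    have real_indep: "d m = 0" if "\<And>x. (\<Sum>m\<in>?M. d m * Psi (spacing \<omega> \<gamma> N) m x) = 0" "m \<in> ?M"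
      for d :: "nat ^ 'd \<Rightarrow> real" and m
    proof -
      have "0 = ip (\<lambda>x. \<Sum>m\<in>?M. d m * Psi (spacing \<omega> \<gamma> N) m x) (Psi (spacing \<omega> \<gamma> N) m)"
        using that(1) by simp
      also have "\<dots> = (\<Sum>m'\<in>?M. d m' * ip (Psi (spacing \<omega> \<gamma> N) m') (Psi (spacing \<omega> \<gamma> N) m))"
        unfolding ip_scale_left[symmetric] using Psi_facts(2) by (intro ip_sum_left sqs_scale) auto
      also have "\<dots> = (\<Sum>m'\<in>?M. if m' = m then d m' else 0)"
        by (rule sum.cong) (simp_all add: Psi_facts(1))
      also have "\<dots> = d m" using that(2) fin by simp
      finally show ?thesis by simp
    qed
    show "lin_indep (?P ` ?M)"
      unfolding lin_indep_def
    proof (intro conjI allI impI ballI)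
      show "finite (?P ` ?M)" using fin by simp
      fix c g assume c: "\<forall>x. (\<Sum>g\<in>?P ` ?M. c g * g x) = 0" and "g \<in> ?P ` ?M"
      then obtain m where m: "m \<in> ?M" "g = ?P m" by blast
      have *: "(\<Sum>m\<in>?M. c (?P m) * ?P m x) = 0" for x
        using c[rule_format, of x] by (simp add: sum.reindex[OF inj'])
      have "(\<Sum>m\<in>?M. Re (c (?P m)) * Psi (spacing \<omega> \<gamma> N) m x) = 0"
        "(\<Sum>m\<in>?M. Im (c (?P m)) * Psi (spacing \<omega> \<gamma> N) m x) = 0" for x
        using arg_cong[OF *[of x], of Re] arg_cong[OF *[of x], of Im] by (simp_all add: Re_sum Im_sum)
      then have "Re (c (?P m)) = 0" "Im (c (?P m)) = 0"
        using real_indep[of "\<lambda>m. Re (c (?P m))" m] real_indep[of "\<lambda>m. Im (c (?P m))" m] m(1) by auto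
      then show "c g = 0" unfolding m(2) by (rule complex_eqI[of _ 0, simplified])
    qed
  qed
qed

lemma En_eq: "En \<omega> \<gamma> N n / lam = nth_level lvl n"
proof -
  have "{t. card {m. lam * lvl m \<le> t} > n} = (\<lambda>t. lam * t) ` {t. card {m. lvl m \<le> t} > n}"
  proof -
    have eq: "{m. lam * lvl m \<le> t} = {m. lvl m \<le> t / lam}" for t
      using lam_pos by (simp add: field_simps)
    show ?thesis unfolding eq
    proof (intro set_eqI iffI)
      fix t assume "t \<in> {t. card {m. lvl m \<le> t / lam} > n}"
      then show "t \<in> (\<lambda>t. lam * t) ` {t. card {m. lvl m \<le> t} > n}"
        using lam_pos by (intro image_eqI[of _ _ "t / lam"]) auto
    qed (use lam_pos in auto)
  qed
  then have "En \<omega> \<gamma> N n = Inf ((\<lambda>t. lam * t) ` {t. card {m. lvl m \<le> t} > n})"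
    unfolding En_def eigenfunction_count by simp
  also have "\<dots> = lam * nth_level lvl n"
    unfolding nth_level_def using lam_pos infinite_UNIV_nat_vec Psi_facts(4) level_nonneg
    by (intro Inf_scale count_set_nonempty count_set_bdd_below) auto
  finally show ?thesis using lam_pos by simp
qed

end

section \<open>Harmonic levels and the passage to the limit\<close>

lemma harm_level_eq: "harm_level \<omega> m = (\<Sum>i\<in>UNIV. \<omega> $ i * (real (m $ i) + 1 / 2))"
  unfolding harm_level_def sum_distrib_left by (rule sum.cong) (simp_all add: algebra_simps)

lemma e_harm_eq: "e_harm \<omega> n = nth_level (harm_level \<omega>) n"
  by (simp add: e_harm_def nth_level_def)

lemma finite_harm_level:
  fixes \<omega> :: "real ^ 'd"
  assumes \<omega>: "\<And>i. \<omega> $ i > 0"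
  shows "finite {m. harm_level \<omega> m \<le> t}"
proof -
  define K where "K = nat \<lceil>Max (range (\<lambda>i. t / \<omega> $ i))\<rceil> + 1"
  have "m $ i < K" if "harm_level \<omega> m \<le> t" for m i
  proof -
    have "\<omega> $ i * (real (m $ i) + 1 / 2) \<le> harm_level \<omega> m"
      unfolding harm_level_eq using \<omega>
      by (intro member_le_sum) (auto intro!: mult_nonneg_nonneg less_imp_le)
    with that have "real (m $ i) + 1 / 2 \<le> t / \<omega> $ i"
      using \<omega>[of i] by (simp add: pos_le_divide_eq mult.commute)
    also have "\<dots> \<le> Max (range (\<lambda>i. t / \<omega> $ i))" by (rule Max_ge) auto
    finally show ?thesis unfolding K_def by linarith
  qed
  then have "{m. harm_level \<omega> m \<le> t} \<subseteq> {m. \<forall>i. m $ i < K}" by blast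
  then show ?thesis using finite_box finite_subset by blast
qed

lemma spacing_at_top:
  assumes "\<omega> $ i > 0" "\<gamma> > - 1"
  shows "filterlim (\<lambda>N. spacing \<omega> \<gamma> N i) at_top sequentially"
proof -
  have "1 + \<gamma> > 0" using assms(2) by simp
  then have "filterlim (\<lambda>N. real N powr (1 + \<gamma>) / c) at_top sequentially" if "c > 0" for c :: real
    using that by real_asymp
  then show ?thesis using assms(1) unfolding spacing_def .
qed

theorem theorem2p1:
  fixes \<omega> :: "real ^ 'd" and \<gamma> :: real and n :: nat
  assumes "\<forall>i. \<omega> $ i > 0"
    and "\<gamma> > -1"
  shows "(\<lambda>N. En \<omega> \<gamma> N n / (real N powr (1 - \<gamma>))) \<longlonglongrightarrow> e_harm \<omega> n"
proof -
  define M where "M N = level (vec_nth \<omega>) (spacing \<omega> \<gamma> N)" for N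
  have \<omega>: "\<And>i. \<omega> $ i > 0" using assms(1) by blast
  \<comment> \<open>At N = 0 the spacing is 0 and the oscillator theory does not apply; the limit
    ignores this term.\<close>
  have pos: "\<forall>\<^sub>F N in sequentially. N > (0::nat)" by (rule eventually_gt_at_top)
  have ev_lim: "(\<lambda>N. ev (spacing \<omega> \<gamma> N i) k) \<longlonglongrightarrow> real k + 1 / 2" for i k
    by (rule filterlim_compose[OF ev_tendsto spacing_at_top[OF \<omega> assms(2)]])
  have "(\<lambda>N. nth_level (M N) n) \<longlonglongrightarrow> nth_level (harm_level \<omega>) n"
  proof (rule nth_level_tendsto)
    show "infinite (UNIV :: (nat ^ 'd) set)"
      using infinite_UNIV_nat_vec by blast
    show "0 \<le> harm_level \<omega> m" for m
      unfolding harm_level_eq using \<omega> by (intro sum_nonneg mult_nonneg_nonneg less_imp_le) auto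
    show "finite {m. harm_level \<omega> m \<le> t}" for t by (rule finite_harm_level[OF \<omega>])
    show "\<forall>\<^sub>F N in sequentially. (\<forall>m. 0 \<le> M N m) \<and> (\<forall>t. finite {m. M N m \<le> t})"
      using pos
    proof eventually_elim
      case (elim N)
      show ?case
        unfolding M_def using level_nonneg[OF \<omega> elim] Psi_facts(4)[OF \<omega> elim] by blast
    qed
    show "(\<lambda>N. M N m) \<longlonglongrightarrow> harm_level \<omega> m" for m
      unfolding M_def level_def harm_level_eq
      by (intro tendsto_sum tendsto_mult tendsto_const ev_lim)
    show "\<exists>B. finite B \<and> (\<forall>\<^sub>F N in sequentially. \<forall>m. m \<notin> B \<longrightarrow> M N m > C)" for C
    proof -
      \<comment> \<open>Outside the box some index is at least K. Monotonicity of \<open>ev\<close>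
        in the index then reduces tightness over infinitely many levels to one limit per coordinate,
        at index K, where the harmonic value already exceeds C.\<close>
      define K where "K = nat \<lceil>Max (range (\<lambda>i. C / \<omega> $ i))\<rceil>"
      have K: "\<omega> $ i * (real K + 1 / 2) > C" for i
      proof -
        have "C / \<omega> $ i \<le> Max (range (\<lambda>i. C / \<omega> $ i))" by (rule Max_ge) auto
        then have "C / \<omega> $ i < real K + 1 / 2" unfolding K_def by linarith
        then show ?thesis using \<omega>[of i] by (simp add: pos_divide_less_eq mult.commute)
      qed
      have "(\<lambda>N. \<omega> $ i * ev (spacing \<omega> \<gamma> N i) K) \<longlonglongrightarrow> \<omega> $ i * (real K + 1 / 2)" for i
        by (intro tendsto_mult tendsto_const ev_lim)
      then have "\<forall>\<^sub>F N in sequentially. \<forall>i. \<omega> $ i * ev (spacing \<omega> \<gamma> N i) K > C"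
        by (intro eventually_all_finite order_tendstoD(1)[OF _ K])
      then have "\<forall>\<^sub>F N in sequentially. \<forall>m. m \<notin> {m. \<forall>i. m $ i < K} \<longrightarrow> M N m > C"
        using pos
      proof eventually_elim
        case (elim N)
        show ?case
        proof (intro allI impI)
          fix m :: "nat ^ 'd" assume "m \<notin> {m. \<forall>i. m $ i < K}"
          then obtain i where i: "K \<le> m $ i" by (auto simp: not_less)
          have b: "spacing \<omega> \<gamma> N j > 0" for j by (rule spacing_pos[OF \<omega> elim(2)])
          have "C < \<omega> $ i * ev (spacing \<omega> \<gamma> N i) K" using elim by blast
          also have "\<dots> \<le> \<omega> $ i * ev (spacing \<omega> \<gamma> N i) (m $ i)"
            using \<omega>[of i] ev_mono[OF b i] by (intro mult_left_mono) auto
          also have "\<dots> \<le> M N m"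
            unfolding M_def by (rule level_ge[where w = "vec_nth \<omega>", OF \<omega> b])
          finally show "C < M N m" .
        qed
      qed
      then show ?thesis using finite_box by blast
    qed
  qed
  moreover have "\<forall>\<^sub>F N in sequentially. nth_level (M N) n = En \<omega> \<gamma> N n / (real N powr (1 - \<gamma>))"
    using pos
  proof eventually_elim
    case (elim N)
    show ?case unfolding M_def by (rule En_eq[OF \<omega> elim, symmetric])
  qed
  ultimately show ?thesis
    unfolding e_harm_eq by (rule Lim_transform_eventually)
qed

end
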